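(* Let $\mathbb{B}$ be the weighted adjacency matrix of the line graph of a countable, simple, locally finite, weighted directed graph with edge index set $J$. Let $(c_j)_{j\in J}$ be real numbers such that $0<c_{\min}\le c_j\le c_{\max}<\infty$ for all $j\in J$ (for some constants $c_{\min},c_{\max}$), and assume there exists $0<c\in\mathbb{R}$ such that $\frac{c}{c_j}\in\mathbb{N}$ for all $j\in J$. Let $C=\mathrm{diag}(c_j)_{j\in J}$, $\mathbb{B}^C=C^{-1}\mathbb{B}C$ and $q=(q_j)_{j\in J}\in L^\infty([0,1],\ell^\infty)$. Then the flow problem $$\begin{cases}\frac{\partial}{\partial t}u_j(x,t)=c_j\frac{\partial}{\partial x}u_j(x,t)+q_j(x)u_j(x,t),& x\in(0,1),\ t\ge0,\\ u_j(1,t)=\sum_{k\in J}\mathbb{B}^C_{jk}u_k(0,t),& t\ge0,\\ u_j(x,0)=f_j(x),& x\in(0,1),\end{cases}\qquad j\in J,$$ is well-posed on $X=L^\infty([0,1],\ell^1)$; that is, the abstract Cauchy problem on $X$ for the operator $A(f_j)_{j\in J}=(c_jf_j'+q_jf_j)_{j\in J}$ with domain $D(A)=\{f\in W^{1,\infty}([0,1],\ell^1)\mid f(1)=\mathbb{B}^Cf(0)\}$ is well-posed with respect to the weak$^*$-topology.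
   Context: **Graph.** $G=(V,E)$ is a directed graph with vertices $V=\{v_i\mid i\in I\}$ and edges $E=\{e_j\mid j\in J\}\subseteq V\times V$, where $I,J\subseteq\mathbb{N}$. For an edge $(v_i,v_k)$, $v_i$ is its tail and $v_k$ its head. $G$ is simple (no loops or multiple edges) and locally finite (each vertex is incident with only finitely many edges). It carries weights $0\le w_{ij}\le 1$ ($i,j\in J$), with $w_{ij}\ne 0$ only if the head of $e_j$ is the tail of $e_i$, such that $\sum_{i\in J}w_{ij}=1$ for all $j\in J$. The matrix $\mathbb{B}=(\mathbb{B}_{ij})_{i,j\in J}$ is defined by $\mathbb{B}_{ij}=w_{ij}$ if the head of $e_j$ is the tail of $e_i$, and $\mathbb{B}_{ij}=0$ otherwise. It acts as a (column-)stochastic operator on $\ell^1=\ell^1(J)$; also $\ell^\infty=\ell^\infty(J)$. **Space.** $X=L^\infty([0,1],\ell^1)$ (Bochner space) has norm $\|f\|_X=\operatorname{ess\,sup}_{s\in[0,1]}\|f(s)\|_{\ell^1}$. It is identified with the dual of $L^1([0,1],c_0)$, $c_0=c_0(J)$, via $\langle f,g\rangle=\int_0^1\langle f(s),g(s)\rangle\,ds$; the weak$^*$-topology on $X$ is the one induced by this duality. $W^{1,\infty}([0,1],\ell^1)$ is the Sobolev space of functions in $X$ with weak derivative in $X$, evaluated at points through continuous representatives. **Well-posedness.** Let $\tau$ denote the weak$^*$-topology. The abstract Cauchy problem $\dot u(t)=Au(t)$ ($t\ge0$), $u(0)=f\in D(A)$, is well-posed in $X$ if: (i) for every $f\in D(A)$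 there is a solution $u(t)=u(t,f)$ with $u\in B_{loc}(\mathbb{R}_+,X)\cap C^1(\mathbb{R}_+,(X,\tau))$ and $\dot u\in B_{loc}(\mathbb{R}_+,X)$; (ii) the solution is unique; (iii) if $(f_n)\subseteq D(A)$ is norm-bounded and $\tau$-convergent to $0$, then the solutions $u(t,f_n)$ converge to $0$ in $\tau$ uniformly for $t$ in compact intervals $[0,t_0]$. Here $B_{loc}(\mathbb{R}_+,X)$ is the space of functions that are norm-bounded on each compact subset of $\mathbb{R}_+$, and differentiation is understood in the vector-valued sense with respect to $\tau$. *)

theory Defs
  imports
    "HOL-Analysis.Analysis"
    "HOL-Probability.Essential_Supremum"
    "Graph_Theory.Digraph"
begin

section \<open>The sequence spaces\<close>

typedef (overloaded) 'a ell1 = "{x :: nat \<Rightarrow> 'a::real_normed_vector. summable (\<lambda>j. norm (x j))}"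
  morphisms coord Abs_ell1
  by (rule exI[of _ "\<lambda>_. 0"]) simp

setup_lifting type_definition_ell1

lemma summable_coord: "summable (\<lambda>j. norm (coord x j))"
  using coord[of x] by simp

lemma ell1_eqI: "(\<And>j. coord x j = coord y j) \<Longrightarrow> x = y"
  by transfer auto

instantiation ell1 :: (real_normed_vector) real_normed_vector
begin

lift_definition zero_ell1 :: "'a ell1" is "\<lambda>_. 0"
  by simp

lift_definition plus_ell1 :: "'a ell1 \<Rightarrow> 'a ell1 \<Rightarrow> 'a ell1" is "\<lambda>x y j. x j + y j"
proof -
  fix x y :: "nat \<Rightarrow> 'a"
  assume "summable (\<lambda>j. norm (x j))" "summable (\<lambda>j. norm (y j))"
  from summable_add[OF this] show "summable (\<lambda>j. norm (x j + y j))"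
    by (rule summable_comparison_test') (auto intro: norm_triangle_ineq)
qed

lift_definition uminus_ell1 :: "'a ell1 \<Rightarrow> 'a ell1" is "\<lambda>x j. - x j"
  by simp

lift_definition minus_ell1 :: "'a ell1 \<Rightarrow> 'a ell1 \<Rightarrow> 'a ell1" is "\<lambda>x y j. x j - y j"
proof -
  fix x y :: "nat \<Rightarrow> 'a"
  assume "summable (\<lambda>j. norm (x j))" "summable (\<lambda>j. norm (y j))"
  from summable_add[OF this] show "summable (\<lambda>j. norm (x j - y j))"
    by (rule summable_comparison_test') (auto intro: norm_triangle_ineq4)
qed

lift_definition scaleR_ell1 :: "real \<Rightarrow> 'a ell1 \<Rightarrow> 'a ell1" is "\<lambda>r x j. r *\<^sub>R x j"
  by (simp add: summable_mult)

lift_definition norm_ell1 :: "'a ell1 \<Rightarrow> real" is "\<lambda>x. \<Sum>j. norm (x j)" .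

definition dist_ell1 :: "'a ell1 \<Rightarrow> 'a ell1 \<Rightarrow> real"
  where "dist_ell1 x y = norm (x - y)"

definition sgn_ell1 :: "'a ell1 \<Rightarrow> 'a ell1"
  where "sgn_ell1 x = inverse (norm x) *\<^sub>R x"

definition uniformity_ell1 :: "('a ell1 \<times> 'a ell1) filter"
  where "uniformity_ell1 = (INF e\<in>{0<..}. principal {(x, y). dist x y < e})"

definition open_ell1 :: "'a ell1 set \<Rightarrow> bool"
  where "open_ell1 U = (\<forall>x\<in>U. \<forall>\<^sub>F (x', y) in uniformity. x' = x \<longrightarrow> y \<in> U)"

instance
proof
  fix x y z :: "'a ell1" and a b :: real
  show "x + y + z = x + (y + z)" "x + y = y + x" "0 + x = x" "- x + x = 0" "x - y = x + - y"
    by (rule ell1_eqI, simp only: plus_ell1.rep_eq zero_ell1.rep_eq uminus_ell1.rep_eq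
        minus_ell1.rep_eq, simp add: algebra_simps)+
  show "a *\<^sub>R (x + y) = a *\<^sub>R x + a *\<^sub>R y" "(a + b) *\<^sub>R x = a *\<^sub>R x + b *\<^sub>R x"
    "a *\<^sub>R b *\<^sub>R x = (a * b) *\<^sub>R x" "1 *\<^sub>R x = x"
    by (rule ell1_eqI, simp only: plus_ell1.rep_eq scaleR_ell1.rep_eq, simp add: algebra_simps)+
  show "dist x y = norm (x - y)" by (rule dist_ell1_def)
  show "sgn x = inverse (norm x) *\<^sub>R x" by (simp add: sgn_ell1_def)
  show "(norm x = 0) = (x = 0)"
  proof
    assume "norm x = 0"
    then show "x = 0"
      using summable_coord[of x]
      by (intro ell1_eqI) (simp add: norm_ell1.rep_eq zero_ell1.rep_eq suminf_eq_zero_iff)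
  qed (simp add: norm_ell1.rep_eq zero_ell1.rep_eq)
  show "norm (x + y) \<le> norm x + norm y"
  proof -
    have "norm (x + y) \<le> (\<Sum>j. norm (coord x j) + norm (coord y j))"
      unfolding norm_ell1.rep_eq using summable_coord[of "x + y"]
      by (intro suminf_le summable_add summable_coord)
        (auto simp: plus_ell1.rep_eq intro: norm_triangle_ineq)
    then show ?thesis
      by (simp add: norm_ell1.rep_eq suminf_add[OF summable_coord summable_coord])
  qed
  show "norm (a *\<^sub>R x) = \<bar>a\<bar> * norm x"
    by (simp add: norm_ell1.rep_eq scaleR_ell1.rep_eq suminf_mult[OF summable_coord])
qed (rule uniformity_ell1_def open_ell1_def)+

end

lemma coord_simps [simp]:
  "coord 0 j = 0" "coord (x + y) j = coord x j + coord y j" "coord (- x) j = - coord x j"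
  "coord (x - y) j = coord x j - coord y j" "coord (r *\<^sub>R x) j = r *\<^sub>R coord x j"
  by (simp_all add: zero_ell1.rep_eq plus_ell1.rep_eq uminus_ell1.rep_eq minus_ell1.rep_eq
      scaleR_ell1.rep_eq)

lemma sum_coord_le_norm: "finite F \<Longrightarrow> (\<Sum>j\<in>F. norm (coord x j)) \<le> norm x"
  unfolding norm_ell1.rep_eq by (rule sum_le_suminf) (auto simp: summable_coord)

lemma norm_coord_le: "norm (coord x j) \<le> norm x"
  using sum_coord_le_norm[of "{j}" x] by simp

instance ell1 :: (banach) banach
proof
  fix X :: "nat \<Rightarrow> 'a ell1"
  assume X: "Cauchy X"
  have "Cauchy (\<lambda>n. coord (X n) j)" for j
  proof (rule metric_CauchyI)
    fix e :: real assume "0 < e"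
    with X obtain N where "\<forall>m\<ge>N. \<forall>n\<ge>N. norm (X m - X n) < e"
      by (metis CauchyD)
    moreover have "dist (coord (X m) j) (coord (X n) j) \<le> norm (X m - X n)" for m n
      using norm_coord_le[of "X m - X n" j] by (simp add: dist_norm)
    ultimately show "\<exists>N. \<forall>m\<ge>N. \<forall>n\<ge>N. dist (coord (X m) j) (coord (X n) j) < e"
      by (meson le_less_trans)
  qed
  then have "\<forall>j. \<exists>l. (\<lambda>n. coord (X n) j) \<longlonglongrightarrow> l"
    by (simp add: Cauchy_convergent_iff convergent_def)
  then obtain l where l: "\<And>j. (\<lambda>n. coord (X n) j) \<longlonglongrightarrow> l j"
    by metis
  have part: "\<exists>N. \<forall>m\<ge>N. \<forall>K. (\<Sum>j<K. norm (coord (X m) j - l j)) \<le> e" if "0 < e" for e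
  proof -
    from X \<open>0 < e\<close> obtain N where N: "\<forall>m\<ge>N. \<forall>n\<ge>N. norm (X m - X n) < e"
      by (metis CauchyD)
    have "(\<Sum>j<K. norm (coord (X m) j - l j)) \<le> e" if "m \<ge> N" for m K
    proof (rule LIMSEQ_le_const2)
      show "(\<lambda>n. \<Sum>j<K. norm (coord (X m) j - coord (X n) j)) \<longlonglongrightarrow> (\<Sum>j<K. norm (coord (X m) j - l j))"
        by (intro tendsto_intros l)
      show "\<exists>N. \<forall>n\<ge>N. (\<Sum>j<K. norm (coord (X m) j - coord (X n) j)) \<le> e"
      proof (intro exI[of _ N] allI impI)
        fix n assume "n \<ge> N"
        with N that have "norm (X m - X n) < e" by blast
        then show "(\<Sum>j<K. norm (coord (X m) j - coord (X n) j)) \<le> e"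
          using sum_coord_le_norm[of "{..<K}" "X m - X n"] by simp
      qed
    qed
    then show ?thesis by blast
  qed
  have summ: "summable (\<lambda>j. norm (coord (X m) j - l j))"
    and bd: "(\<Sum>j. norm (coord (X m) j - l j)) \<le> e"
    if "\<forall>K. (\<Sum>j<K. norm (coord (X m) j - l j)) \<le> e" for m e
  proof -
    show s: "summable (\<lambda>j. norm (coord (X m) j - l j))"
      using that by (intro bounded_imp_summable[of _ e]) (auto simp del: sum.lessThan_Suc simp: lessThan_Suc_atMost[symmetric])
    show "(\<Sum>j. norm (coord (X m) j - l j)) \<le> e"
      using that s by (intro suminf_le_const) auto
  qed
  from part[of 1] obtain M where "\<forall>K. (\<Sum>j<K. norm (coord (X M) j - l j)) \<le> 1"
    by auto
  from summ[OF this] have "summable (\<lambda>j. norm (coord (X M) j - l j))" .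
  from summable_add[OF this summable_coord[of "X M"]] have "summable (\<lambda>j. norm (l j))"
  proof (rule summable_comparison_test')
    show "norm (norm (l j)) \<le> norm (coord (X M) j - l j) + norm (coord (X M) j)" for j
      using norm_triangle_ineq4[of "coord (X M) j" "coord (X M) j - l j"] by simp
  qed
  then obtain L where L: "coord L = l"
    using Abs_ell1_inverse by blast
  have "X \<longlonglongrightarrow> L"
  proof (rule metric_LIMSEQ_I)
    fix e :: real assume "0 < e"
    with part[of "e/2"] obtain N
      where N: "\<And>m. m \<ge> N \<Longrightarrow> \<forall>K. (\<Sum>j<K. norm (coord (X m) j - l j)) \<le> e/2"
      by auto
    have "dist (X m) L < e" if "m \<ge> N" for m
      using bd[OF N[OF that]] \<open>0 < e\<close> by (simp add: dist_norm norm_ell1.rep_eq L)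
    then show "\<exists>N. \<forall>n\<ge>N. dist (X n) L < e" by blast
  qed
  then show "convergent X" by (auto simp: convergent_def)
qed

lift_definition ell1_of_list :: "'a::real_normed_vector list \<Rightarrow> 'a ell1"
  is "\<lambda>xs j. if j < length xs then xs ! j else 0"
  by (rule summable_finite[of "{..<length _}"]) auto

instance ell1 :: ("{real_normed_vector, second_countable_topology}") second_countable_topology
proof
  obtain Q :: "'a set" where Q: "countable Q" "\<And>U. open U \<Longrightarrow> U \<noteq> {} \<Longrightarrow> \<exists>d\<in>Q. d \<in> U"
    using countable_dense_exists by blast
  define D where "D = ell1_of_list ` lists Q"
  have "countable D"
    unfolding D_def using Q(1) by (intro countable_image countable_lists)
  have dense: "\<exists>d\<in>D. dist x d < e" if "0 < e" for x :: "'a ell1" and e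
  proof -
    have "(\<lambda>N. \<Sum>j. norm (coord x (j + N))) \<longlonglongrightarrow> 0"
      using suminf_exist_split2[OF summable_coord[of x]] .
    then have "\<forall>\<^sub>F N in sequentially. (\<Sum>j. norm (coord x (j + N))) < e/2"
      using \<open>0 < e\<close> by (intro order_tendstoD) auto
    then obtain N where N: "(\<Sum>j. norm (coord x (j + N))) < e/2"
      by (auto simp: eventually_sequentially)
    define \<delta> where "\<delta> = e / (2 * real (Suc N))"
    have "0 < \<delta>" using \<open>0 < e\<close> by (simp add: \<delta>_def)
    have "\<exists>d\<in>Q. d \<in> ball (coord x j) \<delta>" for j
      using \<open>0 < \<delta>\<close> by (intro Q(2)) auto
    then obtain a where a: "\<And>j. a j \<in> Q" "\<And>j. dist (coord x j) (a j) < \<delta>"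
      unfolding mem_ball by metis
    define d where "d = ell1_of_list (map a [0..<N])"
    have cd: "coord d j = (if j < N then a j else 0)" for j
      by (simp add: d_def ell1_of_list.rep_eq)
    have "norm (x - d) = (\<Sum>j. norm (coord (x - d) (j + N))) + (\<Sum>j<N. norm (coord (x - d) j))"
      unfolding norm_ell1.rep_eq by (rule suminf_split_initial_segment[OF summable_coord])
    also have "(\<Sum>j. norm (coord (x - d) (j + N))) = (\<Sum>j. norm (coord x (j + N)))"
      by (simp add: cd)
    also have "(\<Sum>j<N. norm (coord (x - d) j)) \<le> real (card {..<N}) * \<delta>"
      using a(2) by (intro sum_bounded_above) (auto simp: cd dist_norm less_imp_le)
    also have "real (card {..<N}) * \<delta> \<le> e/2"
      using \<open>0 < e\<close> by (simp add: \<delta>_def field_simps)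
    finally have "dist x d < e" using N by (simp add: dist_norm)
    moreover have "d \<in> D" using a(1) unfolding D_def d_def by (intro imageI) auto
    ultimately show ?thesis by blast
  qed
  define B where "B = (\<lambda>(d, n). ball d (1 / real (Suc n))) ` (D \<times> (UNIV :: nat set))"
  have "countable B" unfolding B_def using \<open>countable D\<close> by auto
  moreover have "topological_basis B"
  proof (rule topological_basisI)
    show "open U" if "U \<in> B" for U using that by (auto simp: B_def)
  next
    fix U :: "'a ell1 set" and x assume "open U" "x \<in> U"
    then obtain e where e: "0 < e" "ball x e \<subseteq> U" by (auto simp: open_contains_ball)
    obtain n where n: "1 / real (Suc n) < e/2"
      using nat_approx_posE[of "e/2"] e(1) by auto
    obtain d where d: "d \<in> D" "dist x d < 1 / real (Suc n)"
      using dense[of "1 / real (Suc n)" x] by auto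
    have "ball d (1 / real (Suc n)) \<subseteq> ball x e"
    proof
      fix y assume "y \<in> ball d (1 / real (Suc n))"
      then have "dist x y < e"
        using dist_triangle[of x y d] d(2) n by simp
      then show "y \<in> ball x e" by simp
    qed
    moreover have "x \<in> ball d (1 / real (Suc n))" using d(2) by (simp add: dist_commute)
    ultimately show "\<exists>B'\<in>B. x \<in> B' \<and> B' \<subseteq> U"
      using d(1) e(2) by (intro bexI[of _ "ball d (1 / real (Suc n))"]) (auto simp: B_def)
  qed
  ultimately show "\<exists>B :: 'a ell1 set set. countable B \<and> open = generate_topology B"
    using topological_basis_imp_subbasis by blast
qed

text \<open>
  For \<open>J \<subseteq> \<nat>\<close>, the spaces over \<open>J\<close> are the closed subspaces of sequences on \<open>\<nat>\<close> that vanish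
  outside \<open>J\<close>. Bounded continuous functions on the discrete space \<open>nat\<close> are the bounded sequences
  with the supremum norm.
\<close>

definition ell1_on :: "nat set \<Rightarrow> 'a::real_normed_vector ell1 set"
  where "ell1_on J = {x. \<forall>j. j \<notin> J \<longrightarrow> coord x j = 0}"

definition ellinf_on :: "nat set \<Rightarrow> (nat \<Rightarrow>\<^sub>C 'a::real_normed_vector) set"
  where "ellinf_on J = {x. \<forall>j. j \<notin> J \<longrightarrow> apply_bcontfun x j = 0}"

definition c0_on :: "nat set \<Rightarrow> (nat \<Rightarrow>\<^sub>C 'a::real_normed_vector) set"
  where "c0_on J = {x \<in> ellinf_on J. apply_bcontfun x \<longlonglongrightarrow> 0}"


section \<open>Bochner spaces over the unit interval\<close>

text \<open>
  Elements of the Bochner spaces are represented by functions, and equality in these spaces is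
  equality almost everywhere. In all definitions below \<open>S\<close> is a closed subspace of the Banach
  space \<^typ>\<open>'b\<close>.
\<close>

abbreviation unit_interval :: "real measure"
  where "unit_interval \<equiv> lebesgue_on {0..1}"

definition strongly_measurable :: "'a measure \<Rightarrow> ('a \<Rightarrow> 'b::real_normed_vector) \<Rightarrow> bool"
  where "strongly_measurable M f \<longleftrightarrow>
    (\<exists>s. (\<forall>n. simple_function M (s n)) \<and> (AE x in M. (\<lambda>n. s n x) \<longlonglongrightarrow> f x))"

definition ess_norm :: "(real \<Rightarrow> 'b::real_normed_vector) \<Rightarrow> ennreal"
  where "ess_norm f = esssup unit_interval (\<lambda>s. ennreal (norm (f s)))"

definition bochner_Linf :: "'b::real_normed_vector set \<Rightarrow> (real \<Rightarrow> 'b) set"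
  where "bochner_Linf S =
    {f. strongly_measurable unit_interval f \<and> (AE s in unit_interval. f s \<in> S) \<and> ess_norm f < \<infinity>}"

definition bochner_L1 :: "'b::real_normed_vector set \<Rightarrow> (real \<Rightarrow> 'b) set"
  where "bochner_L1 S =
    {f. strongly_measurable unit_interval f \<and> (AE s in unit_interval. f s \<in> S) \<and>
        (\<integral>\<^sup>+ s. ennreal (norm (f s)) \<partial>unit_interval) < \<infinity>}"

definition test_function :: "(real \<Rightarrow> real) \<Rightarrow> bool"
  where "test_function \<phi> \<longleftrightarrow>
    (\<forall>n x. (deriv ^^ n) \<phi> field_differentiable at x) \<and>
    (\<exists>K. compact K \<and> K \<subseteq> {0<..<1} \<and> (\<forall>x. x \<notin> K \<longrightarrow> \<phi> x = 0))"

definition is_weak_derivative ::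
  "(real \<Rightarrow> 'b::{banach, second_countable_topology}) \<Rightarrow> (real \<Rightarrow> 'b) \<Rightarrow> bool"
  where "is_weak_derivative f g \<longleftrightarrow>
    (\<forall>\<phi>. test_function \<phi> \<longrightarrow>
      (LINT s|unit_interval. deriv \<phi> s *\<^sub>R f s) = - (LINT s|unit_interval. \<phi> s *\<^sub>R g s))"

definition W1inf :: "'b::{banach, second_countable_topology} set \<Rightarrow> (real \<Rightarrow> 'b) set"
  where "W1inf S = {f \<in> bochner_Linf S. \<exists>g \<in> bochner_Linf S. is_weak_derivative f g}"

text \<open>The weak derivative is unique up to equality almost everywhere.\<close>

definition weak_derivative ::
  "'b::{banach, second_countable_topology} set \<Rightarrow> (real \<Rightarrow> 'b) \<Rightarrow> real \<Rightarrow> 'b"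
  where "weak_derivative S f = (SOME g. g \<in> bochner_Linf S \<and> is_weak_derivative f g)"

definition is_continuous_rep :: "(real \<Rightarrow> 'b::real_normed_vector) \<Rightarrow> (real \<Rightarrow> 'b) \<Rightarrow> bool"
  where "is_continuous_rep f g \<longleftrightarrow>
    continuous_on {0..1} g \<and> (AE s in unit_interval. f s = g s)"


section \<open>The weak* topology\<close>

definition duality_pairing ::
  "nat set \<Rightarrow> (real \<Rightarrow> 'k::{real_normed_field, banach, second_countable_topology} ell1) \<Rightarrow>
    (real \<Rightarrow> nat \<Rightarrow>\<^sub>C 'k) \<Rightarrow> 'k"
  where "duality_pairing J f g =
    (LINT s|unit_interval. (\<Sum>\<^sub>\<infinity>j\<in>J. coord (f s) j * apply_bcontfun (g s) j))"

text \<open>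
  The coarsest topology on \<open>L\<^sup>\<infinity>([0,1], \<ell>\<^sup>1(J))\<close> for which all pairings with elements of
  \<open>L\<^sup>1([0,1], c\<^sub>0(J))\<close> are continuous.
\<close>

definition weak_star ::
  "nat set \<Rightarrow> (real \<Rightarrow> 'k::{real_normed_field, banach, second_countable_topology} ell1) topology"
  where "weak_star J =
    pullback_topology (bochner_Linf (ell1_on J))
      (\<lambda>f. \<lambda>g\<in>bochner_L1 (c0_on J). duality_pairing J f g)
      (product_topology (\<lambda>_. euclidean) (bochner_L1 (c0_on J)))"

lemma topspace_weak_star [simp]: "topspace (weak_star J) = bochner_Linf (ell1_on J)"
  by (auto simp: weak_star_def topspace_pullback_topology)

lemma limitin_weak_star:
  "limitin (weak_star J) u l F \<longleftrightarrow>
    l \<in> bochner_Linf (ell1_on J) \<and> (\<forall>\<^sub>F a in F. u a \<in> bochner_Linf (ell1_on J)) \<and>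
    (\<forall>g\<in>bochner_L1 (c0_on J).
      ((\<lambda>a. duality_pairing J (u a) g) \<longlongrightarrow> duality_pairing J l g) F)"
  (is "?L \<longleftrightarrow> ?R")
proof -
  let ?X = "bochner_Linf (ell1_on J) :: (real \<Rightarrow> 'a ell1) set"
  let ?e = "\<lambda>f. \<lambda>g\<in>bochner_L1 (c0_on J). duality_pairing J f g"
  let ?P = "product_topology (\<lambda>_. euclidean) (bochner_L1 (c0_on J)) :: ((real \<Rightarrow> nat \<Rightarrow>\<^sub>C 'a) \<Rightarrow> 'a) topology"
  have "?L \<longleftrightarrow> l \<in> ?X \<and> (\<forall>\<^sub>F a in F. u a \<in> ?X) \<and> limitin ?P (\<lambda>a. ?e (u a)) (?e l) F"
  proof
    assume L: ?L
    then have l: "l \<in> ?X" by (metis limitin_topspace topspace_weak_star)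
    have ev: "\<forall>\<^sub>F a in F. u a \<in> ?X"
      using L by (metis limitin_def openin_topspace topspace_weak_star)
    have "limitin ?P (\<lambda>a. ?e (u a)) (?e l) F"
      unfolding limitin_def
    proof (intro conjI allI impI)
      show "?e l \<in> topspace ?P" by simp
      fix U assume "openin ?P U \<and> ?e l \<in> U"
      then have "openin (weak_star J) (?e -` U \<inter> ?X)" "l \<in> ?e -` U \<inter> ?X"
        using l by (auto simp: weak_star_def openin_pullback_topology)
      with L have "\<forall>\<^sub>F a in F. u a \<in> ?e -` U \<inter> ?X"
        unfolding limitin_def by blast
      then show "\<forall>\<^sub>F a in F. ?e (u a) \<in> U" by eventually_elim auto
    qed
    with l ev show "l \<in> ?X \<and> (\<forall>\<^sub>F a in F. u a \<in> ?X) \<and> limitin ?P (\<lambda>a. ?e (u a)) (?e l) F"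
      by blast
  next
    assume R: "l \<in> ?X \<and> (\<forall>\<^sub>F a in F. u a \<in> ?X) \<and> limitin ?P (\<lambda>a. ?e (u a)) (?e l) F"
    show ?L
      unfolding limitin_def
    proof (intro conjI allI impI)
      show "l \<in> topspace (weak_star J)" using R by simp
      fix U assume U: "openin (weak_star J) U \<and> l \<in> U"
      then obtain V where V: "openin ?P V" "U = ?e -` V \<inter> ?X"
        by (auto simp: weak_star_def openin_pullback_topology)
      with R U have "\<forall>\<^sub>F a in F. ?e (u a) \<in> V"
        unfolding limitin_def by blast
      moreover have "\<forall>\<^sub>F a in F. u a \<in> ?X" using R by blast
      ultimately show "\<forall>\<^sub>F a in F. u a \<in> U" by eventually_elim (simp add: V(2))
    qed
  qed
  then show ?thesis
    by (simp add: limitin_componentwise)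
qed


section \<open>Well-posedness of abstract Cauchy problems\<close>

text \<open>
  The topology \<open>\<tau>\<close> is given on (representatives of) elements of \<open>X\<close>, so that \<open>X\<close> is
  \<^term>\<open>topspace \<tau>\<close>. Functions on \<open>\<real>\<^sub>+\<close> are functions on \<^typ>\<open>real\<close> whose values at negative
  arguments are irrelevant. The derivative at \<open>0\<close> is one-sided.
\<close>

definition B_loc :: "(real \<Rightarrow> 'b::real_normed_vector) set \<Rightarrow> (real \<Rightarrow> real \<Rightarrow> 'b) set"
  where "B_loc X = {u. (\<forall>t\<ge>0. u t \<in> X) \<and>
    (\<forall>K. compact K \<and> K \<subseteq> {0..} \<longrightarrow> (\<exists>M::real. \<forall>t\<in>K. ess_norm (u t) \<le> ennreal M))}"

definition has_C1_derivative ::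
  "(real \<Rightarrow> 'b::real_normed_vector) topology \<Rightarrow> (real \<Rightarrow> real \<Rightarrow> 'b) \<Rightarrow> (real \<Rightarrow> real \<Rightarrow> 'b) \<Rightarrow> bool"
  where "has_C1_derivative \<tau> u u' \<longleftrightarrow>
    (\<forall>t\<ge>0. limitin \<tau> (\<lambda>r s. (1 / (r - t)) *\<^sub>R (u r s - u t s)) (u' t) (at t within {0..})) \<and>
    continuous_map (top_of_set {0..}) \<tau> u \<and>
    continuous_map (top_of_set {0..}) \<tau> u'"

definition is_solution ::
  "(real \<Rightarrow> 'b::real_normed_vector) topology \<Rightarrow> (real \<Rightarrow> 'b) set \<Rightarrow>
    ((real \<Rightarrow> 'b) \<Rightarrow> (real \<Rightarrow> 'b)) \<Rightarrow> (real \<Rightarrow> 'b) \<Rightarrow> (real \<Rightarrow> real \<Rightarrow> 'b) \<Rightarrow> bool"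
  where "is_solution \<tau> D A f u \<longleftrightarrow>
    u \<in> B_loc (topspace \<tau>) \<and> (\<forall>t\<ge>0. u t \<in> D) \<and> (AE s in unit_interval. u 0 s = f s) \<and>
    (\<exists>u' \<in> B_loc (topspace \<tau>). has_C1_derivative \<tau> u u' \<and>
      (\<forall>t\<ge>0. AE s in unit_interval. u' t s = A (u t) s))"

definition well_posed ::
  "(real \<Rightarrow> 'b::real_normed_vector) topology \<Rightarrow> (real \<Rightarrow> 'b) set \<Rightarrow>
    ((real \<Rightarrow> 'b) \<Rightarrow> (real \<Rightarrow> 'b)) \<Rightarrow> bool"
  where "well_posed \<tau> D A \<longleftrightarrow>
    (\<forall>f\<in>D. \<exists>u. is_solution \<tau> D A f u) \<and>
    (\<forall>f\<in>D. \<forall>u v. is_solution \<tau> D A f u \<and> is_solution \<tau> D A f v \<longrightarrow>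
      (\<forall>t\<ge>0. AE s in unit_interval. u t s = v t s)) \<and>
    (\<forall>f u. (\<forall>n. f n \<in> D \<and> is_solution \<tau> D A (f n) (u n)) \<and>
      (\<exists>M::real. \<forall>n. ess_norm (f n) \<le> ennreal M) \<and> limitin \<tau> f (\<lambda>_. 0) sequentially \<longrightarrow>
      (\<forall>t0\<ge>0. \<forall>U. openin \<tau> U \<and> (\<lambda>_. 0) \<in> U \<longrightarrow>
        (\<forall>\<^sub>F n in sequentially. \<forall>t\<in>{0..t0}. u n t \<in> U)))"


section \<open>Flows on networks\<close>

definition line_graph_matrix :: "('v, nat) pre_digraph \<Rightarrow> (nat \<Rightarrow> nat \<Rightarrow> real) \<Rightarrow> nat \<Rightarrow> nat \<Rightarrow> real"
  where "line_graph_matrix G w i j = (if head G j = tail G i then w i j else 0)"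

text \<open>The matrix \<open>C\<^sup>-\<^sup>1 B C\<close> for the diagonal matrix \<open>C\<close> with entries \<open>c\<close>.\<close>

definition diag_conjugate :: "(nat \<Rightarrow> real) \<Rightarrow> (nat \<Rightarrow> nat \<Rightarrow> real) \<Rightarrow> nat \<Rightarrow> nat \<Rightarrow> real"
  where "diag_conjugate c B j k = inverse (c j) * B j k * c k"

definition flow_domain ::
  "nat set \<Rightarrow> (nat \<Rightarrow> nat \<Rightarrow> real) \<Rightarrow>
    (real \<Rightarrow> 'k::{real_normed_field, banach, second_countable_topology} ell1) set"
  where "flow_domain J B =
    {f \<in> W1inf (ell1_on J). \<exists>g. is_continuous_rep f g \<and>
      (\<forall>j\<in>J. coord (g 1) j = (\<Sum>\<^sub>\<infinity>k\<in>J. B j k *\<^sub>R coord (g 0) k))}"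

text \<open>For \<open>f\<close> in the domain, the sequence under \<^const>\<open>Abs_ell1\<close> is summable for almost every \<open>s\<close>.\<close>

definition flow_operator ::
  "nat set \<Rightarrow> (nat \<Rightarrow> real) \<Rightarrow> (real \<Rightarrow> nat \<Rightarrow>\<^sub>C 'k) \<Rightarrow>
    (real \<Rightarrow> 'k::{real_normed_field, banach, second_countable_topology} ell1) \<Rightarrow> real \<Rightarrow> 'k ell1"
  where "flow_operator J c q f = (\<lambda>s. Abs_ell1 (\<lambda>j.
    if j \<in> J
    then c j *\<^sub>R coord (weak_derivative (ell1_on J) f s) j + apply_bcontfun (q s) j * coord (f s) j
    else 0))"

end

theory Submission
  imports Defs
begin

text \<open>
  The problem is solved by characteristics. The integrating factor \<open>Q\<^sub>j(x) = exp (\<integral>\<^sub>0\<^sup>x q\<^sub>j/c\<^sub>j)\<close> turns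
  the equation into the pure transport equation for \<open>v\<^sub>j = Q\<^sub>j u\<^sub>j\<close>, with boundary matrix
  \<open>M\<^sub>j\<^sub>k = Q\<^sub>j(1) B\<^sub>j\<^sub>k\<close>, where \<open>B\<close> is the conjugated adjacency matrix. Then
  \<open>v\<^sub>j(x,t) = H\<^sub>j(t + x/c\<^sub>j)\<close>, where \<open>H\<^sub>j(t) = v\<^sub>j(0,t)\<close> solves a linear system with delays:
  \<open>H\<^sub>j(x/c\<^sub>j)\<close> is the initial value of \<open>v\<^sub>j\<close> at \<open>x\<close>, and \<open>H\<^sub>j(t + 1/c\<^sub>j) = \<Sum>\<^sub>k M\<^sub>j\<^sub>k H\<^sub>k(t)\<close>. The delays are
  bounded below, so the system is solved step by step in time. Because \<open>c\<^sub>0/c\<^sub>j\<close> is a bounded positive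
  integer, only finitely many speeds occur. Hence the edges split into finitely many groups, and on
  each group a step of the delay system evaluates an \<open>\<ell>\<^sup>1\<close>-valued function at one time and applies
  the bounded matrix \<open>M\<close>; this controls the \<open>\<ell>\<^sup>1\<close>-norms (\<open>iter_bound\<close>).

  All statements about the weak* topology are reduced to primitives. On norm-bounded sets, weak*
  convergence means that for each edge the primitives of the coordinate converge pointwise
  (\<open>bounded_weak_star_limit\<close>), where the coordinate may first be multiplied by \<open>Q\<^sub>j\<close>. The primitive
  of \<open>v\<^sub>j(\<cdot>,t)\<close> over \<open>[0,x]\<close> is \<open>c\<^sub>j\<close> times a difference of two values of the primitive of \<open>H\<^sub>j\<close>.
  Weak* differentiability in time and weak* continuity of the derivative thus become
  differentiability of the primitive of \<open>H\<^sub>j\<close> and continuity of \<open>H\<^sub>j\<close> (\<open>profile_derivative\<close>,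
  \<open>profile_continuous\<close>).

  Up to the boundary condition, the domain consists of the functions whose coordinates are primitives of those of the weak
  derivative (\<open>coord_primitive_of_weak_derivative\<close>, \<open>primitive_on_imp_weak_derivative\<close>). If the
  initial value is in the domain, \<open>H\<close> is again such a primitive: its derivative solves the same delay
  system, and the boundary condition excludes jumps (\<open>sol_primitive\<close>). This gives existence.
  Conversely, testing the weak* derivative of an arbitrary solution with weighted indicators of
  intervals on one edge shows that the mass in a window moving along the characteristics is constant
  (\<open>constant_along_characteristics\<close>). So every solution comes from the delay system
  (\<open>solution_along_characteristics\<close>), which gives uniqueness. For continuous dependence, weak*
  convergence of the initial values to \<open>0\<close> passes from one time step to the next, since every row of
  \<open>M\<close> is finite, and uniformity in time follows from equi-Lipschitz continuity of the primitives
  (\<open>sol_integral_tendsto_0\<close>).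
\<close>

section \<open>Measurability and integration over the unit interval\<close>

lemma AE_unit_interval_iff:
  "(AE s in unit_interval. P s) \<longleftrightarrow> (AE s in lborel. s \<in> {0..1} \<longrightarrow> P s)"
  by (simp add: AE_restrict_space_iff AE_completion_iff)

lemma LINT_unit_interval:
  fixes f :: "real \<Rightarrow> 'b::{banach, second_countable_topology}"
  assumes "f \<in> borel_measurable borel"
  shows "(LINT s|unit_interval. f s) = (LBINT s:{0..1}. f s)"
proof -
  have "(LINT s|unit_interval. f s) = (LINT s|lebesgue. indicator {0..1} s *\<^sub>R f s)"
    by (rule integral_restrict_space) auto
  also have "\<dots> = (LINT s|lborel. indicator {0..1} s *\<^sub>R f s)"
    using assms by (intro integral_completion) auto
  finally show ?thesis by (simp add: set_lebesgue_integral_def)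
qed

lemma borel_measurable_unit_interval:
  "f \<in> borel_measurable borel \<Longrightarrow> f \<in> borel_measurable unit_interval"
  by (intro measurable_restrict_space1 measurable_completion) simp

lemma borel_measurable_unit_interval_AE:
  fixes f :: "real \<Rightarrow> 'b::{second_countable_topology, real_normed_vector}"
  assumes f: "f \<in> borel_measurable unit_interval" and AE: "AE s in unit_interval. f s = g s"
  shows "g \<in> borel_measurable unit_interval"
proof (rule measurableI)
  fix A :: "'b set" assume A: "A \<in> sets borel"
  have c: "complete_measure unit_interval"
  proof
    fix X Y :: "real set" assume XY: "X \<subseteq> Y" "Y \<in> null_sets unit_interval"
    then have "Y \<in> null_sets lebesgue" "Y \<subseteq> {0..1}"
      using null_sets_restrict_space[of "{0..1::real}" lebesgue Y] by auto
    then have "X \<in> sets lebesgue" "X \<subseteq> {0..1}"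
      using XY(1) completion.complete[of X Y lborel] by auto
    then show "X \<in> sets unit_interval"
      by (auto simp: sets_restrict_space image_iff)
  qed
  show "g -` A \<inter> space unit_interval \<in> sets unit_interval"
  proof (rule complete_measure.in_sets_AE[OF c])
    show "AE x in unit_interval. (x \<in> f -` A \<inter> space unit_interval) = (x \<in> g -` A \<inter> space unit_interval)"
      using AE by eventually_elim auto
    show "f -` A \<inter> space unit_interval \<in> sets unit_interval"
      using f A by (rule measurable_sets)
  qed auto
qed simp

lemma strongly_measurable_compose:
  fixes f :: "'a \<Rightarrow> 'b::real_normed_vector" and h :: "'b \<Rightarrow> 'c::real_normed_vector"
  assumes "strongly_measurable M f" "continuous_on UNIV h"
  shows "strongly_measurable M (\<lambda>x. h (f x))"
proof -
  obtain s where s: "\<And>n. simple_function M (s n)" "AE x in M. (\<lambda>n. s n x) \<longlonglongrightarrow> f x"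
    using assms(1) unfolding strongly_measurable_def by blast
  have "AE x in M. (\<lambda>n. h (s n x)) \<longlonglongrightarrow> h (f x)"
    using s(2)
  proof eventually_elim
    case (elim x)
    show ?case using continuous_on_tendsto_compose[OF assms(2) elim] by simp
  qed
  moreover have "simple_function M (\<lambda>x. h (s n x))" for n
    by (rule simple_function_compose1[OF s(1)])
  ultimately show ?thesis
    unfolding strongly_measurable_def by (intro exI[of _ "\<lambda>n x. h (s n x)"]) blast
qed

lemma strongly_measurable_borel:
  fixes f :: "real \<Rightarrow> 'b::{real_normed_vector, second_countable_topology}"
  assumes "f \<in> borel_measurable borel"
  shows "strongly_measurable unit_interval f"
proof -
  from borel_measurable_implies_sequence_metric[OF borel_measurable_unit_interval[OF assms], of 0]
  obtain s where "\<And>n. simple_function unit_interval (s n)"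
    "\<And>x. x \<in> space unit_interval \<Longrightarrow> (\<lambda>n. s n x) \<longlonglongrightarrow> f x" by blast
  then show ?thesis unfolding strongly_measurable_def by (intro exI[of _ s]) auto
qed

lemma strongly_measurable_borel_rep:
  fixes f :: "real \<Rightarrow> 'b::{banach, second_countable_topology}"
  assumes "strongly_measurable unit_interval f"
  obtains f' where "f' \<in> borel_measurable borel" "AE s in unit_interval. f s = f' s"
proof -
  obtain s where s: "\<And>n. simple_function unit_interval (s n)" "AE x in unit_interval. (\<lambda>n. s n x) \<longlonglongrightarrow> f x"
    using assms unfolding strongly_measurable_def by blast
  have "\<exists>s'. simple_function lborel s' \<and> (AE x in lborel. indicator {0..1} x *\<^sub>R s n x = s' x)" for n
    using s(1)[of n] completion_ex_simple_function[of lborel "\<lambda>x. indicator {0..1} x *\<^sub>R s n x"]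
    by (simp add: simple_function_restrict_space)
  then obtain s' where s': "\<And>n. simple_function lborel (s' n)"
    "\<And>n. AE x in lborel. indicator {0..1} x *\<^sub>R s n x = s' n x" by metis
  have [measurable]: "s' n \<in> borel_measurable borel" for n
    using borel_measurable_simple_function[OF s'(1)] by simp
  let ?f = "\<lambda>x. lim (\<lambda>n. s' n x)"
  have "AE x in lborel. \<forall>n. indicator {0..1} x *\<^sub>R s n x = s' n x"
    using s'(2) by (simp add: AE_all_countable)
  moreover have "AE x in lborel. x \<in> {0..1} \<longrightarrow> (\<lambda>n. s n x) \<longlonglongrightarrow> f x"
    using s(2) by (simp add: AE_unit_interval_iff)
  ultimately have "AE x in lborel. x \<in> {0..1} \<longrightarrow> f x = ?f x"
  proof eventually_elim
    case (elim x)
    show ?case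
    proof
      assume x: "x \<in> {0..1}"
      then have "(\<lambda>n. s' n x) = (\<lambda>n. s n x)" using elim(1) by auto
      then show "f x = ?f x" using elim(2) x by (simp add: limI)
    qed
  qed
  then show ?thesis
    using that[of ?f] by (simp add: AE_unit_interval_iff)
qed

lemma strongly_measurable_norm:
  assumes "strongly_measurable unit_interval f"
  shows "(\<lambda>s. norm (f s)) \<in> borel_measurable unit_interval"
proof -
  have "strongly_measurable unit_interval (\<lambda>s. norm (f s))"
    using assms by (rule strongly_measurable_compose) (intro continuous_intros)
  then obtain r where "r \<in> borel_measurable borel" "AE s in unit_interval. norm (f s) = r s"
    by (rule strongly_measurable_borel_rep)
  from this(1) AE_symmetric[OF this(2)] show ?thesis
    by (rule borel_measurable_unit_interval_AE[OF borel_measurable_unit_interval])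
qed

lemma strongly_measurable_imp_borel_measurable:
  fixes f :: "real \<Rightarrow> 'b::{banach, second_countable_topology}"
  assumes "strongly_measurable unit_interval f"
  shows "f \<in> borel_measurable unit_interval"
proof -
  obtain r where "r \<in> borel_measurable borel" "AE s in unit_interval. f s = r s"
    using assms by (rule strongly_measurable_borel_rep)
  from this(1) AE_symmetric[OF this(2)] show ?thesis
    by (rule borel_measurable_unit_interval_AE[OF borel_measurable_unit_interval])
qed

lemma ess_norm_le_iff:
  assumes "strongly_measurable unit_interval f" "0 \<le> M"
  shows "ess_norm f \<le> ennreal M \<longleftrightarrow> (AE s in unit_interval. norm (f s) \<le> M)"
proof
  assume *: "ess_norm f \<le> ennreal M"
  have "AE s in unit_interval. ennreal (norm (f s)) \<le> ess_norm f"
    unfolding ess_norm_def by (rule esssup_AE)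
  then show "AE s in unit_interval. norm (f s) \<le> M"
  proof eventually_elim
    case (elim s)
    then have "ennreal (norm (f s)) \<le> ennreal M" using * by (rule order_trans)
    then show ?case using \<open>0 \<le> M\<close> by (simp add: ennreal_le_iff)
  qed
next
  assume *: "AE s in unit_interval. norm (f s) \<le> M"
  show "ess_norm f \<le> ennreal M"
    unfolding ess_norm_def
  proof (rule esssup_I)
    show "(\<lambda>s. ennreal (norm (f s))) \<in> borel_measurable unit_interval"
      using strongly_measurable_norm[OF assms(1)] by measurable
    show "AE s in unit_interval. ennreal (norm (f s)) \<le> ennreal M"
      using * by eventually_elim (rule ennreal_leI)
  qed
qed

lemma bochner_Linf_bound:
  assumes "f \<in> bochner_Linf S"
  obtains M where "0 \<le> M" "AE s in unit_interval. norm (f s) \<le> M" "ess_norm f \<le> ennreal M"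
proof -
  have f: "strongly_measurable unit_interval f" "ess_norm f < \<infinity>"
    using assms by (auto simp: bochner_Linf_def)
  then have "ess_norm f \<le> ennreal (enn2real (ess_norm f))"
    by (simp add: less_top)
  with ess_norm_le_iff[OF f(1), of "enn2real (ess_norm f)"] that[of "enn2real (ess_norm f)"] show ?thesis by simp
qed

lemma bochner_LinfI:
  fixes f :: "real \<Rightarrow> 'b::{real_normed_vector, second_countable_topology}"
  assumes "f \<in> borel_measurable borel" "\<And>s. s \<in> {0..1} \<Longrightarrow> f s \<in> S" "\<And>s. s \<in> {0..1} \<Longrightarrow> norm (f s) \<le> M"
  shows "f \<in> bochner_Linf S" "ess_norm f \<le> ennreal M"
proof -
  have sm: "strongly_measurable unit_interval f" by (rule strongly_measurable_borel) fact
  have "0 \<le> M" using assms(3)[of 0] norm_ge_zero[of "f 0"] by (smt (verit) atLeastAtMost_iff)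
  have "AE s in unit_interval. norm (f s) \<le> M" using assms(3) by (intro AE_I2) simp
  with ess_norm_le_iff[OF sm \<open>0 \<le> M\<close>] show *: "ess_norm f \<le> ennreal M" by simp
  have "AE s in unit_interval. f s \<in> S" using assms(2) by (intro AE_I2) simp
  with sm * show "f \<in> bochner_Linf S"
    unfolding bochner_Linf_def by (auto intro: order.strict_trans1)
qed

text \<open>A bounded strongly measurable function has a Borel version that is bounded everywhere.\<close>

lemma bounded_borel_rep:
  fixes f :: "real \<Rightarrow> 'b::{banach, second_countable_topology}"
  assumes "strongly_measurable unit_interval f" "AE s in unit_interval. norm (f s) \<le> M" "0 \<le> M"
  obtains f' where "f' \<in> borel_measurable borel" "AE s in unit_interval. f s = f' s" "\<And>s. norm (f' s) \<le> M"
proof -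
  obtain r where [measurable]: "r \<in> borel_measurable borel" and r: "AE s in unit_interval. f s = r s"
    using strongly_measurable_borel_rep[OF assms(1)] by blast
  show ?thesis
  proof (rule that[of "\<lambda>s. if norm (r s) \<le> M then r s else 0"])
    show "AE s in unit_interval. f s = (if norm (r s) \<le> M then r s else 0)"
      using r assms(2) by eventually_elim auto
  qed (use assms(3) in \<open>auto, measurable\<close>)
qed

subsection \<open>Coordinates of summable sequences\<close>

lemma bounded_linear_coord: "bounded_linear (\<lambda>x. coord x j)"
  by (rule bounded_linear_intro[of _ 1]) (auto intro: norm_coord_le)

lemma continuous_on_coord [continuous_intros]:
  "continuous_on A f \<Longrightarrow> continuous_on A (\<lambda>x. coord (f x) j)"
  by (rule bounded_linear.continuous_on[OF bounded_linear_coord])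

lemma coord_Abs_ell1:
  assumes "\<And>F. finite F \<Longrightarrow> (\<Sum>j\<in>F. norm (x j)) \<le> M"
  shows "coord (Abs_ell1 x) = x" "norm (Abs_ell1 x) \<le> M"
proof -
  have s: "summable (\<lambda>j. norm (x j))"
    using assms by (intro bounded_imp_summable[of _ M]) auto
  then show c: "coord (Abs_ell1 x) = x" by (intro Abs_ell1_inverse) simp
  show "norm (Abs_ell1 x) \<le> M"
    unfolding norm_ell1.rep_eq c using s assms by (intro suminf_le_const) auto
qed

lemma norm_ell1_le:
  assumes "\<And>F. finite F \<Longrightarrow> (\<Sum>j\<in>F. norm (coord x j)) \<le> L"
  shows "norm x \<le> L"
  unfolding norm_ell1.rep_eq using assms by (intro suminf_le_const summable_coord) auto

text \<open>The sequence with entry \<open>z\<close> at \<open>i\<close> and \<open>0\<close> elsewhere.\<close>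

lift_definition unit_ell1 :: "nat \<Rightarrow> 'a::real_normed_vector \<Rightarrow> 'a ell1"
  is "\<lambda>i z j. if j = i then z else 0"
  by (rule summable_finite[of "{i}" for i]) auto

lemma norm_unit_ell1: "norm (unit_ell1 i z) = norm z"
proof -
  have "norm (unit_ell1 i z) = (\<Sum>j\<in>{i}. norm (coord (unit_ell1 i z) j))"
    unfolding norm_ell1.rep_eq by (rule suminf_finite) (auto simp: unit_ell1.rep_eq)
  then show ?thesis by (simp add: unit_ell1.rep_eq)
qed

lemma bounded_linear_unit_ell1: "bounded_linear (unit_ell1 i)"
  by (rule bounded_linear_intro[of _ 1])
    (auto simp: norm_unit_ell1 unit_ell1.rep_eq intro!: ell1_eqI)

lemma unit_ell1_sums: "(\<lambda>j. unit_ell1 j (coord x j)) sums x"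
  unfolding sums_def
proof (rule metric_LIMSEQ_I)
  fix e :: real assume "0 < e"
  have co: "coord (\<Sum>j<N. unit_ell1 j (coord x j)) i = (if i < N then coord x i else 0)" for N i
    by (induction N) (auto simp: unit_ell1.rep_eq)
  have "(\<lambda>N. \<Sum>j. norm (coord x (j + N))) \<longlonglongrightarrow> 0"
    using suminf_exist_split2[OF summable_coord[of x]] .
  then obtain N0 where N0: "\<And>N. N \<ge> N0 \<Longrightarrow> norm (\<Sum>j. norm (coord x (j + N))) < e"
    using \<open>0 < e\<close> LIMSEQ_D[of _ 0 e] by force
  have "dist (\<Sum>j<N. unit_ell1 j (coord x j)) x < e" if "N \<ge> N0" for N
  proof -
    let ?d = "x - (\<Sum>j<N. unit_ell1 j (coord x j))"
    have "norm ?d = (\<Sum>j. norm (coord ?d (j + N))) + (\<Sum>j<N. norm (coord ?d j))"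
      unfolding norm_ell1.rep_eq by (rule suminf_split_initial_segment[OF summable_coord])
    also have "\<dots> = (\<Sum>j. norm (coord x (j + N)))"
      by (simp add: co)
    finally show ?thesis using N0[OF that] by (simp add: dist_norm norm_minus_commute)
  qed
  then show "\<exists>N0. \<forall>N\<ge>N0. dist (\<Sum>j<N. unit_ell1 j (coord x j)) x < e" by blast
qed

text \<open>Since finitely supported sequences are dense, measurability can be tested on the coordinates.\<close>

lemma borel_measurable_coordI:
  fixes f :: "'x \<Rightarrow> 'k::{banach, second_countable_topology} ell1"
  assumes [measurable]: "\<And>j. (\<lambda>x. coord (f x) j) \<in> borel_measurable M"
  shows "f \<in> borel_measurable M"
proof (rule borel_measurable_LIMSEQ_metric)
  have [measurable]: "unit_ell1 j \<in> borel_measurable borel" for j :: nat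
    by (intro borel_measurable_continuous_onI linear_continuous_on bounded_linear_unit_ell1)
  show "(\<lambda>x. \<Sum>j<N. unit_ell1 j (coord (f x) j)) \<in> borel_measurable M" for N
    by measurable
  show "(\<lambda>N. \<Sum>j<N. unit_ell1 j (coord (f x) j)) \<longlonglongrightarrow> f x" for x
    using unit_ell1_sums[of "f x"] by (simp add: sums_def)
qed

lemma borel_measurable_coord [measurable]:
  fixes f :: "'x \<Rightarrow> 'k::{banach, second_countable_topology} ell1"
  assumes "f \<in> borel_measurable M"
  shows "(\<lambda>x. coord (f x) j) \<in> borel_measurable M"
  using assms
  by (rule borel_measurable_continuous_on[OF linear_continuous_on[OF bounded_linear_coord]])

section \<open>Lipschitz functions as primitives of bounded functions\<close>

lemma set_borel_measurable_subinterval: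
  fixes f :: "real \<Rightarrow> 'b::{banach, second_countable_topology}"
  assumes "set_borel_measurable borel {0..T} f" "0 \<le> a" "b \<le> T"
  shows "set_borel_measurable borel {a..b} f"
  using assms by (rule_tac set_borel_measurable_subset[of _ "{0..T}"]) auto

lemma set_integrable_bounded:
  fixes f :: "real \<Rightarrow> 'b::{banach, second_countable_topology}"
  assumes "set_borel_measurable borel {a..b} f" "\<And>s. s \<in> {a..b} \<Longrightarrow> norm (f s) \<le> M"
  shows "set_integrable lborel {a..b} f"
proof -
  have "integrable lborel (\<lambda>x. indicator {a..b} x *\<^sub>R (indicator {a..b} x *\<^sub>R f x))"
    using assms(1)
    by (intro integrableI_bounded_set_indicator[where B = M])
      (auto simp: set_borel_measurable_def assms(2) emeasure_lborel_Icc_eq)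
  moreover have "(\<lambda>x. indicator {a..b} x *\<^sub>R (indicator {a..b} x *\<^sub>R f x)) = (\<lambda>x. indicator {a..b} x *\<^sub>R f x)"
    by (auto simp: indicator_def)
  ultimately show ?thesis by (simp add: set_integrable_def)
qed

lemma norm_set_integral_le:
  fixes f :: "real \<Rightarrow> 'b::{banach, second_countable_topology}"
  assumes "set_integrable lborel {a..b} f" "a \<le> b" "\<And>s. s \<in> {a..b} \<Longrightarrow> norm (f s) \<le> M"
  shows "norm (LBINT s:{a..b}. f s) \<le> M * (b - a)"
proof -
  have "norm (LBINT s:{a..b}. f s) \<le> (LINT s|lborel. norm (indicator {a..b} s *\<^sub>R f s))"
    unfolding set_lebesgue_integral_def by (rule integral_norm_bound)
  also have "\<dots> \<le> (LINT s|lborel. indicator {a..b} s *\<^sub>R M)"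
  proof (rule integral_mono)
    show "integrable lborel (\<lambda>s. norm (indicator {a..b} s *\<^sub>R f s))"
      using assms(1) by (simp add: set_integrable_def del: norm_scaleR)
    show "integrable lborel (\<lambda>s. indicator {a..b} s *\<^sub>R M)"
      by (intro integrable_scaleR_left integrable_real_indicator) (auto simp: emeasure_lborel_Icc_eq)
  qed (use assms(3) in \<open>auto simp: indicator_def\<close>)
  also have "\<dots> = M * (b - a)" using \<open>a \<le> b\<close> by simp
  finally show ?thesis .
qed

lemma set_integral_split:
  fixes f :: "real \<Rightarrow> 'b::{banach, second_countable_topology}"
  assumes "set_integrable lborel {a..c} f" "a \<le> b" "b \<le> c"
  shows "(LBINT s:{a..c}. f s) = (LBINT s:{a..b}. f s) + (LBINT s:{b..c}. f s)"
proof -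
  have i: "set_integrable lborel {a..b} f" "set_integrable lborel {b..c} f"
    using assms by (auto intro: set_integrable_subset)
  have "(LBINT s:{a..c}. f s) = (LINT s|lborel. indicator {a..b} s *\<^sub>R f s + indicator {b..c} s *\<^sub>R f s)"
    unfolding set_lebesgue_integral_def
  proof (rule integral_cong_AE)
    show "AE s in lborel. indicat_real {a..c} s *\<^sub>R f s
        = indicat_real {a..b} s *\<^sub>R f s + indicat_real {b..c} s *\<^sub>R f s"
      using AE_lborel_singleton[of b] by eventually_elim (use assms(2,3) in \<open>auto simp: indicator_def\<close>)
  qed (use assms(1) i in \<open>auto simp: set_integrable_def dest: borel_measurable_integrable\<close>)
  also have "\<dots> = (LBINT s:{a..b}. f s) + (LBINT s:{b..c}. f s)"
    using i unfolding set_lebesgue_integral_def set_integrable_def by (rule Bochner_Integration.integral_add)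
  finally show ?thesis .
qed

lemma set_integral_shift_scale:
  fixes f :: "real \<Rightarrow> 'b::{banach, second_countable_topology}"
  assumes "0 < c"
  shows "(LBINT s:{a..b}. f (t + c * s)) = (1 / c) *\<^sub>R (LBINT s:{t + c * a..t + c * b}. f s)"
proof -
  have "(LBINT s:{t + c * a..t + c * b}. f s)
      = \<bar>c\<bar> *\<^sub>R (LINT s|lborel. indicator {t + c * a..t + c * b} (t + c * s) *\<^sub>R f (t + c * s))"
    unfolding set_lebesgue_integral_def using assms by (intro lborel_integral_real_affine) simp
  also have "(\<lambda>s. indicat_real {t + c * a..t + c * b} (t + c * s)) = indicator {a..b}"
    using assms by (auto simp: indicator_def fun_eq_iff)
  finally show ?thesis using assms by (simp add: set_lebesgue_integral_def)
qed

lemma set_integral_point [simp]: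
  fixes f :: "real \<Rightarrow> 'b::{banach, second_countable_topology}"
  shows "(LBINT s:{a}. f s) = 0"
  unfolding set_lebesgue_integral_def
  by (rule integral_eq_zero_AE) (use AE_lborel_singleton[of a] in \<open>eventually_elim, auto\<close>)

text \<open>
  \<open>F\<close> is a primitive on \<open>[0,T]\<close> of the bounded measurable function \<open>f\<close>. For \<open>T = 1\<close>, such \<open>F\<close>
  are the continuous representatives of the elements of \<open>W\<^sup>1\<^sup>,\<^sup>\<infinity>\<close>, with weak derivative \<open>f\<close>.
  Nothing is required of \<open>F\<close> and \<open>f\<close> outside \<open>[0,T]\<close>.
\<close>

definition primitive_on ::
  "real \<Rightarrow> (real \<Rightarrow> 'b::{banach, second_countable_topology}) \<Rightarrow> (real \<Rightarrow> 'b) \<Rightarrow> bool"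
  where "primitive_on T F f \<longleftrightarrow>
    set_borel_measurable borel {0..T} f \<and> (\<exists>M. \<forall>s\<in>{0..T}. norm (f s) \<le> M) \<and>
    (\<forall>x\<in>{0..T}. F x = F 0 + (LBINT s:{0..x}. f s))"

lemma primitive_onD:
  assumes "primitive_on T F f"
  shows "set_borel_measurable borel {0..T} f" "x \<in> {0..T} \<Longrightarrow> F x = F 0 + (LBINT s:{0..x}. f s)"
  using assms unfolding primitive_on_def by blast+

lemma primitive_on_integral:
  fixes f :: "real \<Rightarrow> 'b::{banach, second_countable_topology}"
  assumes "f \<in> borel_measurable borel" "\<And>s. s \<in> {0..T} \<Longrightarrow> norm (f s) \<le> M"
  shows "primitive_on T (\<lambda>x. z + (LBINT s:{0..x}. f s)) f"
  using assms unfolding primitive_on_def set_borel_measurable_def by (auto intro!: exI[of _ M])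

lemma primitive_on_integrable:
  assumes "primitive_on T F f" "0 \<le> a" "b \<le> T"
  shows "set_integrable lborel {a..b} f"
proof -
  from assms(1) obtain M where "\<forall>s\<in>{0..T}. norm (f s) \<le> M" "set_borel_measurable borel {0..T} f"
    by (auto simp: primitive_on_def)
  with assms(2,3) show ?thesis
    using set_integrable_bounded[OF set_borel_measurable_subinterval[of T f a b], of M] by auto
qed

lemma primitive_on_diff:
  assumes "primitive_on T F f" "0 \<le> a" "a \<le> b" "b \<le> T"
  shows "F b - F a = (LBINT s:{a..b}. f s)"
proof -
  have "F b = F 0 + (LBINT s:{0..b}. f s)" "F a = F 0 + (LBINT s:{0..a}. f s)"
    using assms(2-4) by (intro primitive_onD(2)[OF assms(1)]; simp)+
  moreover have "(LBINT s:{0..b}. f s) = (LBINT s:{0..a}. f s) + (LBINT s:{a..b}. f s)"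
    using assms by (intro set_integral_split primitive_on_integrable) auto
  ultimately show ?thesis by simp
qed

lemma primitive_on_lipschitz_bound:
  assumes "primitive_on T F f" "\<And>s. s \<in> {0..T} \<Longrightarrow> norm (f s) \<le> M" "x \<in> {0..T}" "y \<in> {0..T}"
  shows "norm (F x - F y) \<le> M * \<bar>x - y\<bar>"
proof -
  have *: "norm (F b - F a) \<le> M * (b - a)" if "0 \<le> a" "a \<le> b" "b \<le> T" for a b
    unfolding primitive_on_diff[OF assms(1) that] using that assms(2)
    by (intro norm_set_integral_le primitive_on_integrable[OF assms(1)]) auto
  show ?thesis
    using *[of x y] *[of y x] assms(3,4) by (cases "x \<le> y") (auto simp: norm_minus_commute)
qed

lemma primitive_on_lipschitz:
  assumes "primitive_on T F f"
  obtains L where "0 \<le> L" "\<And>s. s \<in> {0..T} \<Longrightarrow> norm (f s) \<le> L"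
    "\<And>x y. x \<in> {0..T} \<Longrightarrow> y \<in> {0..T} \<Longrightarrow> norm (F x - F y) \<le> L * \<bar>x - y\<bar>"
proof -
  from assms obtain M where M: "\<forall>s\<in>{0..T}. norm (f s) \<le> M"
    by (auto simp: primitive_on_def)
  then have "\<forall>s\<in>{0..T}. norm (f s) \<le> max M 0" by auto
  then show ?thesis
    using that[of "max M 0"] primitive_on_lipschitz_bound[OF assms, of "max M 0"] by auto
qed

lemma primitive_on_continuous: "primitive_on T F f \<Longrightarrow> continuous_on {0..T} F"
  by (erule primitive_on_lipschitz)
    (rule lipschitz_on_continuous_on, auto simp: lipschitz_on_def dist_norm dist_real_def)

lemma set_borel_measurable_continuous:
  fixes F :: "real \<Rightarrow> 'b::real_normed_vector"
  assumes "continuous_on {a..b} F"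
  shows "set_borel_measurable borel {a..b} F"
  unfolding set_borel_measurable_def using assms
  by (intro borel_measurable_continuous_on_indicator) auto

lemma quadratic_increments_imp_constant:
  fixes D :: "real \<Rightarrow> 'b::real_normed_vector"
  assumes D: "\<And>a b. 0 \<le> a \<Longrightarrow> a \<le> b \<Longrightarrow> b \<le> T \<Longrightarrow> norm (D b - D a) \<le> C * (b - a)\<^sup>2"
    and x: "x \<in> {0..T}"
  shows "D x = D 0"
proof -
  have *: "norm (D x - D 0) \<le> C * x\<^sup>2 / real (Suc n)" for n
  proof -
    let ?h = "x / real (Suc n)"
    have "norm (D (real k * ?h) - D 0) \<le> real k * (C * ?h\<^sup>2)" if "k \<le> Suc n" for k
      using that
    proof (induction k)
      case (Suc k)
      have hx: "real (Suc k) * ?h \<le> x"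
        using Suc.prems x by (simp add: field_simps mult_left_mono)
      have "norm (D (real (Suc k) * ?h) - D (real k * ?h)) \<le> C * (real (Suc k) * ?h - real k * ?h)\<^sup>2"
        using hx x by (intro D) (auto intro!: divide_right_mono mult_right_mono)
      also have "real (Suc k) * ?h - real k * ?h = ?h" by (simp add: distrib_right add_divide_distrib)
      finally have "norm (D (real (Suc k) * ?h) - D (real k * ?h)) \<le> C * ?h\<^sup>2" .
      moreover have "norm (D (real (Suc k) * ?h) - D 0)
          \<le> norm (D (real (Suc k) * ?h) - D (real k * ?h)) + norm (D (real k * ?h) - D 0)"
        using norm_triangle_ineq[of "D (real (Suc k) * ?h) - D (real k * ?h)" "D (real k * ?h) - D 0"] by simp
      ultimately show ?case using Suc by (simp add: algebra_simps)
    qed simp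
    moreover have "real (Suc n) * ?h = x" by simp
    moreover have "real (Suc n) * (C * ?h\<^sup>2) = C * x\<^sup>2 / real (Suc n)"
    proof -
      have "r * (C * (x / r)\<^sup>2) = C * x\<^sup>2 / r" if "r \<noteq> 0" for r
        using that by (simp add: power2_eq_square)
      then show ?thesis by simp
    qed
    ultimately show ?thesis by (metis order_refl)
  qed
  have "(\<lambda>n. C * x\<^sup>2 / real (Suc n)) \<longlonglongrightarrow> 0"
    by (rule LIMSEQ_Suc) (rule lim_const_over_n)
  then have "norm (D x - D 0) \<le> 0" by (rule LIMSEQ_le_const) (use * in auto)
  then show ?thesis by simp
qed

lemma set_borel_measurable_bilinear:
  fixes f :: "real \<Rightarrow> 'b::{banach, second_countable_topology}"
    and g :: "real \<Rightarrow> 'c::{banach, second_countable_topology}"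
    and prod :: "'b \<Rightarrow> 'c \<Rightarrow> 'd::{banach, second_countable_topology}" (infixl \<open>\<odot>\<close> 70)
  assumes bb: "bounded_bilinear (\<odot>)"
    and f: "set_borel_measurable borel S f" and g: "set_borel_measurable borel S g"
  shows "set_borel_measurable borel S (\<lambda>x. f x \<odot> g x)"
proof -
  interpret P: bounded_bilinear "(\<odot>)" by (rule bb)
  have cont: "continuous_on UNIV (\<lambda>p. fst p \<odot> snd p)"
    by (intro P.continuous_on continuous_intros)
  have "(\<lambda>x. (indicator S x *\<^sub>R f x) \<odot> (indicator S x *\<^sub>R g x)) \<in> borel_measurable borel"
    using borel_measurable_continuous_Pair[OF f[unfolded set_borel_measurable_def] g[unfolded set_borel_measurable_def] cont]
    by simp
  also have "(\<lambda>x. (indicator S x *\<^sub>R f x) \<odot> (indicator S x *\<^sub>R g x)) = (\<lambda>x. indicator S x *\<^sub>R (f x \<odot> g x))"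
    by (auto simp: indicator_def P.zero_left)
  finally show ?thesis by (simp add: set_borel_measurable_def)
qed

text \<open>
  The product rule. The difference of the two sides has increments of second order, so it is
  constant. Neither Fubini's theorem nor differentiability almost everywhere is needed.
\<close>

lemma primitive_on_bilinear:
  fixes F f :: "real \<Rightarrow> 'b::{banach, second_countable_topology}"
    and G g :: "real \<Rightarrow> 'c::{banach, second_countable_topology}"
    and prod :: "'b \<Rightarrow> 'c \<Rightarrow> 'd::{banach, second_countable_topology}" (infixl \<open>\<odot>\<close> 70)
  assumes bb: "bounded_bilinear (\<odot>)" and F: "primitive_on T F f" and G: "primitive_on T G g"
  shows "primitive_on T (\<lambda>x. F x \<odot> G x) (\<lambda>x. f x \<odot> G x + F x \<odot> g x)"
proof -
  interpret P: bounded_bilinear "(\<odot>)" by (rule bb)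
  obtain K where K: "0 \<le> K" "\<And>a b. norm (a \<odot> b) \<le> norm a * norm b * K"
    using P.nonneg_bounded by blast
  obtain M where M: "0 \<le> M" "\<And>s. s \<in> {0..T} \<Longrightarrow> norm (f s) \<le> M"
    "\<And>x y. x \<in> {0..T} \<Longrightarrow> y \<in> {0..T} \<Longrightarrow> norm (F x - F y) \<le> M * \<bar>x - y\<bar>"
    using primitive_on_lipschitz[OF F] by blast
  obtain N where N: "0 \<le> N" "\<And>s. s \<in> {0..T} \<Longrightarrow> norm (g s) \<le> N"
    "\<And>x y. x \<in> {0..T} \<Longrightarrow> y \<in> {0..T} \<Longrightarrow> norm (G x - G y) \<le> N * \<bar>x - y\<bar>"
    using primitive_on_lipschitz[OF G] by blast
  have bF: "norm (F s) \<le> norm (F 0) + M * T" if "s \<in> {0..T}" for s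
  proof -
    have "norm (F s) \<le> norm (F 0) + norm (F s - F 0)" using norm_triangle_ineq[of "F 0" "F s - F 0"] by simp
    also have "norm (F s - F 0) \<le> M * \<bar>s - 0\<bar>" using that by (intro M) auto
    also have "\<dots> \<le> M * T" using that M by (intro mult_left_mono) auto
    finally show ?thesis by simp
  qed
  have bG: "norm (G s) \<le> norm (G 0) + N * T" if "s \<in> {0..T}" for s
  proof -
    have "norm (G s) \<le> norm (G 0) + norm (G s - G 0)" using norm_triangle_ineq[of "G 0" "G s - G 0"] by simp
    also have "norm (G s - G 0) \<le> N * \<bar>s - 0\<bar>" using that by (intro N) auto
    also have "\<dots> \<le> N * T" using that N by (intro mult_left_mono) auto
    finally show ?thesis by simp
  qed
  let ?p = "\<lambda>x. f x \<odot> G x + F x \<odot> g x"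
  have mp: "set_borel_measurable borel {0..T} ?p"
  proof -
    have "set_borel_measurable borel {0..T} (\<lambda>x. f x \<odot> G x)" "set_borel_measurable borel {0..T} (\<lambda>x. F x \<odot> g x)"
      by (rule set_borel_measurable_bilinear[OF bb primitive_onD(1)[OF F] set_borel_measurable_continuous[OF primitive_on_continuous[OF G]]],
          rule set_borel_measurable_bilinear[OF bb set_borel_measurable_continuous[OF primitive_on_continuous[OF F]] primitive_onD(1)[OF G]])
    then show ?thesis
      by (simp add: set_borel_measurable_def scaleR_add_right)
  qed
  have bp: "norm (?p s) \<le> M * (norm (G 0) + N * T) * K + (norm (F 0) + M * T) * N * K" if s: "s \<in> {0..T}" for s
  proof -
    have "norm (?p s) \<le> norm (f s) * norm (G s) * K + norm (F s) * norm (g s) * K"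
      using K(2) by (intro order_trans[OF norm_triangle_ineq] add_mono)
    also have "\<dots> \<le> M * (norm (G 0) + N * T) * K + (norm (F 0) + M * T) * N * K"
      using s M N K bF bG by (intro add_mono mult_mono) auto
    finally show ?thesis .
  qed
  have ip: "set_integrable lborel {a..b} ?p" if "0 \<le> a" "b \<le> T" for a b
    using that set_integrable_bounded[OF set_borel_measurable_subinterval[OF mp that], OF bp] by auto
  define D where "D x = F x \<odot> G x - (LBINT s:{0..x}. ?p s)" for x
  have "norm (D b - D a) \<le> (3 * (M * N * K)) * (b - a)\<^sup>2" if ab: "0 \<le> a" "a \<le> b" "b \<le> T" for a b
  proof -
    have "set_integrable lborel {a..b} f" "set_integrable lborel {a..b} g"
      using primitive_on_integrable[OF F] primitive_on_integrable[OF G] ab by auto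
    then have i: "set_integrable lborel {a..b} (\<lambda>s. f s \<odot> G a)" "set_integrable lborel {a..b} (\<lambda>s. F a \<odot> g s)"
      and e: "(LBINT s:{a..b}. f s \<odot> G a) = (LBINT s:{a..b}. f s) \<odot> G a"
        "(LBINT s:{a..b}. F a \<odot> g s) = F a \<odot> (LBINT s:{a..b}. g s)"
      unfolding set_integrable_def set_lebesgue_integral_def
      using integrable_bounded_linear[OF P.bounded_linear_left[of "G a"], of lborel "\<lambda>x. indicator {a..b} x *\<^sub>R f x"]
        integrable_bounded_linear[OF P.bounded_linear_right[of "F a"], of lborel "\<lambda>x. indicator {a..b} x *\<^sub>R g x"]
        integral_bounded_linear[OF P.bounded_linear_left[of "G a"], of lborel "\<lambda>x. indicator {a..b} x *\<^sub>R f x"]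
        integral_bounded_linear[OF P.bounded_linear_right[of "F a"], of lborel "\<lambda>x. indicator {a..b} x *\<^sub>R g x"]
      by (simp_all add: P.scaleR_left P.scaleR_right)
    let ?r = "\<lambda>s. ?p s - (f s \<odot> G a + F a \<odot> g s)"
    have int_le: "norm (LBINT s:{a..b}. ?r s) \<le> (2 * (M * N * K) * (b - a)) * (b - a)"
    proof (rule norm_set_integral_le)
      show "set_integrable lborel {a..b} ?r"
        using ab by (intro set_integral_diff(1) ip set_integral_add(1)[OF i])
      fix s assume s: "s \<in> {a..b}"
      have "?r s = f s \<odot> (G s - G a) + (F s - F a) \<odot> g s"
        by (simp add: P.diff_left P.diff_right)
      also have "norm \<dots> \<le> norm (f s) * norm (G s - G a) * K + norm (F s - F a) * norm (g s) * K"
        using K(2) by (intro order_trans[OF norm_triangle_ineq] add_mono)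
      also have "\<dots> \<le> M * (N * (b - a)) * K + M * (b - a) * N * K"
      proof (intro add_mono mult_mono)
        have "norm (G s - G a) \<le> N * \<bar>s - a\<bar>" "norm (F s - F a) \<le> M * \<bar>s - a\<bar>"
          using M(3)[of s a] N(3)[of s a] s ab by auto
        moreover have "N * \<bar>s - a\<bar> \<le> N * (b - a)" "M * \<bar>s - a\<bar> \<le> M * (b - a)"
          using M(1) N(1) s by (auto intro!: mult_left_mono)
        ultimately show "norm (G s - G a) \<le> N * (b - a)" "norm (F s - F a) \<le> M * (b - a)" by auto
      qed (use M N K s ab in auto)
      finally show "norm (?r s) \<le> 2 * (M * N * K) * (b - a)" by (simp add: algebra_simps)
    qed (use ab in auto)
    have prod_le: "norm ((F b - F a) \<odot> (G b - G a)) \<le> (M * (b - a)) * (N * (b - a)) * K"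
      using M(3)[of b a] N(3)[of b a] M(1) N(1) K ab
      by (intro order_trans[OF K(2)] mult_mono) auto
    have D_eq: "D b - D a = (F b - F a) \<odot> (G b - G a) - (LBINT s:{a..b}. ?r s)"
    proof -
      have "(LBINT s:{a..b}. ?r s) = (LBINT s:{a..b}. ?p s) - ((F b - F a) \<odot> G a + F a \<odot> (G b - G a))"
        using ip i ab e primitive_on_diff[OF F ab] primitive_on_diff[OF G ab]
        by (simp add: set_integral_diff set_integral_add)
      moreover have "D b - D a = F b \<odot> G b - F a \<odot> G a - (LBINT s:{a..b}. ?p s)"
        unfolding D_def using set_integral_split[OF ip, of 0 b a] ab by simp
      ultimately show ?thesis by (simp add: P.diff_left P.diff_right)
    qed
    have "norm (D b - D a) \<le> (M * (b - a)) * (N * (b - a)) * K + (2 * (M * N * K) * (b - a)) * (b - a)"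
      unfolding D_eq by (rule order_trans[OF norm_triangle_ineq4 add_mono[OF prod_le int_le]])
    then show ?thesis by (simp add: power2_eq_square algebra_simps)
  qed
  then have "D x = D 0" if "x \<in> {0..T}" for x
    using that by (rule quadratic_increments_imp_constant)
  moreover have "D 0 = F 0 \<odot> G 0"
    by (simp add: D_def)
  moreover have "F x \<odot> G x = D x + (LBINT s:{0..x}. ?p s)" for x
    by (simp only: D_def diff_add_cancel)
  ultimately have "F x \<odot> G x = F 0 \<odot> G 0 + (LBINT s:{0..x}. ?p s)" if "x \<in> {0..T}" for x
    using that by metis
  with mp bp show ?thesis unfolding primitive_on_def by blast
qed


lemma norm_exp_remainder_le:
  fixes z :: "'k::{real_normed_field, banach}"
  shows "norm (exp z - (\<Sum>n<k. inverse (fact n) *\<^sub>R z ^ n)) \<le> norm z ^ k * exp (norm z)"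
proof -
  have s: "(\<lambda>n. inverse (fact n) * norm z ^ n) sums exp (norm z)"
    using exp_converges[of "norm z"] by simp
  have le: "norm (inverse (fact (n + k)) *\<^sub>R z ^ (n + k)) \<le> norm z ^ k * (inverse (fact n) * norm z ^ n)" for n
  proof -
    have "inverse (fact (n + k)) \<le> (inverse (fact n) :: real)"
      by (intro le_imp_inverse_le fact_mono) auto
    then have "inverse (fact (n + k)) * norm z ^ (n + k) \<le> inverse (fact n) * norm z ^ (n + k)"
      by (intro mult_right_mono) auto
    then show ?thesis by (simp add: norm_power power_add norm_mult mult_ac)
  qed
  have sk: "summable (\<lambda>n. norm z ^ k * (inverse (fact n) * norm z ^ n))"
    using s by (intro summable_mult) (simp add: sums_iff)
  have "exp z - (\<Sum>n<k. inverse (fact n) *\<^sub>R z ^ n) = (\<Sum>n. inverse (fact (n + k)) *\<^sub>R z ^ (n + k))"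
    using exp_first_terms[of z k] by simp
  also have "norm \<dots> \<le> (\<Sum>n. norm z ^ k * (inverse (fact n) * norm z ^ n))"
    using le by (rule norm_suminf_le[OF _ sk])
  also have "\<dots> = norm z ^ k * exp (norm z)"
    using s by (subst suminf_mult) (auto simp: sums_iff)
  finally show ?thesis .
qed

text \<open>The chain rule for the exponential, again by increments of second order.\<close>

lemma primitive_on_exp:
  fixes A a :: "real \<Rightarrow> 'k::{real_normed_field, banach, second_countable_topology}"
  assumes A: "primitive_on T A a"
  shows "primitive_on T (\<lambda>x. exp (A x)) (\<lambda>x. a x * exp (A x))"
proof -
  obtain M where M: "0 \<le> M" "\<And>s. s \<in> {0..T} \<Longrightarrow> norm (a s) \<le> M"
    "\<And>x y. x \<in> {0..T} \<Longrightarrow> y \<in> {0..T} \<Longrightarrow> norm (A x - A y) \<le> M * \<bar>x - y\<bar>"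
    using primitive_on_lipschitz[OF A] by blast
  have cA: "continuous_on {0..T} A" by (rule primitive_on_continuous[OF A])
  then have cE: "continuous_on {0..T} (\<lambda>x. exp (A x))" by (intro continuous_intros)
  then have "bounded ((\<lambda>x. exp (A x)) ` {0..T})"
    by (intro compact_imp_bounded compact_continuous_image) auto
  then obtain B where B: "\<And>x. x \<in> {0..T} \<Longrightarrow> norm (exp (A x)) \<le> B"
    unfolding bounded_iff by blast
  define R where "R = M * T"
  have dR: "norm (A x - A y) \<le> R" if "x \<in> {0..T}" "y \<in> {0..T}" for x y
  proof -
    have "M * \<bar>x - y\<bar> \<le> R" unfolding R_def using that M(1) by (intro mult_left_mono) auto
    with M(3)[OF that] show ?thesis by linarith
  qed
  let ?p = "\<lambda>x. a x * exp (A x)"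
  have mp: "set_borel_measurable borel {0..T} ?p"
    by (rule set_borel_measurable_bilinear[OF bounded_bilinear_mult primitive_onD(1)[OF A] set_borel_measurable_continuous[OF cE]])
  have bp: "norm (?p s) \<le> M * B" if "s \<in> {0..T}" for s
    using M(1) M(2)[OF that] B[OF that] by (auto simp: norm_mult intro!: mult_mono)
  have ip: "set_integrable lborel {a..b} ?p" if "0 \<le> a" "b \<le> T" for a b
    using that set_integrable_bounded[OF set_borel_measurable_subinterval[OF mp that], OF bp] by auto
  define D where "D x = exp (A x) - (LBINT s:{0..x}. ?p s)" for x
  have "norm (D v - D u) \<le> (2 * (M\<^sup>2 * B * exp R)) * (v - u)\<^sup>2" if uv: "0 \<le> u" "u \<le> v" "v \<le> T" for u v
  proof -
    have B0: "0 \<le> B"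
      using B[of u] uv order_trans[OF norm_ge_zero] by auto
    have exp_diff: "norm (exp (A x) - exp (A y)) \<le> B * (M * (v - u) * exp R)"
      if xy: "x \<in> {u..v}" "y \<in> {u..v}" for x y
    proof -
      have xyT: "x \<in> {0..T}" "y \<in> {0..T}" using xy uv by auto
      have "exp (A x) - exp (A y) = exp (A y) * (exp (A x - A y) - 1)"
        by (simp add: right_diff_distrib flip: exp_add)
      also have "norm \<dots> = norm (exp (A y)) * norm (exp (A x - A y) - 1)" by (rule norm_mult)
      also have "\<dots> \<le> B * (norm (A x - A y) * exp (norm (A x - A y)))"
        using norm_exp_remainder_le[of "A x - A y" 1] B[OF xyT(2)] B0 by (intro mult_mono) auto
      also have "\<dots> \<le> B * (M * (v - u) * exp R)"
      proof (intro mult_left_mono mult_mono)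
        have "M * \<bar>x - y\<bar> \<le> M * (v - u)" using xy M(1) by (intro mult_left_mono) auto
        with M(3)[OF xyT] show "norm (A x - A y) \<le> M * (v - u)" by linarith
        show "exp (norm (A x - A y)) \<le> exp R" using dR[OF xyT] by simp
      qed (use M uv B0 in auto)
      finally show ?thesis .
    qed
    have u: "u \<in> {0..T}" and v: "v \<in> {0..T}" using uv by auto
    have i: "set_integrable lborel {u..v} a" using primitive_on_integrable[OF A] uv by auto
    then have i': "set_integrable lborel {u..v} (\<lambda>s. a s * exp (A u))" by simp
    let ?r = "\<lambda>s. ?p s - a s * exp (A u)"
    have 1: "norm (LBINT s:{u..v}. ?r s) \<le> (M * (B * (M * (v - u) * exp R))) * (v - u)"
    proof (rule norm_set_integral_le)
      show "set_integrable lborel {u..v} ?r" using uv by (intro set_integral_diff(1) ip i')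
      fix s assume s: "s \<in> {u..v}"
      have "?r s = a s * (exp (A s) - exp (A u))" by (simp add: right_diff_distrib)
      also have "norm \<dots> \<le> M * (B * (M * (v - u) * exp R))"
        unfolding norm_mult using s uv M by (intro mult_mono exp_diff) auto
      finally show "norm (?r s) \<le> M * (B * (M * (v - u) * exp R))" .
    qed (use uv in auto)
    let ?z = "A v - A u"
    have 2: "norm (exp (A u) * (exp ?z - 1 - ?z)) \<le> B * ((M * (v - u))\<^sup>2 * exp R)"
    proof -
      have "norm (exp ?z - 1 - ?z) \<le> norm ?z ^ 2 * exp (norm ?z)"
        using norm_exp_remainder_le[of ?z 2] by (simp add: numeral_2_eq_2 algebra_simps)
      also have "\<dots> \<le> (M * (v - u))\<^sup>2 * exp R"
        using M(3)[OF v u] dR[OF v u] uv by (intro mult_mono power_mono) auto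
      finally show ?thesis using B[OF u] B0 unfolding norm_mult by (intro mult_mono) auto
    qed
    have "D v - D u = exp (A u) * (exp ?z - 1 - ?z) - (LBINT s:{u..v}. ?r s)"
    proof -
      have "(LBINT s:{u..v}. ?r s) = (LBINT s:{u..v}. ?p s) - ?z * exp (A u)"
        using ip i' uv primitive_on_diff[OF A uv] by (simp add: set_integral_diff)
      moreover have "D v - D u = exp (A v) - exp (A u) - (LBINT s:{u..v}. ?p s)"
        unfolding D_def using set_integral_split[OF ip, of 0 v u] uv by simp
      moreover have "exp (A v) = exp (A u) * exp ?z" by (simp flip: exp_add)
      ultimately show ?thesis by (simp add: algebra_simps)
    qed
    with 1 2 norm_triangle_ineq4[of "exp (A u) * (exp ?z - 1 - ?z)" "LBINT s:{u..v}. ?r s"]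
    have "norm (D v - D u) \<le> B * ((M * (v - u))\<^sup>2 * exp R) + (M * (B * (M * (v - u) * exp R))) * (v - u)"
      by simp
    then show ?thesis by (simp add: power2_eq_square algebra_simps)
  qed
  then have "D x = D 0" if "x \<in> {0..T}" for x
    using that by (rule quadratic_increments_imp_constant)
  moreover have "D 0 = exp (A 0)"
    by (simp add: D_def)
  moreover have "exp (A x) = D x + (LBINT s:{0..x}. ?p s)" for x
    by (simp only: D_def diff_add_cancel)
  ultimately have "exp (A x) = exp (A 0) + (LBINT s:{0..x}. ?p s)" if "x \<in> {0..T}" for x
    using that by metis
  with mp bp show ?thesis unfolding primitive_on_def by blast
qed

section \<open>The transport equation along characteristics\<close>

lemma norm_set_integral_minus_value_le:
  fixes h :: "real \<Rightarrow> 'b::{banach, second_countable_topology}"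
  assumes "set_integrable lborel {a..b} h" "a \<le> b" "0 \<le> L"
    and lip: "\<And>s. s \<in> {a..b} \<Longrightarrow> norm (h s - z) \<le> L * (b - a)"
  shows "norm ((LBINT s:{a..b}. h s) - (b - a) *\<^sub>R z) \<le> L * (b - a)\<^sup>2"
proof -
  have i: "set_integrable lborel {a..b} (\<lambda>s. z)"
    by (rule set_integrable_bounded[of _ _ _ "norm z"])
      (auto intro: set_borel_measurable_continuous)
  have "(LBINT s:{a..b}. z) = (b - a) *\<^sub>R z"
    unfolding set_lebesgue_integral_def using assms(2)
    by (subst integral_scaleR_left) (auto simp: emeasure_lborel_Icc_eq)
  then have "(LBINT s:{a..b}. h s) - (b - a) *\<^sub>R z = (LBINT s:{a..b}. h s - z)"
    using set_integral_diff(2)[OF assms(1) i] by simp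
  also have "norm \<dots> \<le> L * (b - a) * (b - a)"
    using assms i by (intro norm_set_integral_le set_integral_diff(1)) auto
  finally show ?thesis by (simp add: power2_eq_square mult.assoc)
qed

text \<open>The primitive of a Lipschitz function \<open>v\<close> has derivative \<open>v\<close>, with a quadratic remainder.\<close>

lemma lipschitz_integral_increment:
  fixes v :: "real \<Rightarrow> 'b::{banach, second_countable_topology}"
  assumes lip: "\<And>x y. x \<in> {0..T} \<Longrightarrow> y \<in> {0..T} \<Longrightarrow> norm (v x - v y) \<le> L * \<bar>x - y\<bar>" and L: "0 \<le> L"
    and ab: "a \<in> {0..T}" "b \<in> {0..T}"
  shows "norm ((LBINT s:{0..b}. v s) - (LBINT s:{0..a}. v s) - (b - a) *\<^sub>R v a) \<le> L * (b - a)\<^sup>2"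
proof -
  have cont: "continuous_on {0..T} v"
    using lip L by (intro lipschitz_on_continuous_on[of L]) (auto simp: lipschitz_on_def dist_norm dist_real_def)
  have "bounded (v ` {0..T})" using cont by (intro compact_imp_bounded compact_continuous_image) auto
  then obtain N where N: "\<And>x. x \<in> {0..T} \<Longrightarrow> norm (v x) \<le> N" unfolding bounded_iff by blast
  have i: "set_integrable lborel {x..y} v" if "0 \<le> x" "y \<le> T" for x y
    using set_integrable_bounded[OF set_borel_measurable_subinterval[OF set_borel_measurable_continuous[OF cont] that], of N] N that
    by auto
  have *: "norm ((LBINT s:{x..y}. v s) - (y - x) *\<^sub>R v z) \<le> L * (y - x)\<^sup>2"
    if "0 \<le> x" "x \<le> y" "y \<le> T" "z \<in> {x..y}" for x y z
  proof (rule norm_set_integral_minus_value_le[OF i])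
    show "norm (v s - v z) \<le> L * (y - x)" if "s \<in> {x..y}" for s
    proof -
      have "norm (v s - v z) \<le> L * \<bar>s - z\<bar>" using that \<open>z \<in> {x..y}\<close> \<open>0 \<le> x\<close> \<open>y \<le> T\<close> by (intro lip) auto
      also have "\<dots> \<le> L * (y - x)" using that \<open>z \<in> {x..y}\<close> L by (intro mult_left_mono) auto
      finally show ?thesis .
    qed
  qed (use that L in auto)
  have split: "(LBINT s:{0..y}. v s) - (LBINT s:{0..x}. v s) = (LBINT s:{x..y}. v s)" if "0 \<le> x" "x \<le> y" "y \<le> T" for x y
    using set_integral_split[OF i[of 0 y], of x] that by simp
  show ?thesis
  proof (cases "a \<le> b")
    case True
    then show ?thesis using split[of a b] *[of a b a] ab by auto
  next
    case False
    then have "norm ((LBINT s:{b..a}. v s) - (a - b) *\<^sub>R v a) \<le> L * (b - a)\<^sup>2"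
      using *[of b a a] ab by (simp add: power2_commute)
    moreover have "(LBINT s:{0..b}. v s) - (LBINT s:{0..a}. v s) - (b - a) *\<^sub>R v a
        = - ((LBINT s:{b..a}. v s) - (a - b) *\<^sub>R v a)"
      using split[of b a] False ab by (simp add: algebra_simps)
    ultimately show ?thesis by (simp only: norm_minus_cancel)
  qed
qed

lemma has_vector_derivative_iff_quotient:
  "(f has_vector_derivative y) (at x within S) \<longleftrightarrow>
    ((\<lambda>r. (1 / (r - x)) *\<^sub>R (f r - f x)) \<longlongrightarrow> y) (at x within S)"
proof -
  have "(f has_vector_derivative y) (at x within S) \<longleftrightarrow>
      ((\<lambda>r. norm (f r - f x - (r - x) *\<^sub>R y) / norm (r - x)) \<longlongrightarrow> 0) (at x within S)"
    unfolding has_vector_derivative_def has_derivative_iff_norm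
    by (simp add: bounded_linear_scaleR_left)
  also have "\<dots> \<longleftrightarrow> ((\<lambda>r. norm ((1 / (r - x)) *\<^sub>R (f r - f x) - y)) \<longlongrightarrow> 0) (at x within S)"
  proof (rule tendsto_cong)
    have "norm (f r - f x - (r - x) *\<^sub>R y) / norm (r - x) = norm ((1 / (r - x)) *\<^sub>R (f r - f x) - y)"
      if "r \<noteq> x" for r
    proof -
      have "(1 / (r - x)) *\<^sub>R (f r - f x) - y = (1 / (r - x)) *\<^sub>R (f r - f x - (r - x) *\<^sub>R y)"
        using that by (simp add: scaleR_diff_right)
      then show ?thesis by simp
    qed
    then show "\<forall>\<^sub>F r in at x within S. norm (f r - f x - (r - x) *\<^sub>R y) / norm (r - x)
        = norm ((1 / (r - x)) *\<^sub>R (f r - f x) - y)"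
      by (auto simp: eventually_at_filter)
  qed
  also have "\<dots> \<longleftrightarrow> ((\<lambda>r. (1 / (r - x)) *\<^sub>R (f r - f x)) \<longlongrightarrow> y) (at x within S)"
    unfolding tendsto_norm_zero_iff by (rule LIM_zero_iff)
  finally show ?thesis .
qed

text \<open>
  \<open>V(\<cdot>,t)\<close> is a primitive of \<open>v(\<cdot>,t)\<close>, and \<open>v\<close> solves the transport equation in the
  integrated form that the weak* derivative provides. The mass of \<open>v\<close> in a window that moves
  along the characteristics does not change.
\<close>

lemma constant_along_characteristics:
  fixes v V :: "real \<Rightarrow> real \<Rightarrow> 'b::real_normed_vector"
  assumes c: "0 < c" and t0: "0 \<le> t0" and x: "x \<in> {0..<1}"
    and lip: "\<And>a b t. a \<in> {0..1} \<Longrightarrow> b \<in> {0..1} \<Longrightarrow> t \<in> {t0..t0 + x / c} \<Longrightarrow>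
      norm (V b t - V a t - (b - a) *\<^sub>R v a t) \<le> L * (b - a)\<^sup>2"
    and deriv: "\<And>b t. b \<in> {0..1} \<Longrightarrow> 0 \<le> t \<Longrightarrow>
      (V b has_vector_derivative c *\<^sub>R (v b t - v 0 t)) (at t within {0..})"
    and cont: "\<And>b t. b \<in> {0..1} \<Longrightarrow> 0 \<le> t \<Longrightarrow>
      ((\<lambda>r. v b r - v 0 r) \<longlongrightarrow> v b t - v 0 t) (at t within {0..})"
  shows "v x t0 = v 0 (t0 + x / c)"
proof -
  define T where "T = {t0..t0 + x / c}"
  have T: "T \<subseteq> {0..}" using t0 by (auto simp: T_def)
  have t0T: "t0 \<in> T" "t0 + x / c \<in> T" using x c by (auto simp: T_def)
  have L0: "0 \<le> L"
    using order_trans[OF norm_ge_zero lip[of 0 1 t0]] t0T by (auto simp: T_def)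
  \<comment> \<open>the characteristic through \<open>(x,t0)\<close>\<close>
  define p where "p t = x - c * (t - t0)" for t
  have p: "p t \<in> {0..x}" if "t \<in> T" for t
    using that x c by (auto simp: p_def T_def field_simps)
  have window: "V (x + h) t0 - V x t0 = V h (t0 + x / c) - V 0 (t0 + x / c)" if h: "0 < h" "x + h \<le> 1" for h
  proof -
    \<comment> \<open>the mass in the window of width \<open>h\<close> that starts on the characteristic\<close>
    define W where "W t = V (p t + h) t - V (p t) t" for t
    have "(W has_vector_derivative 0) (at t within T)" if t: "t \<in> T" for t
    proof -
      have t': "0 \<le> t" using t T by auto
      have pt: "p t + d \<in> {0..1}" if "d \<in> {0, h}" for d
        using p[OF t] x h that by auto
      let ?d = "\<lambda>r. v (p t + h) r - v (p t) r"
      let ?E = "\<lambda>r. (V (p r + h) r - V (p t + h) r - (p r - p t) *\<^sub>R v (p t + h) r)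
          - (V (p r) r - V (p t) r - (p r - p t) *\<^sub>R v (p t) r)"
      have lim1: "((\<lambda>r. (1 / (r - t)) *\<^sub>R (V (p t + d) r - V (p t + d) t)) \<longlongrightarrow>
          c *\<^sub>R (v (p t + d) t - v 0 t)) (at t within T)" if "d \<in> {0, h}" for d
        using deriv[OF pt[OF that] t'] T has_vector_derivative_within_subset
        unfolding has_vector_derivative_iff_quotient[symmetric] by blast
      have lim2: "(?d \<longlongrightarrow> v (p t + h) t - v (p t) t) (at t within T)"
        using tendsto_diff[OF cont[OF pt[of h] t'] cont[OF pt[of 0] t']] T tendsto_within_subset
        by fastforce
      have lim3: "((\<lambda>r. (1 / (r - t)) *\<^sub>R ?E r) \<longlongrightarrow> 0) (at t within T)"
      proof (rule Lim_null_comparison)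
        have "norm ((1 / (r - t)) *\<^sub>R ?E r) \<le> 2 * L * c\<^sup>2 * \<bar>r - t\<bar>" if r: "r \<in> T" "r \<noteq> t" for r
        proof -
          have 1: "norm (V (p r + d) r - V (p t + d) r - (p r - p t) *\<^sub>R v (p t + d) r) \<le> L * (p r - p t)\<^sup>2"
            if "d \<in> {0, h}" for d
          proof -
            have "p r + d \<in> {0..1}" using p[OF r(1)] x h that by auto
            from lip[OF pt[OF that] this, of r] r(1) show ?thesis by (simp add: T_def)
          qed
          have 2: "norm (?E r) \<le> 2 * (L * (p r - p t)\<^sup>2)"
            using 1[of h] 1[of 0] by (intro order_trans[OF norm_triangle_ineq4]) simp
          have 3: "(p r - p t)\<^sup>2 = c\<^sup>2 * \<bar>r - t\<bar> * \<bar>r - t\<bar>"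
            by (simp add: p_def power2_eq_square algebra_simps flip: abs_mult)
          show ?thesis using 2 r(2) unfolding 3 norm_scaleR
            by (simp add: divide_simps mult_ac)
        qed
        then show "\<forall>\<^sub>F r in at t within T. norm ((1 / (r - t)) *\<^sub>R ?E r) \<le> 2 * L * c\<^sup>2 * \<bar>r - t\<bar>"
          by (auto simp: eventually_at_filter)
        have "((\<lambda>r. 2 * L * c\<^sup>2 * \<bar>r - t\<bar>) \<longlongrightarrow> 2 * L * c\<^sup>2 * \<bar>t - t\<bar>) (at t within T)"
          by (intro tendsto_intros)
        then show "((\<lambda>r. 2 * L * c\<^sup>2 * \<bar>r - t\<bar>) \<longlongrightarrow> 0) (at t within T)" by simp
      qed
      have "((\<lambda>r. (1 / (r - t)) *\<^sub>R (V (p t + h) r - V (p t + h) t) - (1 / (r - t)) *\<^sub>R (V (p t) r - V (p t) t)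
          - c *\<^sub>R ?d r + (1 / (r - t)) *\<^sub>R ?E r) \<longlongrightarrow>
          c *\<^sub>R (v (p t + h) t - v 0 t) - c *\<^sub>R (v (p t) t - v 0 t) - c *\<^sub>R (v (p t + h) t - v (p t) t) + 0)
          (at t within T)"
        using tendsto_add[OF tendsto_diff[OF tendsto_diff[OF lim1[of h] lim1[of 0]]
              tendsto_scaleR[OF tendsto_const[of c] lim2]] lim3]
        by simp
      then have "((\<lambda>r. (1 / (r - t)) *\<^sub>R (W r - W t)) \<longlongrightarrow> c *\<^sub>R (v (p t + h) t - v 0 t)
          - c *\<^sub>R (v (p t) t - v 0 t) - c *\<^sub>R (v (p t + h) t - v (p t) t) + 0) (at t within T)"
      proof (rule Lim_transform_eventually)
        have "(1 / (r - t)) *\<^sub>R (V (p t + h) r - V (p t + h) t) - (1 / (r - t)) *\<^sub>R (V (p t) r - V (p t) t)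
          - c *\<^sub>R ?d r + (1 / (r - t)) *\<^sub>R ?E r = (1 / (r - t)) *\<^sub>R (W r - W t)" if "r \<noteq> t" for r
        proof -
          have e: "c *\<^sub>R ?d r = (1 / (r - t)) *\<^sub>R ((c * (r - t)) *\<^sub>R ?d r)"
            using that by simp
          have pp: "p r - p t = - (c * (r - t))" by (simp add: p_def algebra_simps)
          show ?thesis
            unfolding e scaleR_diff_right[symmetric] scaleR_add_right[symmetric] pp W_def
            by (rule arg_cong[where f = "scaleR (1 / (r - t))"]) (simp add: scaleR_diff_right)
        qed
        then show "\<forall>\<^sub>F r in at t within T. (1 / (r - t)) *\<^sub>R (V (p t + h) r - V (p t + h) t)
          - (1 / (r - t)) *\<^sub>R (V (p t) r - V (p t) t) - c *\<^sub>R ?d r + (1 / (r - t)) *\<^sub>R ?E r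
          = (1 / (r - t)) *\<^sub>R (W r - W t)"
          by (auto simp: eventually_at_filter)
      qed
      then show ?thesis unfolding has_vector_derivative_iff_quotient by (simp add: scaleR_diff_right)
    qed
    then obtain k where "\<And>t. t \<in> T \<Longrightarrow> W t = k"
      using has_vector_derivative_zero_constant[of T W] by (auto simp: T_def)
    then have "W t0 = W (t0 + x / c)" using t0T by simp
    then show ?thesis using c by (simp add: W_def p_def)
  qed
  have small: "norm (v x t0 - v 0 (t0 + x / c)) \<le> 2 * L * h" if h: "0 < h" "h < 1 - x" for h
  proof -
    have 1: "norm (V (x + h) t0 - V x t0 - h *\<^sub>R v x t0) \<le> L * h\<^sup>2"
      using lip[of x "x + h" t0] t0T x h by (auto simp: T_def)
    have 2: "norm (V h (t0 + x / c) - V 0 (t0 + x / c) - h *\<^sub>R v 0 (t0 + x / c)) \<le> L * h\<^sup>2"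
      using lip[of 0 h "t0 + x / c"] t0T x h by (auto simp: T_def)
    have "h *\<^sub>R (v x t0 - v 0 (t0 + x / c)) =
        (V h (t0 + x / c) - V 0 (t0 + x / c) - h *\<^sub>R v 0 (t0 + x / c)) - (V (x + h) t0 - V x t0 - h *\<^sub>R v x t0)"
      using window[of h] h by (simp add: scaleR_diff_right)
    then have "norm (h *\<^sub>R (v x t0 - v 0 (t0 + x / c))) \<le> L * h\<^sup>2 + L * h\<^sup>2"
      using norm_triangle_ineq4[of "V h (t0 + x / c) - V 0 (t0 + x / c) - h *\<^sub>R v 0 (t0 + x / c)"
          "V (x + h) t0 - V x t0 - h *\<^sub>R v x t0"] 1 2 by simp
    moreover have "norm (h *\<^sub>R (v x t0 - v 0 (t0 + x / c))) = h * norm (v x t0 - v 0 (t0 + x / c))"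
      using h by simp
    moreover have "L * h\<^sup>2 + L * h\<^sup>2 = h * (2 * L * h)"
      by (simp add: power2_eq_square algebra_simps)
    ultimately have "h * norm (v x t0 - v 0 (t0 + x / c)) \<le> h * (2 * L * h)"
      by linarith
    then show ?thesis using h by simp
  qed
  have "norm (v x t0 - v 0 (t0 + x / c)) \<le> 0"
  proof (rule tendsto_lowerbound)
    have "((\<lambda>h. 2 * L * h) \<longlongrightarrow> 2 * L * 0) (at_right 0)" by (intro tendsto_intros)
    then show "((\<lambda>h. 2 * L * h) \<longlongrightarrow> 0) (at_right 0)" by simp
    show "\<forall>\<^sub>F h in at_right 0. norm (v x t0 - v 0 (t0 + x / c)) \<le> 2 * L * h"
      using small x by (intro eventually_at_rightI[of 0 "1 - x"]) auto
  qed simp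
  then show ?thesis by simp
qed

section \<open>Weak convergence is convergence of primitives\<close>

lemma integrable_mult_bounded:
  fixes p h :: "'a \<Rightarrow> 'k::{real_normed_field, banach, second_countable_topology}"
  assumes p: "integrable N p" and h: "h \<in> borel_measurable N" "AE s in N. norm (h s) \<le> M"
  shows "integrable N (\<lambda>s. p s * h s)" "norm (LINT s|N. p s * h s) \<le> M * (LINT s|N. norm (p s))"
proof -
  have le: "AE s in N. norm (p s * h s) \<le> M * norm (p s)"
    using h(2) by eventually_elim (simp add: norm_mult mult.commute[of M] mult_left_mono)
  have i: "integrable N (\<lambda>s. M * norm (p s))" using p by simp
  show *: "integrable N (\<lambda>s. p s * h s)"
  proof (rule Bochner_Integration.integrable_bound[OF i])
    show "(\<lambda>s. p s * h s) \<in> borel_measurable N" using p h(1) by measurable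
    show "AE s in N. norm (p s * h s) \<le> norm (M * norm (p s))"
      using le by eventually_elim (auto simp: abs_real_def)
  qed
  have "norm (LINT s|N. p s * h s) \<le> (LINT s|N. norm (p s * h s))" by (rule integral_norm_bound)
  also have "\<dots> \<le> (LINT s|N. M * norm (p s))"
    using * i le by (intro integral_mono_AE) auto
  finally show "norm (LINT s|N. p s * h s) \<le> M * (LINT s|N. norm (p s))" by simp
qed

lemma finite_measure_unit_interval: "finite_measure unit_interval"
  by (rule finite_measure_lebesgue_on) simp

lemma integrable_bounded_unit_interval:
  fixes f :: "real \<Rightarrow> 'b::{banach, second_countable_topology}"
  assumes "f \<in> borel_measurable unit_interval" "AE s in unit_interval. norm (f s) \<le> M"
  shows "integrable unit_interval f"
  using finite_measure.integrable_const_bound[OF finite_measure_unit_interval assms(2,1)] .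

text \<open>
  For bounded functions, convergence of all primitives implies convergence of the integrals against
  every integrable function: indicators of intervals are tested by assumption, hence indicators of
  Borel sets, and these span a dense subspace of \<open>L\<^sup>1\<close>.
\<close>

lemma weak_limit_zero_of_primitives:
  fixes h :: "'a \<Rightarrow> real \<Rightarrow> 'k::{real_normed_field, banach, second_countable_topology}"
  assumes ev: "\<forall>\<^sub>F a in F. h a \<in> borel_measurable unit_interval \<and> (AE s in unit_interval. norm (h a s) \<le> M)"
    and prim: "\<And>x. x \<in> {0..1} \<Longrightarrow> ((\<lambda>a. LINT s|unit_interval. indicator {0..x} s *\<^sub>R h a s) \<longlongrightarrow> 0) F"
    and p: "integrable unit_interval p"
  shows "((\<lambda>a. LINT s|unit_interval. p s * h a s) \<longlongrightarrow> 0) F"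
proof -
  let ?I = "\<lambda>p a. LINT s|unit_interval. p s * h a s"
  define Q where "Q p \<longleftrightarrow> (?I p \<longlongrightarrow> 0) F" for p
  have Q_lim: "Q p" if p: "integrable unit_interval p" and pn: "\<And>n::nat. integrable unit_interval (P n)" "\<And>n. Q (P n)"
    and conv: "AE s in unit_interval. (\<lambda>n. P n s) \<longlonglongrightarrow> p s"
    and w: "integrable unit_interval w" "\<And>n. AE s in unit_interval. norm (P n s) \<le> w s" for p P w
    unfolding Q_def
  proof (rule tendstoI)
    fix e :: real assume "0 < e"
    define K where "K = \<bar>M\<bar> + 1"
    have "0 < K" by (simp add: K_def)
    have "(\<lambda>n. LINT s|unit_interval. norm (p s - P n s)) \<longlonglongrightarrow> (LINT s|unit_interval. 0)"
    proof (rule integral_dominated_convergence[where w = "\<lambda>s. norm (p s) + w s"])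
      show "AE s in unit_interval. (\<lambda>n. norm (p s - P n s)) \<longlonglongrightarrow> 0"
        using conv
      proof eventually_elim
        case (elim s)
        have "(\<lambda>n. norm (p s - P n s)) \<longlonglongrightarrow> norm (p s - p s)" by (intro tendsto_intros elim)
        then show ?case by simp
      qed
      show "AE s in unit_interval. norm (norm (p s - P n s)) \<le> norm (p s) + w s" for n
        using w(2)[of n] by eventually_elim (simp add: order_trans[OF norm_triangle_ineq4])
    qed (use p pn w in auto)
    then have "\<forall>\<^sub>F n in sequentially. (LINT s|unit_interval. norm (p s - P n s)) < e / (2 * K)"
      using \<open>0 < e\<close> \<open>0 < K\<close> by (intro order_tendstoD(2)) auto
    then obtain n where n: "(LINT s|unit_interval. norm (p s - P n s)) < e / (2 * K)"
      by (auto simp: eventually_sequentially)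
    have "\<forall>\<^sub>F a in F. norm (?I (P n) a) < e / 2"
      using pn(2)[of n] \<open>0 < e\<close> unfolding Q_def by (auto dest: tendstoD[of _ _ _ "e / 2"])
    then show "\<forall>\<^sub>F a in F. dist (?I p a) 0 < e"
      using ev
    proof eventually_elim
      case (elim a)
      then have h: "h a \<in> borel_measurable unit_interval" "AE s in unit_interval. norm (h a s) \<le> K"
        by (auto simp: K_def)
      have "?I p a = ?I (P n) a + (LINT s|unit_interval. (p s - P n s) * h a s)"
        using integrable_mult_bounded(1)[OF pn(1) h] integrable_mult_bounded(1)[OF p h]
        by (simp add: left_diff_distrib)
      also have "norm \<dots> < e / 2 + K * (e / (2 * K))"
      proof (intro norm_triangle_lt add_strict_mono elim)
        have "norm (LINT s|unit_interval. (p s - P n s) * h a s) \<le> K * (LINT s|unit_interval. norm (p s - P n s))"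
          using p pn by (intro integrable_mult_bounded(2) h) auto
        also have "\<dots> < K * (e / (2 * K))"
          using n \<open>0 < K\<close> by (rule mult_strict_left_mono)
        finally show "norm (LINT s|unit_interval. (p s - P n s) * h a s) < K * (e / (2 * K))" .
      qed
      finally show ?case using \<open>0 < K\<close> by simp
    qed
  qed
  have Q_add: "Q (\<lambda>s. p s + r s)" if "integrable unit_interval p" "integrable unit_interval r" "Q p" "Q r" for p r
  proof -
    have "((\<lambda>a. ?I p a + ?I r a) \<longlongrightarrow> 0 + 0) F"
      using that unfolding Q_def by (intro tendsto_add)
    moreover have "\<forall>\<^sub>F a in F. ?I p a + ?I r a = ?I (\<lambda>s. p s + r s) a"
      using ev
    proof eventually_elim
      case (elim a)
      then show ?case
        using that(1,2) integrable_mult_bounded(1)[of unit_interval _ "h a" M] by (simp add: distrib_right)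
    qed
    ultimately show ?thesis unfolding Q_def by (auto elim: Lim_transform_eventually)
  qed
  have meas_ind: "integrable unit_interval (\<lambda>s. indicator B s *\<^sub>R c)" if "B \<in> sets borel" for B and c :: 'k
  proof (rule integrable_bounded_unit_interval)
    show "(\<lambda>s. indicator B s *\<^sub>R c) \<in> borel_measurable unit_interval"
      using that by (intro borel_measurable_unit_interval borel_measurable_scaleR borel_measurable_indicator borel_measurable_const)
    show "AE s in unit_interval. norm (indicator B s *\<^sub>R c) \<le> norm c"
      by (intro AE_I2) (auto simp: indicator_def)
  qed
  have Q_cong: "Q r" if "\<And>s. s \<in> {0..1} \<Longrightarrow> p s = r s" "Q p" for p r
  proof -
    have "?I p a = ?I r a" for a by (intro Bochner_Integration.integral_cong) (auto simp: that)
    with that(2) show ?thesis by (simp add: Q_def)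
  qed
  have Q_prim: "Q (\<lambda>s. indicator {0..x} s *\<^sub>R c)" if "x \<in> {0..1}" for x c
  proof -
    have "((\<lambda>a. c * (LINT s|unit_interval. indicator {0..x} s *\<^sub>R h a s)) \<longlongrightarrow> c * 0) F"
      using prim[OF that] by (intro tendsto_intros)
    moreover have "c * (LINT s|unit_interval. indicator {0..x} s *\<^sub>R h a s) = ?I (\<lambda>s. indicator {0..x} s *\<^sub>R c) a" for a
      by (subst integral_mult_right_zero[symmetric]) simp
    ultimately show ?thesis by (simp add: Q_def)
  qed
  have Q_borel: "\<forall>c. Q (\<lambda>s. indicator B s *\<^sub>R c)" if "B \<in> sets borel" for B
  proof -
    have sb: "sets borel = sigma_sets UNIV (range (\<lambda>a::real. {..a}))"
      unfolding borel_eq_atMost by (rule sets_measure_of) simp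
    have st: "Int_stable (range (\<lambda>a::real. {..a}))" by (auto simp: Int_stable_def)
    show ?thesis
      using st subset_UNIV[of "range (\<lambda>a::real. {..a})", folded Pow_UNIV] that[unfolded sb]
    proof (induction rule: sigma_sets_induct_disjoint)
      case (basic A)
      then obtain x where A: "A = {..x}" by blast
      show ?case
      proof
        fix c
        show "Q (\<lambda>s. indicator A s *\<^sub>R c)"
        proof (cases "x < 0")
          case True
          show ?thesis
            by (rule Q_cong[of "\<lambda>_. 0"]) (use True in \<open>auto simp: A Q_def\<close>)
        next
          case False
          have "Q (\<lambda>s. indicator {0..min x 1} s *\<^sub>R c)" by (rule Q_prim) (use False in auto)
          then show ?thesis by (rule Q_cong[rotated]) (auto simp: A indicator_def)
        qed
      qed
    next
      case empty
      show ?case by (simp add: Q_def)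
    next
      case (compl A)
      then have A: "A \<in> sets borel" by (simp add: sb)
      show ?case
      proof
        fix c
        have "Q (\<lambda>s. indicator {0..1} s *\<^sub>R c + indicator A s *\<^sub>R (- c))"
          by (intro Q_add meas_ind Q_prim A compl.IH[rule_format]) auto
        then show "Q (\<lambda>s. indicator (UNIV - A) s *\<^sub>R c)"
          by (rule Q_cong[rotated]) (auto simp: indicator_def)
      qed
    next
      case (union A)
      then have A: "A i \<in> sets borel" for i by (auto simp: sb)
      show ?case
      proof
        fix c
        have fin: "Q (\<lambda>s. indicator (\<Union>i<n. A i) s *\<^sub>R c)" for n
        proof (induction n)
          case (Suc n)
          have "Q (\<lambda>s. indicator (\<Union>i<n. A i) s *\<^sub>R c + indicator (A n) s *\<^sub>R c)"
            using union.IH A Suc by (intro Q_add meas_ind) auto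
          moreover have "indicator (\<Union>i<n. A i) s + indicator (A n) s = indicat_real (\<Union>i<Suc n. A i) s" for s
          proof -
            have "(\<Union>i<n. A i) \<inter> A n = {}"
              using union(1) by (auto simp: disjoint_family_on_def) (metis IntI empty_iff less_irrefl)
            then show ?thesis by (auto simp: lessThan_Suc indicator_def)
          qed
          ultimately show ?case by (simp flip: scaleR_add_left)
        qed (simp add: Q_def)
        show "Q (\<lambda>s. indicator (\<Union>i. A i) s *\<^sub>R c)"
        proof (rule Q_lim[where P = "\<lambda>n s. indicator (\<Union>i<n. A i) s *\<^sub>R c" and w = "\<lambda>s. norm c"])
          show "AE s in unit_interval. (\<lambda>n. indicat_real (\<Union>i<n. A i) s *\<^sub>R c) \<longlonglongrightarrow> indicat_real (\<Union>i. A i) s *\<^sub>R c"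
            by (intro AE_I2 tendsto_intros LIMSEQ_indicator_UN)
          show "integrable unit_interval (\<lambda>s. norm c)"
            by (rule integrable_bounded_unit_interval[of _ "norm c"]) auto
          show "integrable unit_interval (\<lambda>s. indicator (\<Union>i. A i) s *\<^sub>R c)"
            "integrable unit_interval (\<lambda>s. indicator (\<Union>i<n. A i) s *\<^sub>R c)" for n
            using A by (auto intro!: meas_ind)
          show "AE s in unit_interval. norm (indicat_real (\<Union>i<n. A i) s *\<^sub>R c) \<le> norm c" for n
            by (intro AE_I2) (simp add: indicator_def)
        qed (rule fin)
      qed
    qed
  qed
  have Q_set: "Q (\<lambda>s. indicator A s *\<^sub>R c)" if "A \<in> sets unit_interval" for A c
  proof -
    obtain L where L: "L \<in> sets lebesgue" "A = {0..1} \<inter> L"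
      using \<open>A \<in> sets unit_interval\<close> by (auto simp: sets_restrict_space)
    obtain S N N' where S: "L = S \<union> N" "N \<subseteq> N'" "N' \<in> null_sets lborel" "S \<in> sets lborel"
      using L(1) by (rule sets_completionE)
    have S': "S \<in> sets borel" using S(4) by simp
    have "AE s in lborel. s \<notin> N'" by (rule AE_not_in) (rule S)
    then have ae: "AE s in unit_interval. indicat_real S s = indicat_real A s"
      unfolding AE_unit_interval_iff by eventually_elim (use S L in \<open>auto simp: indicator_def\<close>)
    have "integrable unit_interval (\<lambda>s. indicator A s *\<^sub>R c)"
      by (rule integrable_bounded_unit_interval[of _ "norm c"])
        (use \<open>A \<in> sets unit_interval\<close> in \<open>auto simp: indicator_def\<close>)
    then show ?thesis
    proof (rule Q_lim[where P = "\<lambda>n s. indicator S s *\<^sub>R c" and w = "\<lambda>s. norm c"])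
      show "integrable unit_interval (\<lambda>s. indicator S s *\<^sub>R c)" by (rule meas_ind[OF S'])
      show "Q (\<lambda>s. indicator S s *\<^sub>R c)" using Q_borel[OF S'] by blast
      show "AE s in unit_interval. (\<lambda>n. indicat_real S s *\<^sub>R c) \<longlonglongrightarrow> indicat_real A s *\<^sub>R c"
        using ae by eventually_elim simp
      show "integrable unit_interval (\<lambda>s. norm c)"
        by (rule integrable_bounded_unit_interval[of _ "norm c"]) auto
      show "AE s in unit_interval. norm (indicat_real S s *\<^sub>R c) \<le> norm c"
        by (intro AE_I2) (simp add: indicator_def)
    qed
  qed
  have "Q p"
    using p
  proof (induction rule: integrable_induct)
    case (base A c)
    then show ?case by (intro Q_set) simp
  next
    case (add f g)
    then show ?case by (intro Q_add)
  next
    case (lim f s)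
    show ?case
    proof (rule Q_lim[where P = s and w = "\<lambda>x. 2 * norm (f x)"])
      show "AE x in unit_interval. (\<lambda>n. s n x) \<longlonglongrightarrow> f x"
        using lim.hyps(2) by (intro AE_I2)
      show "AE x in unit_interval. norm (s n x) \<le> 2 * norm (f x)" for n
        using lim.hyps(3) by (intro AE_I2)
      show "integrable unit_interval (\<lambda>x. 2 * norm (f x))" using lim.hyps(4) by simp
    qed (use lim.hyps lim.IH in \<open>simp_all\<close>)
  qed
  then show ?thesis by (simp add: Q_def)
qed

text \<open>
  In particular, a bounded function with vanishing primitive is orthogonal to every integrable
  function, for instance to its own phase.
\<close>

lemma AE_zero_of_primitives_zero:
  fixes h :: "real \<Rightarrow> 'k::{real_normed_field, banach, second_countable_topology}"
  assumes h: "h \<in> borel_measurable unit_interval" "AE s in unit_interval. norm (h s) \<le> M"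
    and prim: "\<And>x. x \<in> {0..1} \<Longrightarrow> (LINT s|unit_interval. indicator {0..x} s *\<^sub>R h s) = 0"
  shows "AE s in unit_interval. h s = 0"
proof -
  \<comment> \<open>where \<open>h\<close> vanishes, \<open>p\<close> is \<open>0\<close>\<close>
  define p where "p s = norm (h s) *\<^sub>R inverse (h s)" for s
  have "p \<in> borel_measurable unit_interval" unfolding p_def using h(1) by measurable
  moreover have "norm (p s) \<le> 1" for s by (cases "h s = 0") (auto simp: p_def norm_inverse)
  ultimately have p: "integrable unit_interval p"
    by (intro integrable_bounded_unit_interval[of _ 1]) auto
  have "(\<lambda>n::nat. LINT s|unit_interval. p s * h s) \<longlonglongrightarrow> 0"
    using h prim by (intro weak_limit_zero_of_primitives[where M = M] p) auto
  then have "(LINT s|unit_interval. p s * h s) = 0" by (simp add: LIMSEQ_const_iff)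
  moreover have "p s * h s = of_real (norm (h s))" for s
    by (auto simp: p_def of_real_def)
  moreover have i: "integrable unit_interval h" by (rule integrable_bounded_unit_interval) (rule h)+
  moreover have "(LINT s|unit_interval. of_real (norm (h s))) = (of_real (LINT s|unit_interval. norm (h s)) :: 'k)"
    using i by (intro integral_bounded_linear[OF bounded_linear_of_real]) auto
  ultimately have "(LINT s|unit_interval. norm (h s)) = 0" by simp
  with i show ?thesis by (subst (asm) integral_nonneg_eq_0_iff_AE) auto
qed

section \<open>Test functions and weak derivatives\<close>

text \<open>All derivatives exist; this is the first clause in the definition of test functions.\<close>

definition smooth :: "(real \<Rightarrow> real) \<Rightarrow> bool"
  where "smooth f \<longleftrightarrow> (\<forall>n x. (deriv ^^ n) f field_differentiable at x)"

lemma smooth_of_closed_class: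
  assumes C: "\<And>f. C f \<Longrightarrow> \<exists>f'. C f' \<and> (\<forall>x. (f has_field_derivative f' x) (at x))" and f: "C f"
  shows "smooth f"
proof -
  have "C ((deriv ^^ n) f)" for n
  proof (induction n)
    case (Suc n)
    then obtain f' where f': "C f'" "\<And>x. ((deriv ^^ n) f has_field_derivative f' x) (at x)"
      using C by blast
    then have "deriv ((deriv ^^ n) f) = f'" by (intro ext DERIV_imp_deriv)
    with f'(1) show ?case by simp
  qed (simp add: f)
  then show ?thesis
    unfolding smooth_def field_differentiable_def using C by blast
qed

lemma smooth_differentiable: "smooth f \<Longrightarrow> f field_differentiable at x"
  unfolding smooth_def by (metis funpow_0)

lemma smooth_imp_continuous_on: "smooth f \<Longrightarrow> continuous_on A f"
  by (intro continuous_at_imp_continuous_on ballI field_differentiable_imp_continuous_at smooth_differentiable)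

lemma smooth_linear_combination:
  assumes "smooth f" "smooth g"
  shows "smooth (\<lambda>x. u * f x + v * g x)"
proof (rule smooth_of_closed_class[where C = "\<lambda>k. \<exists>n u v. k = (\<lambda>x. u * (deriv ^^ n) f x + v * (deriv ^^ n) g x)"])
  show "\<exists>n u' v'. (\<lambda>x. u * f x + v * g x) = (\<lambda>x. u' * (deriv ^^ n) f x + v' * (deriv ^^ n) g x)"
    by (intro exI[of _ 0] exI[of _ u] exI[of _ v]) simp
  fix k assume "\<exists>n u v. k = (\<lambda>x. u * (deriv ^^ n) f x + v * (deriv ^^ n) g x)"
  then obtain n u v where k: "k = (\<lambda>x. u * (deriv ^^ n) f x + v * (deriv ^^ n) g x)" by blast
  have "((deriv ^^ n) f has_field_derivative (deriv ^^ Suc n) f x) (at x)"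
    "((deriv ^^ n) g has_field_derivative (deriv ^^ Suc n) g x) (at x)" for x
    using assms by (auto simp: smooth_def DERIV_deriv_iff_field_differentiable)
  then have "\<forall>x. (k has_field_derivative u * (deriv ^^ Suc n) f x + v * (deriv ^^ Suc n) g x) (at x)"
    unfolding k by (auto intro!: derivative_eq_intros)
  then show "\<exists>k'. (\<exists>n u v. k' = (\<lambda>x. u * (deriv ^^ n) f x + v * (deriv ^^ n) g x)) \<and>
      (\<forall>x. (k has_field_derivative k' x) (at x))"
    by blast
qed

lemma smooth_antiderivative:
  assumes "smooth f" "\<And>x. (F has_field_derivative f x) (at x)"
  shows "smooth F"
  unfolding smooth_def
proof (intro allI)
  fix n x
  have "deriv F = f" using assms(2) by (intro ext DERIV_imp_deriv)
  then show "(deriv ^^ n) F field_differentiable at x"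
    using assms unfolding smooth_def
    by (cases n) (auto simp: funpow_Suc_right field_differentiable_def simp del: funpow.simps)
qed

text \<open>
  The functions \<open>x\<^sup>-\<^sup>k exp(-1/x)\<close> for \<open>x > 0\<close>, extended by \<open>0\<close>. They are flat at \<open>0\<close>, and their
  span is closed under differentiation.
\<close>

definition flat :: "nat \<Rightarrow> real \<Rightarrow> real"
  where "flat k x = (if x \<le> 0 then 0 else inverse x ^ k * exp (- inverse x))"

lemma flat_has_derivative:
  "(flat k has_field_derivative flat (k + 2) x - real k * flat (k + 1) x) (at x)"
proof (cases x "0::real" rule: linorder_cases)
  case less
  have "((\<lambda>_. 0) has_field_derivative 0) (at x)" by simp
  then have "(flat k has_field_derivative 0) (at x)"
    by (rule has_field_derivative_transform_within_open[of _ _ _ "{..<0}"]) (use less in \<open>auto simp: flat_def\<close>)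
  then show ?thesis using less by (simp add: flat_def)
next
  case greater
  have "((\<lambda>x. inverse x ^ k * exp (- inverse x)) has_field_derivative
      (real k * inverse x ^ (k - 1) * (- (inverse x ^ 2))) * exp (- inverse x)
        + inverse x ^ k * (exp (- inverse x) * (inverse x ^ 2))) (at x)"
    using greater by (auto intro!: derivative_eq_intros simp: power2_eq_square)
  also have "(real k * inverse x ^ (k - 1) * (- (inverse x ^ 2))) * exp (- inverse x)
        + inverse x ^ k * (exp (- inverse x) * (inverse x ^ 2)) = flat (k + 2) x - real k * flat (k + 1) x"
    using greater by (cases k) (auto simp: flat_def power_add power2_eq_square algebra_simps)
  finally show ?thesis
    by (rule has_field_derivative_transform_within_open[of _ _ _ "{0<..}"])
      (use greater in \<open>auto simp: flat_def\<close>)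
next
  case equal
  have "((\<lambda>x. flat (Suc k) x) \<longlongrightarrow> 0) (at_right 0)"
  proof -
    have "((\<lambda>x. inverse x ^ Suc k / exp (inverse x)) \<longlongrightarrow> 0) (at_right (0::real))"
      by (rule filterlim_compose[OF tendsto_power_div_exp_0 filterlim_inverse_at_top_right])
    then show ?thesis
      by (rule Lim_transform_eventually)
        (auto simp: flat_def exp_minus field_simps eventually_at_right_less intro!: eventually_at_rightI[of 0 1])
  qed
  moreover have "((\<lambda>x. flat (Suc k) x) \<longlongrightarrow> 0) (at_left 0)"
    by (rule tendsto_eventually) (auto simp: flat_def intro!: eventually_at_leftI[of "-1"])
  ultimately have "((\<lambda>x. flat (Suc k) x) \<longlongrightarrow> 0) (at 0)"
    by (simp add: filterlim_split_at)
  moreover have "flat (Suc k) h = (flat k (0 + h) - flat k 0) / h" for h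
    by (auto simp: flat_def field_simps)
  ultimately have "(flat k has_field_derivative 0) (at 0)"
    unfolding DERIV_def by simp
  then show ?thesis using equal by (simp add: flat_def)
qed

text \<open>For \<open>n > 0\<close>, bump functions that vanish outside \<open>(a,b)\<close>; as \<open>n\<close> grows they tend to the indicator of \<open>(a,b)\<close>.\<close>

definition bump :: "real \<Rightarrow> real \<Rightarrow> real \<Rightarrow> real \<Rightarrow> real"
  where "bump n a b x = flat 0 (n * (x - a)) * flat 0 (n * (b - x))"

lemma smooth_bump: "smooth (bump n a b)"
proof (rule smooth_of_closed_class)
  let ?B = "\<lambda>(r, k, m) x. r * (flat k (n * (x - a)) * flat m (n * (b - x)))"
  let ?C = "\<lambda>f. \<exists>L. f = (\<lambda>x. \<Sum>l\<leftarrow>L. ?B l x)"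
  have 1: "\<exists>L. \<forall>x. ((\<lambda>x. ?B l x) has_field_derivative (\<Sum>l\<leftarrow>L. ?B l x)) (at x)" for l
  proof -
    obtain r k m where l: "l = (r, k, m)" by (cases l)
    let ?L = "[(r * n, k + 2, m), (- (r * n * real k), k + 1, m), (- (r * n), k, m + 2), (r * n * real m, k, m + 1)]"
    have "(?B l has_field_derivative (\<Sum>l\<leftarrow>?L. ?B l x)) (at x)" for x
      unfolding l
      by (auto intro!: derivative_eq_intros DERIV_chain2[OF flat_has_derivative] simp: algebra_simps)
    then show ?thesis by blast
  qed
  have 2: "\<exists>f'. ?C f' \<and> (\<forall>x. ((\<lambda>x. \<Sum>l\<leftarrow>L. ?B l x) has_field_derivative f' x) (at x))" for L
  proof (induction L)
    case Nil
    show ?case by (intro exI[of _ "\<lambda>x. \<Sum>l\<leftarrow>[]. ?B l x"] conjI exI[of _ "[]"]) auto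
  next
    case (Cons l L)
    then obtain L' where "\<forall>x. ((\<lambda>x. \<Sum>l\<leftarrow>L. ?B l x) has_field_derivative (\<Sum>l\<leftarrow>L'. ?B l x)) (at x)"
      by blast
    moreover obtain L1 where "\<forall>x. ((\<lambda>x. ?B l x) has_field_derivative (\<Sum>l\<leftarrow>L1. ?B l x)) (at x)"
      using 1[of l] by blast
    ultimately have "\<forall>x. ((\<lambda>x. \<Sum>l\<leftarrow>l # L. ?B l x) has_field_derivative (\<Sum>l\<leftarrow>L1 @ L'. ?B l x)) (at x)"
      by (auto intro!: DERIV_add simp del: split_paired_All)
    then show ?case by blast
  qed
  show "\<exists>f'. ?C f' \<and> (\<forall>x. (f has_field_derivative f' x) (at x))" if "?C f" for f
    using that 2 by blast
  show "?C (bump n a b)"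
    by (intro exI[of _ "[(1, 0, 0)]"]) (simp add: bump_def fun_eq_iff)
qed

lemma bump_outside: "0 < n \<Longrightarrow> x \<notin> {a<..<b} \<Longrightarrow> bump n a b x = 0"
  by (auto simp: bump_def flat_def mult_le_0_iff not_less)

lemma bump_bounds: "0 \<le> bump n a b x" "bump n a b x \<le> 1"
proof -
  have "0 \<le> flat 0 y \<and> flat 0 y \<le> 1" for y by (simp add: flat_def)
  then show "0 \<le> bump n a b x" "bump n a b x \<le> 1"
    unfolding bump_def by (auto intro!: mult_le_one)
qed

text \<open>
  Shrinking the interval keeps the supports compact in \<open>(0,x)\<close>, and the limit is still the
  indicator of \<open>(0,x)\<close>.
\<close>

lemma bump_limit:
  "(\<lambda>n. bump (real n + 1) (1 / (real n + 1)) (x - 1 / (real n + 1)) s) \<longlonglongrightarrow> indicator {0<..<x} s"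
proof (cases "s \<in> {0<..<x}")
  case False
  have "bump (real n + 1) (1 / (real n + 1)) (x - 1 / (real n + 1)) s = 0" for n
  proof (rule bump_outside)
    have "0 < 1 / (real n + 1)" by simp
    then show "s \<notin> {1 / (real n + 1)<..<x - 1 / (real n + 1)}"
      using False by (metis greaterThanLessThan_iff diff_add_cancel less_add_same_cancel1 order_less_trans)
  qed simp
  then show ?thesis using False by simp
next
  case True
  have flat_lim: "(\<lambda>n. flat 0 ((real n + 1) * d - 1)) \<longlonglongrightarrow> 1" if "0 < d" for d
  proof -
    have top: "filterlim (\<lambda>n. (real n + 1) * d - 1) at_top sequentially"
    proof -
      have "filterlim (\<lambda>n. real n + 1) at_top sequentially"
        by (rule filterlim_at_top_mono[OF filterlim_real_sequentially]) auto
      then have "filterlim (\<lambda>n. (real n + 1) * d) at_top sequentially"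
        using that by (intro filterlim_at_top_mult_tendsto_pos[OF tendsto_const, of d])
      then have "filterlim (\<lambda>n. - 1 + (real n + 1) * d) at_top sequentially"
        by (intro filterlim_tendsto_add_at_top[OF tendsto_const])
      then show ?thesis by simp
    qed
    have "(\<lambda>n. exp (- inverse ((real n + 1) * d - 1))) \<longlonglongrightarrow> exp (- 0)"
      by (intro tendsto_intros tendsto_inverse_0_at_top top)
    moreover have "\<forall>\<^sub>F n in sequentially. exp (- inverse ((real n + 1) * d - 1)) = flat 0 ((real n + 1) * d - 1)"
      using filterlim_at_top_dense[THEN iffD1, OF top, rule_format, of 0]
      by eventually_elim (simp add: flat_def)
    ultimately show ?thesis by (auto elim: Lim_transform_eventually)
  qed
  have e: "bump (real n + 1) (1 / (real n + 1)) (x - 1 / (real n + 1)) s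
      = flat 0 ((real n + 1) * s - 1) * flat 0 ((real n + 1) * (x - s) - 1)" for n
  proof -
    have "(real n + 1) * (s - 1 / (real n + 1)) = (real n + 1) * s - 1"
      "(real n + 1) * (x - 1 / (real n + 1) - s) = (real n + 1) * (x - s) - 1"
      by (simp_all add: field_simps)
    then show ?thesis by (simp only: bump_def)
  qed
  have "(\<lambda>n. flat 0 ((real n + 1) * s - 1) * flat 0 ((real n + 1) * (x - s) - 1)) \<longlonglongrightarrow> 1 * 1"
    using True by (intro tendsto_mult flat_lim) auto
  then show ?thesis using True by (simp add: e)
qed


lemma set_LINT_unit_interval:
  fixes f :: "real \<Rightarrow> 'b::{banach, second_countable_topology}"
  assumes "set_borel_measurable borel {0..1} f"
  shows "(LINT s|unit_interval. f s) = (LBINT s:{0..1}. f s)"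
proof -
  have "(LINT s|unit_interval. f s) = (LINT s|unit_interval. indicator {0..1} s *\<^sub>R f s)"
    by (intro Bochner_Integration.integral_cong) auto
  also have "\<dots> = (LBINT s:{0..1}. indicator {0..1} s *\<^sub>R f s)"
    using assms unfolding set_borel_measurable_def by (rule LINT_unit_interval)
  also have "\<dots> = (LBINT s:{0..1}. f s)"
    unfolding set_lebesgue_integral_def by (intro Bochner_Integration.integral_cong) (auto simp: indicator_def)
  finally show ?thesis .
qed

lemma set_LINT_unit_interval_prefix:
  fixes f :: "real \<Rightarrow> 'b::{banach, second_countable_topology}"
  assumes "set_borel_measurable borel {0..1} f" "x \<in> {0..1}"
  shows "(LINT s|unit_interval. indicator {0..x} s *\<^sub>R f s) = (LBINT s:{0..x}. f s)"
proof -
  have "(LINT s|unit_interval. indicator {0..x} s *\<^sub>R f s) = (LBINT s:{0..1}. indicator {0..x} s *\<^sub>R f s)"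
  proof (rule set_LINT_unit_interval)
    have "set_borel_measurable borel {0..x} f"
      using set_borel_measurable_subinterval[OF assms(1), of 0 x] assms(2) by auto
    moreover have "(\<lambda>s. indicat_real {0..1} s *\<^sub>R indicat_real {0..x} s *\<^sub>R f s) = (\<lambda>s. indicat_real {0..x} s *\<^sub>R f s)"
      using assms(2) by (auto simp: indicator_def)
    ultimately show "set_borel_measurable borel {0..1} (\<lambda>s. indicator {0..x} s *\<^sub>R f s)"
      by (simp add: set_borel_measurable_def)
  qed
  also have "\<dots> = (LBINT s:{0..x}. f s)"
    unfolding set_lebesgue_integral_def
    by (intro Bochner_Integration.integral_cong) (use assms(2) in \<open>auto simp: indicator_def\<close>)
  finally show ?thesis .
qed

lemma primitive_on_of_derivative:
  fixes F f :: "real \<Rightarrow> real"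
  assumes "\<And>x. (F has_field_derivative f x) (at x)" "continuous_on UNIV f"
  shows "primitive_on T F f"
  unfolding primitive_on_def
proof (intro conjI ballI)
  have c: "continuous_on {a..b} f" for a b using assms(2) by (rule continuous_on_subset) simp
  then show "set_borel_measurable borel {0..T} f" by (rule set_borel_measurable_continuous)
  have "bounded (f ` {0..T})" using c by (intro compact_imp_bounded compact_continuous_image) auto
  then show "\<exists>M. \<forall>s\<in>{0..T}. norm (f s) \<le> M" by (auto simp: bounded_iff)
  fix x assume "x \<in> {0..T}"
  then have "(LINT s|lborel. indicator {0..x} s *\<^sub>R f s) = F x - F 0"
    using assms(1) c
    by (intro integral_FTC_Icc) (auto simp: has_real_derivative_iff_has_vector_derivative intro: has_vector_derivative_at_within)
  then show "F x = F 0 + (LBINT s:{0..x}. f s)" by (simp add: set_lebesgue_integral_def)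
qed

lemma test_function_iff:
  "test_function \<phi> \<longleftrightarrow> smooth \<phi> \<and> (\<exists>K. compact K \<and> K \<subseteq> {0<..<1} \<and> (\<forall>x. x \<notin> K \<longrightarrow> \<phi> x = 0))"
  by (simp add: test_function_def smooth_def)

lemma smooth_imp_primitive_on:
  assumes "smooth \<phi>"
  shows "primitive_on T \<phi> (deriv \<phi>)"
proof (rule primitive_on_of_derivative)
  show "(\<phi> has_field_derivative deriv \<phi> x) (at x)" for x
    using smooth_differentiable[OF assms] by (simp add: DERIV_deriv_iff_field_differentiable)
  have "smooth (deriv \<phi>)"
    using assms unfolding smooth_def by (metis funpow_Suc_right comp_apply)
  then show "continuous_on UNIV (deriv \<phi>)" by (rule smooth_imp_continuous_on)
qed

lemma primitive_on_imp_weak_derivative: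
  fixes F f :: "real \<Rightarrow> 'b::{banach, second_countable_topology}"
  assumes F: "primitive_on 1 F f"
  shows "is_weak_derivative F f"
  unfolding is_weak_derivative_def
proof (intro allI impI)
  fix \<phi> assume \<phi>: "test_function \<phi>"
  obtain K where K: "K \<subseteq> {0<..<1}" "\<And>x. x \<notin> K \<Longrightarrow> \<phi> x = 0" and s: "smooth \<phi>"
    using \<phi> unfolding test_function_iff by blast
  have z: "\<phi> 0 = 0" "\<phi> 1 = 0" using K by (auto intro!: K(2))
  have p\<phi>: "primitive_on 1 \<phi> (deriv \<phi>)" by (rule smooth_imp_primitive_on[OF s])
  have m: "set_borel_measurable borel {0..1} (\<lambda>s. deriv \<phi> s *\<^sub>R F s)"
    "set_borel_measurable borel {0..1} (\<lambda>s. \<phi> s *\<^sub>R f s)"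
    by (rule set_borel_measurable_bilinear[OF bounded_bilinear_scaleR primitive_onD(1)[OF p\<phi>]
            set_borel_measurable_continuous[OF primitive_on_continuous[OF F]]],
        rule set_borel_measurable_bilinear[OF bounded_bilinear_scaleR
            set_borel_measurable_continuous[OF primitive_on_continuous[OF p\<phi>]] primitive_onD(1)[OF F]])
  obtain L where L: "0 \<le> L" "\<And>s. s \<in> {0..1} \<Longrightarrow> norm (deriv \<phi> s) \<le> L"
    "\<And>x y. x \<in> {0..1} \<Longrightarrow> y \<in> {0..1} \<Longrightarrow> norm (\<phi> x - \<phi> y) \<le> L * \<bar>x - y\<bar>"
    using primitive_on_lipschitz[OF p\<phi>] by blast
  obtain N where N: "0 \<le> N" "\<And>s. s \<in> {0..1} \<Longrightarrow> norm (f s) \<le> N"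
    "\<And>x y. x \<in> {0..1} \<Longrightarrow> y \<in> {0..1} \<Longrightarrow> norm (F x - F y) \<le> N * \<bar>x - y\<bar>"
    using primitive_on_lipschitz[OF F] by blast
  have bF: "norm (F s) \<le> norm (F 0) + N" if "s \<in> {0..1}" for s
  proof -
    have "norm (F s) \<le> norm (F 0) + norm (F s - F 0)" using norm_triangle_ineq[of "F 0" "F s - F 0"] by simp
    moreover have "norm (F s - F 0) \<le> N * \<bar>s - 0\<bar>" using that by (intro N) auto
    moreover have "N * \<bar>s - 0\<bar> \<le> N" using that N(1) by (auto intro: mult_left_le)
    ultimately show ?thesis by simp
  qed
  have b\<phi>: "norm (\<phi> s) \<le> L" if "s \<in> {0..1}" for s
    using L(3)[OF that, of 0] that L(1) z mult_left_le[of s L] by auto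
  have i1: "set_integrable lborel {0..1} (\<lambda>s. deriv \<phi> s *\<^sub>R F s)"
    using L N bF by (intro set_integrable_bounded[OF m(1), of "L * (norm (F 0) + N)"]) (auto intro!: mult_mono)
  have i2: "set_integrable lborel {0..1} (\<lambda>s. \<phi> s *\<^sub>R f s)"
    using L N b\<phi> by (intro set_integrable_bounded[OF m(2), of "L * N"]) (auto intro!: mult_mono)
  have "primitive_on 1 (\<lambda>x. \<phi> x *\<^sub>R F x) (\<lambda>x. deriv \<phi> x *\<^sub>R F x + \<phi> x *\<^sub>R f x)"
    by (rule primitive_on_bilinear[OF bounded_bilinear_scaleR p\<phi> F])
  from primitive_onD(2)[OF this, of 1] have "0 = (LBINT s:{0..1}. deriv \<phi> s *\<^sub>R F s + \<phi> s *\<^sub>R f s)"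
    by (simp add: z)
  also have "\<dots> = (LBINT s:{0..1}. deriv \<phi> s *\<^sub>R F s) + (LBINT s:{0..1}. \<phi> s *\<^sub>R f s)"
    using i1 i2 by (rule set_integral_add(2))
  finally show "(LINT s|unit_interval. deriv \<phi> s *\<^sub>R F s) = - (LINT s|unit_interval. \<phi> s *\<^sub>R f s)"
    using m by (simp add: set_LINT_unit_interval eq_neg_iff_add_eq_0)
qed

text \<open>
  A smooth function with compact support in \<open>(0,1)\<close> and integral \<open>0\<close> is the derivative of a test
  function.
\<close>

lemma test_function_antiderivative:
  assumes s: "smooth \<theta>" and a: "0 < a" and b: "b < 1" and z: "\<And>x. x \<notin> {a..b} \<Longrightarrow> \<theta> x = 0"
    and i: "(LBINT s:{0..1}. \<theta> s) = 0"
  obtains \<phi> where "test_function \<phi>" "deriv \<phi> = \<theta>"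
proof -
  have c: "isCont \<theta> x" for x
    using smooth_differentiable[OF s] by (rule field_differentiable_imp_continuous_at)
  then obtain F where F: "\<And>x. (F has_field_derivative \<theta> x) (at x)"
    using einterval_antiderivative[of "-\<infinity>" "\<infinity>" \<theta>]
    by (auto simp: has_real_derivative_iff_has_vector_derivative)
  define \<phi> where "\<phi> x = F x - F 0" for x
  have d: "(\<phi> has_field_derivative \<theta> x) (at x)" for x
    unfolding \<phi>_def using DERIV_diff[OF F DERIV_const[of "F 0"]] by simp
  have sm: "smooth \<phi>" using s d by (rule smooth_antiderivative)
  have left: "\<phi> x = 0" if "x < a" for x
  proof -
    have "\<exists>k. \<forall>y\<in>{..<a}. \<phi> y = k"
      using has_field_derivative_zero_constant[of "{..<a}" \<phi>] z d
      by (metis atLeastAtMost_iff convex_real_interval(4) has_field_derivative_at_within lessThan_iff not_less)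
    then have "\<phi> x = \<phi> 0" using that a by auto
    then show ?thesis by (simp add: \<phi>_def)
  qed
  have "primitive_on 1 \<phi> \<theta>"
    using d c by (intro primitive_on_of_derivative) (auto intro: continuous_at_imp_continuous_on)
  from primitive_onD(2)[OF this, of 1] have "\<phi> 1 = 0" using i by (simp add: \<phi>_def)
  have right: "\<phi> x = 0" if "b < x" for x
  proof -
    have "\<exists>k. \<forall>y\<in>{b<..}. \<phi> y = k"
      using has_field_derivative_zero_constant[of "{b<..}" \<phi>] z d
      by (metis atLeastAtMost_iff convex_real_interval(3) has_field_derivative_at_within greaterThan_iff not_less)
    then have "\<phi> x = \<phi> 1" using that b by auto
    then show ?thesis by (simp add: \<open>\<phi> 1 = 0\<close>)
  qed
  have "test_function \<phi>"
    unfolding test_function_iff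
    using sm left right a b by (intro conjI exI[of _ "{a..b}"]) (auto simp: not_le)
  moreover have "deriv \<phi> = \<theta>" using d by (intro ext DERIV_imp_deriv)
  ultimately show ?thesis by (rule that)
qed

lemma bump_integral:
  "(\<lambda>n. LBINT s:{0..1}. bump (real n + 1) (1 / (real n + 1)) (x - 1 / (real n + 1)) s) \<longlonglongrightarrow>
    (LBINT s:{0..1}. indicat_real {0<..<x} s)"
  unfolding set_lebesgue_integral_def
proof (rule integral_dominated_convergence[where w = "indicator {0..1}"])
  have "continuous_on UNIV (bump n a b)" for n a b
    by (intro smooth_imp_continuous_on smooth_bump)
  then have [measurable]: "bump n a b \<in> borel_measurable borel" for n a b
    by (rule borel_measurable_continuous_onI)
  show "(\<lambda>s. indicat_real {0..1} s *\<^sub>R bump (real n + 1) (1 / (real n + 1)) (x - 1 / (real n + 1)) s)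
      \<in> borel_measurable lborel" for n
    by measurable
  show "AE s in lborel. (\<lambda>n. indicat_real {0..1} s *\<^sub>R bump (real n + 1) (1 / (real n + 1)) (x - 1 / (real n + 1)) s)
      \<longlonglongrightarrow> indicat_real {0..1} s *\<^sub>R indicat_real {0<..<x} s"
    by (intro AE_I2 tendsto_intros bump_limit)
  show "AE s in lborel. norm (indicat_real {0..1} s *\<^sub>R bump (real n + 1) (1 / (real n + 1)) (x - 1 / (real n + 1)) s)
      \<le> indicat_real {0..1} s" for n
    using bump_bounds by (intro AE_I2) (simp add: indicator_def)
qed (auto simp: emeasure_lborel_Icc_eq)

section \<open>Weak derivatives and primitives\<close>

lemma smooth_integrable_scaleR:
  fixes k :: "real \<Rightarrow> 'b::{banach, second_countable_topology}"
  assumes "smooth \<phi>" "k \<in> borel_measurable unit_interval" "AE s in unit_interval. norm (k s) \<le> N"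
  shows "integrable unit_interval (\<lambda>s. \<phi> s *\<^sub>R k s)"
proof -
  have c: "continuous_on UNIV \<phi>"
    using assms(1) by (rule smooth_imp_continuous_on)
  then have "compact (\<phi> ` {0..1})"
    by (intro compact_continuous_image) (auto intro: continuous_on_subset)
  then obtain L where L: "\<And>s. s \<in> {0..1} \<Longrightarrow> norm (\<phi> s) \<le> L"
    using compact_imp_bounded bounded_iff by (metis imageI)
  have "0 \<le> L" using L[of 0] by (auto intro: order_trans[OF norm_ge_zero])
  have "AE s in unit_interval. norm (\<phi> s) \<le> L" using L by (intro AE_I2) auto
  then have "AE s in unit_interval. norm (\<phi> s *\<^sub>R k s) \<le> L * N"
    using assms(3) by eventually_elim (use \<open>0 \<le> L\<close> in \<open>auto intro!: mult_mono\<close>)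
  moreover have "(\<lambda>s. \<phi> s *\<^sub>R k s) \<in> borel_measurable unit_interval"
    using borel_measurable_unit_interval[OF borel_measurable_continuous_onI[OF c]] assms(2)
    by (rule borel_measurable_scaleR)
  ultimately show ?thesis by (intro integrable_bounded_unit_interval)
qed

text \<open>
  The converse of the integration by parts. The difference \<open>h\<close> of \<open>f\<close> and a primitive of \<open>g\<close> is
  orthogonal to all derivatives of test functions. Comparing bumps \<open>\<psi>\<close> with one fixed bump, their
  integrals against \<open>h\<close> equal those against a constant \<open>z\<close>; letting the bumps tend to indicators of
  intervals gives \<open>h = z\<close>.
\<close>

lemma weak_derivative_imp_primitive:
  fixes f g :: "real \<Rightarrow> 'k::{real_normed_field, banach, second_countable_topology}"
  assumes [measurable]: "f \<in> borel_measurable borel" "g \<in> borel_measurable borel"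
    and bound: "\<And>s. norm (f s) \<le> M" "\<And>s. norm (g s) \<le> M"
    and wd: "is_weak_derivative f g"
  shows "\<exists>z. AE s in unit_interval. f s = z + (LBINT r:{0..s}. g r)"
proof -
  define G where "G x = (LBINT r:{0..x}. g r)" for x
  have pG: "primitive_on 1 G g"
    using primitive_on_integral[of g 1 M 0] bound by (simp add: G_def[abs_def])
  define h where "h s = f s - indicator {0..1} s *\<^sub>R G s" for s
  have mG: "(\<lambda>s. indicator {0..1} s *\<^sub>R G s) \<in> borel_measurable borel"
    using set_borel_measurable_continuous[OF primitive_on_continuous[OF pG]]
    by (simp add: set_borel_measurable_def)
  then have mh: "h \<in> borel_measurable borel" unfolding h_def by measurable
  have M0: "0 \<le> M" using bound(1)[of 0] norm_ge_zero order_trans by blast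
  have bG: "norm (G s) \<le> M" if "s \<in> {0..1}" for s
  proof -
    have "norm (G s - G 0) \<le> M * \<bar>s - 0\<bar>"
      using that bound by (intro primitive_on_lipschitz_bound[OF pG]) auto
    also have "\<dots> \<le> M" using that M0 by (auto intro: mult_left_le)
    finally show ?thesis by (simp add: G_def)
  qed
  have bh: "norm (h s) \<le> M + M" for s
    using norm_triangle_ineq4[of "f s" "indicator {0..1} s *\<^sub>R G s"] bound(1)[of s] bG[of s] M0
    by (cases "s \<in> {0..1}") (auto simp: h_def)
  have integrable_test: "integrable unit_interval (\<lambda>s. \<phi> s *\<^sub>R k s)"
    if "continuous_on UNIV \<phi>" "k \<in> borel_measurable borel" "\<And>s. s \<in> {0..1} \<Longrightarrow> norm (k s) \<le> N"
    for \<phi> :: "real \<Rightarrow> real" and k :: "real \<Rightarrow> 'k" and N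
  proof -
    have "compact (\<phi> ` {0..1})"
      using that(1) by (intro compact_continuous_image) (auto intro: continuous_on_subset)
    then obtain L where L: "\<And>s. s \<in> {0..1} \<Longrightarrow> norm (\<phi> s) \<le> L"
      using compact_imp_bounded bounded_iff by (metis imageI)
    have "0 \<le> L" using L[of 0] by (auto intro: order_trans[OF norm_ge_zero])
    show ?thesis
    proof (rule integrable_bounded_unit_interval)
      show "(\<lambda>s. \<phi> s *\<^sub>R k s) \<in> borel_measurable unit_interval"
        using that borel_measurable_continuous_onI[OF that(1)] by (intro borel_measurable_unit_interval) simp
      show "AE s in unit_interval. norm (\<phi> s *\<^sub>R k s) \<le> L * N"
        using L that(3) \<open>0 \<le> L\<close> by (intro AE_I2) (auto intro!: mult_mono)
    qed
  qed
  note cont_smooth = smooth_imp_continuous_on[where A = UNIV]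
  have test: "(LINT s|unit_interval. \<theta> s *\<^sub>R h s) = 0" if \<phi>: "test_function \<phi>" and \<theta>: "deriv \<phi> = \<theta>" "smooth \<theta>" for \<phi> \<theta>
  proof -
    have "(LINT s|unit_interval. \<theta> s *\<^sub>R G s) = - (LINT s|unit_interval. \<phi> s *\<^sub>R g s)"
      using primitive_on_imp_weak_derivative[OF pG] \<phi> \<theta> by (auto simp: is_weak_derivative_def)
    moreover have "(LINT s|unit_interval. \<theta> s *\<^sub>R f s) = - (LINT s|unit_interval. \<phi> s *\<^sub>R g s)"
      using wd \<phi> \<theta> by (auto simp: is_weak_derivative_def)
    moreover have "(LINT s|unit_interval. \<theta> s *\<^sub>R h s)
        = (LINT s|unit_interval. \<theta> s *\<^sub>R f s) - (LINT s|unit_interval. \<theta> s *\<^sub>R (indicator {0..1} s *\<^sub>R G s))"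
      using integrable_test[OF cont_smooth[OF \<theta>(2)], of f M] bound
        integrable_test[OF cont_smooth[OF \<theta>(2)] mG, of M] bG
      by (simp add: h_def scaleR_diff_right)
    moreover have "(LINT s|unit_interval. \<theta> s *\<^sub>R (indicator {0..1} s *\<^sub>R G s)) = (LINT s|unit_interval. \<theta> s *\<^sub>R G s)"
      by (intro Bochner_Integration.integral_cong) auto
    ultimately show ?thesis by simp
  qed
  define \<psi> where "\<psi> x n = bump (real n + 1) (1 / (real n + 1)) (x - 1 / (real n + 1))" for x n
  have sm\<psi>: "smooth (\<psi> x n)" for x n unfolding \<psi>_def by (rule smooth_bump)
  define I where "I \<theta> = (LBINT s:{0..1}. \<theta> s)" for \<theta> :: "real \<Rightarrow> real"
  define H where "H \<theta> = (LINT s|unit_interval. \<theta> s *\<^sub>R h s)" for \<theta> :: "real \<Rightarrow> real"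
  have "(\<lambda>n. I (\<psi> 1 n)) \<longlonglongrightarrow> (LBINT s:{0..1}. indicat_real {0<..<1::real} s)"
    using bump_integral[of 1] by (simp add: I_def \<psi>_def)
  also have "(LBINT s:{0..1}. indicat_real {0<..<1::real} s) = (LINT s|lborel. indicat_real {0<..<1::real} s)"
    unfolding set_lebesgue_integral_def by (intro Bochner_Integration.integral_cong) (auto simp: indicator_def)
  also have "\<dots> = 1" by simp
  finally have "\<forall>\<^sub>F n in sequentially. 0 < I (\<psi> 1 n)" by (rule order_tendstoD) simp
  then obtain m where m: "0 < I (\<psi> 1 m)" by (auto simp: eventually_sequentially)
  define z where "z = (1 / I (\<psi> 1 m)) *\<^sub>R H (\<psi> 1 m)"
  have key: "H (\<psi> x n) = I (\<psi> x n) *\<^sub>R z" if "x \<in> {0..1}" for x n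
  proof -
    \<comment> \<open>this combination of two bumps has integral \<open>0\<close>, so it is the derivative of a test function\<close>
    let ?\<theta> = "\<lambda>s. 1 * \<psi> x n s + (- (I (\<psi> x n) / I (\<psi> 1 m))) * \<psi> 1 m s"
    let ?a = "min (1 / (real n + 1)) (1 / (real m + 1))"
    have sm: "smooth ?\<theta>" by (intro smooth_linear_combination sm\<psi>)
    have iI: "set_integrable lborel {0..1} (\<psi> x n)" for x n
      using primitive_on_integrable[of 1 "\<lambda>x'. LBINT s:{0..x'}. \<psi> x n s" "\<psi> x n" 0 1]
        primitive_on_integral[of "\<psi> x n" 1 1 0] bump_bounds
        borel_measurable_continuous_onI[OF cont_smooth[OF sm\<psi>]]
      by (auto simp: \<psi>_def)
    have "\<psi> x n s = 0" if "s \<notin> {?a..1 - ?a}" for s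
      unfolding \<psi>_def
    proof (rule bump_outside)
      show "s \<notin> {1 / (real n + 1)<..<x - 1 / (real n + 1)}"
        using that \<open>x \<in> {0..1}\<close> by auto
    qed simp
    moreover have "\<psi> 1 m s = 0" if "s \<notin> {?a..1 - ?a}" for s
      unfolding \<psi>_def
    proof (rule bump_outside)
      show "s \<notin> {1 / (real m + 1)<..<1 - 1 / (real m + 1)}"
        using that by auto
    qed simp
    ultimately have z: "?\<theta> s = 0" if "s \<notin> {?a..1 - ?a}" for s using that by simp
    have "I ?\<theta> = 0"
      using iI[of x n] iI[of 1 m] m by (simp add: I_def set_integral_add set_integral_diff)
    then obtain \<phi> where "test_function \<phi>" "deriv \<phi> = ?\<theta>"
      using test_function_antiderivative[OF sm, of ?a "1 - ?a"] z by (auto simp: I_def)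
    from test[OF this sm] have "H ?\<theta> = 0" by (simp add: H_def)
    moreover have "H ?\<theta> = H (\<psi> x n) - (I (\<psi> x n) / I (\<psi> 1 m)) *\<^sub>R H (\<psi> 1 m)"
    proof -
      define r where "r = I (\<psi> x n) / I (\<psi> 1 m)"
      have "H ?\<theta> = (LINT s|unit_interval. \<psi> x n s *\<^sub>R h s - r *\<^sub>R (\<psi> 1 m s *\<^sub>R h s))"
        unfolding H_def r_def[symmetric] by (simp add: scaleR_diff_left)
      also have "\<dots> = H (\<psi> x n) - r *\<^sub>R H (\<psi> 1 m)"
        using integrable_test[OF cont_smooth[OF sm\<psi>] mh bh, of x n] integrable_test[OF cont_smooth[OF sm\<psi>] mh bh, of 1 m]
        unfolding H_def
        by (subst Bochner_Integration.integral_diff) (auto simp del: scaleR_scaleR)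
      finally show ?thesis by (simp add: r_def)
    qed
    ultimately show ?thesis by (simp add: z_def)
  qed
  have "AE s in unit_interval. h s - z = 0"
  proof (rule AE_zero_of_primitives_zero)
    show "(\<lambda>s. h s - z) \<in> borel_measurable unit_interval"
      by (intro borel_measurable_unit_interval borel_measurable_diff[OF mh borel_measurable_const])
    show "AE s in unit_interval. norm (h s - z) \<le> M + M + norm z"
      using bh by (intro AE_I2) (smt (verit) norm_triangle_ineq4)
    fix x :: real assume x: "x \<in> {0..1}"
    have mo: "(\<lambda>s. indicator {0<..<x} s *\<^sub>R h s) \<in> borel_measurable unit_interval"
      using mh by (intro borel_measurable_unit_interval) measurable
    have "(\<lambda>n. H (\<psi> x n)) \<longlonglongrightarrow> (LINT s|unit_interval. indicator {0<..<x} s *\<^sub>R h s)"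
      unfolding H_def
    proof (rule integral_dominated_convergence[where w = "\<lambda>s. M + M"])
      show "integrable unit_interval (\<lambda>s. M + M)"
        by (rule integrable_bounded_unit_interval[of _ "\<bar>M + M\<bar>"]) auto
      show "(\<lambda>s. \<psi> x n s *\<^sub>R h s) \<in> borel_measurable unit_interval" for n
        using integrable_test[OF cont_smooth[OF sm\<psi>] mh bh] by (rule borel_measurable_integrable)
      show "AE s in unit_interval. (\<lambda>n. \<psi> x n s *\<^sub>R h s) \<longlonglongrightarrow> indicat_real {0<..<x} s *\<^sub>R h s"
        unfolding \<psi>_def by (intro AE_I2 tendsto_intros bump_limit)
      show "AE s in unit_interval. norm (\<psi> x n s *\<^sub>R h s) \<le> M + M" for n
      proof (intro AE_I2)
        fix s
        have "norm (\<psi> x n s *\<^sub>R h s) \<le> 1 * (M + M)"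
          unfolding norm_scaleR using bump_bounds bh by (intro mult_mono) (auto simp: \<psi>_def)
        then show "norm (\<psi> x n s *\<^sub>R h s) \<le> M + M" by simp
      qed
    qed (rule mo)
    moreover have "(\<lambda>n. I (\<psi> x n) *\<^sub>R z) \<longlonglongrightarrow> x *\<^sub>R z"
    proof -
      have "(\<lambda>n. I (\<psi> x n)) \<longlonglongrightarrow> (LBINT s:{0..1}. indicat_real {0<..<x} s)"
        using bump_integral[of x] by (simp add: I_def \<psi>_def)
      also have "(LBINT s:{0..1}. indicat_real {0<..<x} s) = (LINT s|lborel. indicat_real {0<..<x} s)"
        unfolding set_lebesgue_integral_def by (intro Bochner_Integration.integral_cong) (use x in \<open>auto simp: indicator_def\<close>)
      also have "\<dots> = x" using x by simp
      finally show ?thesis by (intro tendsto_intros)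
    qed
    ultimately have eq: "(LINT s|unit_interval. indicator {0<..<x} s *\<^sub>R h s) = x *\<^sub>R z"
      using key[OF x] LIMSEQ_unique by simp
    have ph: "(LINT s|unit_interval. indicator {0..x} s *\<^sub>R h s) = x *\<^sub>R z"
      unfolding eq[symmetric]
    proof (rule integral_cong_AE)
      have "AE s in lborel. s \<noteq> 0" "AE s in lborel. s \<noteq> x" by (rule AE_lborel_singleton)+
      then show "AE s in unit_interval. indicat_real {0..x} s *\<^sub>R h s = indicat_real {0<..<x} s *\<^sub>R h s"
        unfolding AE_unit_interval_iff by eventually_elim (auto simp: indicator_def)
      show "(\<lambda>s. indicat_real {0..x} s *\<^sub>R h s) \<in> borel_measurable unit_interval"
        using mh by (intro borel_measurable_unit_interval) measurable
    qed (rule mo)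
    have pz: "(LINT s|unit_interval. indicator {0..x} s *\<^sub>R z) = x *\<^sub>R z"
    proof -
      have "(LINT s|unit_interval. indicator {0..x} s *\<^sub>R z) = (LBINT s:{0..x}. z)"
        using x by (intro set_LINT_unit_interval_prefix set_borel_measurable_continuous) auto
      also have "\<dots> = x *\<^sub>R z"
        unfolding set_lebesgue_integral_def using x
        by (subst integral_scaleR_left) (auto simp: emeasure_lborel_Icc_eq)
      finally show ?thesis .
    qed
    have int: "integrable unit_interval (\<lambda>s. indicat_real {0..x} s *\<^sub>R k s)"
      if k: "k \<in> borel_measurable borel" "\<And>s. norm (k s) \<le> N" for k :: "real \<Rightarrow> 'k" and N
    proof (rule integrable_bounded_unit_interval)
      show "(\<lambda>s. indicat_real {0..x} s *\<^sub>R k s) \<in> borel_measurable unit_interval"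
        using k(1) by (intro borel_measurable_unit_interval) measurable
      show "AE s in unit_interval. norm (indicat_real {0..x} s *\<^sub>R k s) \<le> N"
        using k(2) order_trans[OF norm_ge_zero k(2)] by (intro AE_I2) (auto simp: indicator_def)
    qed
    show "(LINT s|unit_interval. indicat_real {0..x} s *\<^sub>R (h s - z)) = 0"
      using int[OF mh bh] int[of "\<lambda>_. z" "norm z"] ph pz by (simp add: scaleR_diff_right)
  qed
  then have "AE s in unit_interval. f s = z + (LBINT r:{0..s}. g r)"
    unfolding AE_unit_interval_iff
    by eventually_elim (auto simp: h_def G_def algebra_simps)
  then show ?thesis by blast
qed

lemma continuous_eq_of_AE:
  fixes u v :: "real \<Rightarrow> 'b::real_normed_vector"
  assumes c: "continuous_on {0..1} u" "continuous_on {0..1} v"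
    and AE: "AE s in unit_interval. u s = v s" and x: "x \<in> {0..1}"
  shows "u x = v x"
proof (rule ccontr)
  assume ne: "u x \<noteq> v x"
  have "continuous_on {0..1} (\<lambda>s. u s - v s)" by (intro continuous_intros c)
  then obtain d where d: "0 < d" "\<And>s. s \<in> {0..1} \<Longrightarrow> dist s x < d \<Longrightarrow> dist (u s - v s) (u x - v x) < norm (u x - v x)"
    using x ne unfolding continuous_on_iff by (metis right_minus_eq zero_less_norm_iff)
  define a where "a = max 0 (x - d / 2)"
  define b where "b = min 1 (x + d / 2)"
  have ab: "a < b" "{a..b} \<subseteq> {0..1}" using d(1) x by (auto simp: a_def b_def min_def max_def)
  have ne: "u s \<noteq> v s" if "s \<in> {a..b}" for s
  proof -
    have "dist s x < d" using that d(1) by (auto simp: a_def b_def dist_real_def)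
    with d(2)[of s] that ab(2) show ?thesis by (auto simp: dist_norm norm_minus_commute)
  qed
  have "AE s in lborel. s \<notin> {a..b}"
    using AE unfolding AE_unit_interval_iff by eventually_elim (use ab ne in blast)
  then have "{a..b} \<in> null_sets lborel" by (subst AE_iff_null_sets) auto
  then show False using ab(1) by (simp add: null_sets_def)
qed


lemma bounded_coord_rep:
  fixes f :: "real \<Rightarrow> 'k::{banach, second_countable_topology} ell1"
  assumes "f \<in> bochner_Linf S" "0 \<le> M" "AE s in unit_interval. norm (f s) \<le> M"
  obtains f' where "f' \<in> borel_measurable borel" "AE s in unit_interval. coord (f s) j = f' s"
    "\<And>s. norm (f' s) \<le> M"
proof (rule bounded_borel_rep[of "\<lambda>s. coord (f s) j" M])
  show "strongly_measurable unit_interval (\<lambda>s. coord (f s) j)"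
    by (rule strongly_measurable_compose[OF _ linear_continuous_on[OF bounded_linear_coord]])
      (use assms(1) in \<open>auto simp: bochner_Linf_def\<close>)
  show "AE s in unit_interval. norm (coord (f s) j) \<le> M"
    using assms(3) by eventually_elim (rule order_trans[OF norm_coord_le])
qed (use assms(2) in auto)

lemma smooth_test_function: "test_function \<phi> \<Longrightarrow> smooth \<phi>" "test_function \<phi> \<Longrightarrow> smooth (deriv \<phi>)"
  unfolding test_function_iff unfolding smooth_def by (blast, metis funpow_Suc_right comp_apply)

text \<open>
  The coordinates of the continuous representative of a function in \<open>W\<^sup>1\<^sup>,\<^sup>\<infinity>\<close> are primitives of
  the coordinates of its weak derivative.
\<close>

lemma coord_primitive_of_weak_derivative:
  fixes f d :: "real \<Rightarrow> 'k::{real_normed_field, banach, second_countable_topology} ell1"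
  assumes f: "f \<in> bochner_Linf S" and d: "d \<in> bochner_Linf S'" and wd: "is_weak_derivative f d"
    and rep: "is_continuous_rep f g"
    and d': "d' \<in> borel_measurable borel" "\<And>s. norm (d' s) \<le> N" "AE s in unit_interval. coord (d s) j = d' s"
  shows "primitive_on 1 (\<lambda>x. coord (g x) j) d'"
proof -
  obtain M where M: "0 \<le> M" "AE s in unit_interval. norm (f s) \<le> M" using bochner_Linf_bound[OF f] by blast
  obtain N2 where N2: "0 \<le> N2" "AE s in unit_interval. norm (d s) \<le> N2" using bochner_Linf_bound[OF d] by blast
  obtain f' where f': "f' \<in> borel_measurable borel" "AE s in unit_interval. coord (f s) j = f' s" "\<And>s. norm (f' s) \<le> M"
    using bounded_coord_rep[OF f M] by blast
  have mf: "f \<in> borel_measurable unit_interval" "d \<in> borel_measurable unit_interval"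
    using f d by (auto simp: bochner_Linf_def intro: strongly_measurable_imp_borel_measurable)
  have "is_weak_derivative f' d'"
    unfolding is_weak_derivative_def
  proof (intro allI impI)
    fix \<phi> assume \<phi>: "test_function \<phi>"
    have i1: "integrable unit_interval (\<lambda>s. deriv \<phi> s *\<^sub>R f s)"
      and i2: "integrable unit_interval (\<lambda>s. \<phi> s *\<^sub>R d s)"
      using smooth_test_function[OF \<phi>] mf M(2) N2(2) by (auto intro: smooth_integrable_scaleR)
    have c: "(LINT s|unit_interval. \<phi> s *\<^sub>R k' s) = coord (LINT s|unit_interval. \<phi> s *\<^sub>R k s) j"
      if "integrable unit_interval (\<lambda>s. \<phi> s *\<^sub>R k s)" "AE s in unit_interval. coord (k s) j = k' s"
        "k' \<in> borel_measurable borel" "smooth \<phi>"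
      for \<phi> and k :: "real \<Rightarrow> 'k ell1" and k' :: "real \<Rightarrow> 'k"
    proof -
      have "coord (LINT s|unit_interval. \<phi> s *\<^sub>R k s) j = (LINT s|unit_interval. coord (\<phi> s *\<^sub>R k s) j)"
        using integral_bounded_linear[OF bounded_linear_coord that(1), of j] by simp
      also have "\<dots> = (LINT s|unit_interval. \<phi> s *\<^sub>R k' s)"
      proof (rule integral_cong_AE)
        show "(\<lambda>s. coord (\<phi> s *\<^sub>R k s) j) \<in> borel_measurable unit_interval"
          by (rule borel_measurable_coord[OF borel_measurable_integrable[OF that(1)]])
        have "continuous_on UNIV \<phi>"
          using that(4) by (rule smooth_imp_continuous_on)
        from borel_measurable_continuous_onI[OF this]
        show "(\<lambda>s. \<phi> s *\<^sub>R k' s) \<in> borel_measurable unit_interval"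
          using that(3) by (intro borel_measurable_unit_interval borel_measurable_scaleR)
        show "AE s in unit_interval. coord (\<phi> s *\<^sub>R k s) j = \<phi> s *\<^sub>R k' s"
          using that(2) by eventually_elim simp
      qed
      finally show ?thesis by simp
    qed
    have "(LINT s|unit_interval. deriv \<phi> s *\<^sub>R f s) = - (LINT s|unit_interval. \<phi> s *\<^sub>R d s)"
      using wd \<phi> by (auto simp: is_weak_derivative_def)
    then have "coord (LINT s|unit_interval. deriv \<phi> s *\<^sub>R f s) j = - coord (LINT s|unit_interval. \<phi> s *\<^sub>R d s) j"
      by simp
    then show "(LINT s|unit_interval. deriv \<phi> s *\<^sub>R f' s) = - (LINT s|unit_interval. \<phi> s *\<^sub>R d' s)"
      using c[OF i1 f'(2,1) smooth_test_function(2)[OF \<phi>]] c[OF i2 d'(3,1) smooth_test_function(1)[OF \<phi>]] by simp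
  qed
  then obtain z where z: "AE s in unit_interval. f' s = z + (LBINT r:{0..s}. d' r)"
    using weak_derivative_imp_primitive[OF f'(1) d'(1), of "max M N"] f'(3) d'(2) by (meson le_max_iff_disj)
  have p: "primitive_on 1 (\<lambda>x. z + (LBINT r:{0..x}. d' r)) d'"
    using primitive_on_integral d' by blast
  have cg: "continuous_on {0..1} (\<lambda>x. coord (g x) j)" and "AE s in unit_interval. f s = g s"
    using rep by (auto simp: is_continuous_rep_def intro!: continuous_intros)
  from this(2) f'(2) z have "AE s in unit_interval. coord (g s) j = z + (LBINT r:{0..s}. d' r)"
    by eventually_elim simp
  then have eq: "coord (g x) j = z + (LBINT r:{0..x}. d' r)" if "x \<in> {0..1}" for x
    using continuous_eq_of_AE[OF cg primitive_on_continuous[OF p]] that by blast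
  show ?thesis
    unfolding primitive_on_def
    using primitive_onD(1)[OF p] d'(2) eq[of 0] eq by auto
qed

text \<open>Primitives of functions with values in \<open>\<ell>\<^sup>1\<close> can be recognised by their coordinates.\<close>

lemma primitive_on_of_coord:
  fixes f d :: "real \<Rightarrow> 'k::{real_normed_field, banach, second_countable_topology} ell1"
  assumes d: "d \<in> borel_measurable borel" "\<And>s. s \<in> {0..1} \<Longrightarrow> norm (d s) \<le> M"
    and prim: "\<And>j. primitive_on 1 (\<lambda>x. coord (f x) j) (\<lambda>x. coord (d x) j)"
  shows "primitive_on 1 f d"
proof -
  have m: "set_borel_measurable borel {0..1} d"
    using d(1) by (simp add: set_borel_measurable_def)
  have "f x = f 0 + (LBINT s:{0..x}. d s)" if x: "x \<in> {0..1}" for x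
  proof (rule ell1_eqI)
    fix j
    have i: "integrable lborel (\<lambda>s. indicator {0..x} s *\<^sub>R d s)"
      using set_integrable_bounded[OF set_borel_measurable_subinterval[OF m], of 0 x M] d(2) x
      by (auto simp: set_integrable_def)
    have "coord (LBINT s:{0..x}. d s) j = (LBINT s:{0..x}. coord (d s) j)"
      using integral_bounded_linear[OF bounded_linear_coord i, of j]
      by (simp add: set_lebesgue_integral_def)
    then show "coord (f x) j = coord (f 0 + (LBINT s:{0..x}. d s)) j"
      using primitive_onD(2)[OF prim x, of j] by simp
  qed
  with m d(2) show ?thesis unfolding primitive_on_def by blast
qed

lemma primitive_on_cong:
  assumes "primitive_on T F f" "\<And>x. x \<in> {0..T} \<Longrightarrow> F x = G x" "\<And>x. x \<in> {0..T} \<Longrightarrow> f x = g x"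
  shows "primitive_on T G g"
proof -
  have m: "(\<lambda>x. indicator {0..T} x *\<^sub>R f x) = (\<lambda>x. indicator {0..T} x *\<^sub>R g x)"
    using assms(3) by (intro ext) (auto simp: indicator_def)
  have i: "(LBINT s:{0..x}. f s) = (LBINT s:{0..x}. g s)" if "x \<in> {0..T}" for x
    using that assms(3) by (intro set_lebesgue_integral_cong) auto
  obtain N where N: "\<forall>s\<in>{0..T}. norm (f s) \<le> N" using assms(1) by (auto simp: primitive_on_def)
  have "G x = G 0 + (LBINT s:{0..x}. g s)" if x: "x \<in> {0..T}" for x
    using primitive_onD(2)[OF assms(1) x] assms(2)[OF x] assms(2)[of 0] i[OF x] x by auto
  moreover have "set_borel_measurable borel {0..T} g"
    using primitive_onD(1)[OF assms(1)] by (simp add: set_borel_measurable_def m)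
  moreover have "\<forall>s\<in>{0..T}. norm (g s) \<le> N" using N assms(3) by auto
  ultimately show ?thesis unfolding primitive_on_def by blast
qed

lemma primitive_on_cong_AE:
  assumes F: "primitive_on 1 F f" and g: "g \<in> borel_measurable borel" "\<And>s. s \<in> {0..1} \<Longrightarrow> norm (g s) \<le> N"
    and ae: "AE s in unit_interval. f s = g s"
  shows "primitive_on 1 F g"
proof -
  have i: "(LBINT s:{0..x}. f s) = (LBINT s:{0..x}. g s)" if x: "x \<in> {0..1}" for x
    unfolding set_lebesgue_integral_def
  proof (rule integral_cong_AE)
    show "(\<lambda>s. indicat_real {0..x} s *\<^sub>R f s) \<in> borel_measurable lborel"
      using primitive_on_integrable[OF F, of 0 x] x by (auto simp: set_integrable_def)
    show "(\<lambda>s. indicat_real {0..x} s *\<^sub>R g s) \<in> borel_measurable lborel" using g(1) by measurable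
    show "AE s in lborel. indicat_real {0..x} s *\<^sub>R f s = indicat_real {0..x} s *\<^sub>R g s"
      using ae unfolding AE_unit_interval_iff by eventually_elim (use x in \<open>auto simp: indicator_def\<close>)
  qed
  have "F x = F 0 + (LBINT s:{0..x}. g s)" if x: "x \<in> {0..1}" for x
    using primitive_onD(2)[OF F x] i[OF x] by simp
  then show ?thesis
    using g unfolding primitive_on_def set_borel_measurable_def by (auto intro!: exI[of _ N] simp del: atLeastAtMost_iff)
qed

lemma primitive_on_AE_unique:
  fixes F f g :: "real \<Rightarrow> 'k::{real_normed_field, banach, second_countable_topology}"
  assumes F: "primitive_on 1 F f" and G: "primitive_on 1 F g"
  shows "AE s in unit_interval. f s = g s"
proof -
  obtain M where M: "\<forall>s\<in>{0..1}. norm (f s) \<le> M" using F by (auto simp: primitive_on_def)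
  obtain N where N: "\<forall>s\<in>{0..1}. norm (g s) \<le> N" using G by (auto simp: primitive_on_def)
  have mm: "(\<lambda>s. indicator {0..1} s *\<^sub>R f s) \<in> borel_measurable borel" "(\<lambda>s. indicator {0..1} s *\<^sub>R g s) \<in> borel_measurable borel"
    using primitive_onD(1)[OF F] primitive_onD(1)[OF G] by (auto simp: set_borel_measurable_def)
  let ?h = "\<lambda>s. indicator {0..1} s *\<^sub>R f s - indicator {0..1} s *\<^sub>R g s"
  have "AE s in unit_interval. ?h s = 0"
  proof (rule AE_zero_of_primitives_zero)
    show "?h \<in> borel_measurable unit_interval"
      by (intro borel_measurable_unit_interval borel_measurable_diff mm)
    show "AE s in unit_interval. norm (?h s) \<le> M + N"
      using M N by (intro AE_I2) (auto intro!: order_trans[OF norm_triangle_ineq4] add_mono)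
    fix x :: real assume x: "x \<in> {0..1}"
    have mh: "set_borel_measurable borel {0..1} ?h"
      using mm by (simp add: set_borel_measurable_def)
    have "(LINT s|unit_interval. indicator {0..x} s *\<^sub>R ?h s) = (LBINT s:{0..x}. ?h s)"
      by (rule set_LINT_unit_interval_prefix[OF mh x])
    also have "\<dots> = (LBINT s:{0..x}. f s - g s)"
      using x by (intro set_lebesgue_integral_cong) auto
    also have "\<dots> = (LBINT s:{0..x}. f s) - (LBINT s:{0..x}. g s)"
      using primitive_on_integrable[OF F, of 0 x] primitive_on_integrable[OF G, of 0 x] x
      by (intro set_integral_diff(2)) auto
    also have "\<dots> = 0" using primitive_onD(2)[OF F x] primitive_onD(2)[OF G x] by simp
    finally show "(LINT s|unit_interval. indicator {0..x} s *\<^sub>R ?h s) = 0" .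
  qed
  then show ?thesis unfolding AE_unit_interval_iff by eventually_elim auto
qed

lemma continuous_rep_bound:
  assumes "is_continuous_rep f g" "AE s in unit_interval. norm (f s) \<le> N" "x \<in> {0..1}"
  shows "norm (g x) \<le> N"
proof -
  have g: "continuous_on {0..1} g" "AE s in unit_interval. f s = g s"
    using assms(1) by (auto simp: is_continuous_rep_def)
  have "max (norm (g x) - N) 0 = 0"
  proof (rule continuous_eq_of_AE[OF _ _ _ assms(3)])
    show "continuous_on {0..1} (\<lambda>x. max (norm (g x) - N) 0)" by (intro continuous_intros g(1))
    show "AE s in unit_interval. max (norm (g s) - N) 0 = 0"
      using g(2) assms(2) by eventually_elim simp
  qed simp
  then show ?thesis by simp
qed

section \<open>The weak* topology on bounded sets\<close>

text \<open>The sequence with entry \<open>z\<close> at \<open>i\<close> and \<open>0\<close> elsewhere, as an element of \<open>c\<^sub>0\<close>.\<close>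

definition unit_bcf :: "nat \<Rightarrow> 'k::real_normed_vector \<Rightarrow> nat \<Rightarrow>\<^sub>C 'k"
  where "unit_bcf i z = Bcontfun (\<lambda>j. if j = i then z else 0)"

text \<open>The sequence \<open>x\<close> with its first \<open>N\<close> entries replaced by \<open>0\<close>.\<close>

definition tail_bcf :: "nat \<Rightarrow> (nat \<Rightarrow>\<^sub>C 'k::real_normed_vector) \<Rightarrow> nat \<Rightarrow>\<^sub>C 'k"
  where "tail_bcf N x = Bcontfun (\<lambda>j. if j < N then 0 else apply_bcontfun x j)"

lemma apply_unit_bcf: "apply_bcontfun (unit_bcf i z) j = (if j = i then z else 0)"
proof -
  have "bounded (range (\<lambda>j. if j = i then z else 0))"
    unfolding bounded_iff by (rule exI[of _ "norm z"]) auto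
  then show ?thesis by (simp add: unit_bcf_def Bcontfun_inverse bcontfun_def)
qed

lemma apply_tail_bcf: "apply_bcontfun (tail_bcf N x) j = (if j < N then 0 else apply_bcontfun x j)"
proof -
  have "bounded (range (\<lambda>j. if j < N then 0 else apply_bcontfun x j))"
    using norm_bounded[of x] unfolding bounded_iff by (intro exI[of _ "norm x"]) auto
  then show ?thesis by (simp add: tail_bcf_def Bcontfun_inverse bcontfun_def)
qed

lemma norm_unit_bcf_le: "norm (unit_bcf i z) \<le> norm z"
  by (rule norm_bound) (simp add: apply_unit_bcf)

lemma bounded_linear_unit_bcf: "bounded_linear (unit_bcf i)"
  by (rule bounded_linear_intro[of _ 1])
    (auto simp: norm_unit_bcf_le apply_unit_bcf intro!: bcontfun_eqI)

lemma norm_tail_bcf_le: "norm (tail_bcf N x) \<le> norm x"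
  by (rule norm_bound) (auto simp: apply_tail_bcf norm_bounded)

lemma bounded_linear_tail_bcf: "bounded_linear (tail_bcf N)"
  by (rule bounded_linear_intro[of _ 1])
    (auto simp: norm_tail_bcf_le apply_tail_bcf intro!: bcontfun_eqI)

lemma bounded_linear_apply_bcontfun: "bounded_linear (\<lambda>x. apply_bcontfun x j)"
  by (rule bounded_linear_intro[of _ 1]) (auto simp: norm_bounded)

lemma norm_tail_bcf_tendsto_0:
  assumes "apply_bcontfun x \<longlonglongrightarrow> 0"
  shows "(\<lambda>N. norm (tail_bcf N x)) \<longlonglongrightarrow> 0"
proof (rule LIMSEQ_I)
  fix r :: real assume "0 < r"
  then obtain N where N: "\<And>j. N \<le> j \<Longrightarrow> norm (apply_bcontfun x j) < r / 2"
    using LIMSEQ_D[OF assms, of "r / 2"] by auto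
  have "norm (tail_bcf n x) \<le> r / 2" if "N \<le> n" for n
    using N that \<open>0 < r\<close> by (intro norm_bound) (auto simp: apply_tail_bcf less_imp_le)
  then show "\<exists>N. \<forall>n\<ge>N. norm (norm (tail_bcf n x) - 0) < r"
    using \<open>0 < r\<close> by (intro exI[of _ N]) force
qed

text \<open>Each coordinate converges weakly; it is tested with functions with values in one axis of \<open>c\<^sub>0\<close>.\<close>

lemma weak_star_limit_imp_coord:
  fixes h :: "'a \<Rightarrow> real \<Rightarrow> 'k::{real_normed_field, banach, second_countable_topology} ell1"
  assumes lim: "limitin (weak_star J) h l F" and j: "j \<in> J"
    and p: "p \<in> borel_measurable borel" "\<And>s. s \<in> {0..1} \<Longrightarrow> norm (p s) \<le> P"
  shows "((\<lambda>a. LINT s|unit_interval. coord (h a s) j * p s) \<longlongrightarrow> (LINT s|unit_interval. coord (l s) j * p s)) F"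
proof -
  define g where "g s = unit_bcf j (p s)" for s
  have "g \<in> bochner_L1 (c0_on J)"
    unfolding bochner_L1_def
  proof (intro CollectI conjI)
    show "strongly_measurable unit_interval g"
      unfolding g_def using strongly_measurable_borel[OF p(1)]
      by (rule strongly_measurable_compose) (intro linear_continuous_on bounded_linear_unit_bcf)
    have "\<forall>\<^sub>F i in sequentially. apply_bcontfun (g s) i = 0" for s
      using eventually_gt_at_top[of j] by eventually_elim (simp add: g_def apply_unit_bcf)
    then have "apply_bcontfun (g s) \<longlonglongrightarrow> 0" for s by (rule tendsto_eventually)
    then show "AE s in unit_interval. g s \<in> c0_on J"
      using j by (intro AE_I2) (auto simp: c0_on_def ellinf_on_def g_def apply_unit_bcf)
    have "(\<integral>\<^sup>+ s. ennreal (norm (g s)) \<partial>unit_interval) \<le> (\<integral>\<^sup>+ s. ennreal P \<partial>unit_interval)"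
      using p(2) order_trans[OF norm_unit_bcf_le] unfolding g_def
      by (intro nn_integral_mono ennreal_leI) auto
    also have "\<dots> < \<infinity>"
      using finite_measure.emeasure_finite[OF finite_measure_unit_interval, of "{0..1}"]
      by (simp add: ennreal_mult_less_top less_top)
    finally show "(\<integral>\<^sup>+ s. ennreal (norm (g s)) \<partial>unit_interval) < \<infinity>" .
  qed
  then have "((\<lambda>a. duality_pairing J (h a) g) \<longlongrightarrow> duality_pairing J l g) F"
    using lim unfolding limitin_weak_star by blast
  moreover have "duality_pairing J f g = (LINT s|unit_interval. coord (f s) j * p s)" for f
  proof -
    have "(\<Sum>\<^sub>\<infinity>i\<in>J. coord (f s) i * apply_bcontfun (g s) i) = coord (f s) j * p s" for s
    proof -
      have "(\<Sum>\<^sub>\<infinity>i\<in>J. coord (f s) i * apply_bcontfun (g s) i) = (\<Sum>\<^sub>\<infinity>i\<in>{j}. coord (f s) i * apply_bcontfun (g s) i)"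
        by (rule infsum_cong_neutral) (use j in \<open>auto simp: g_def apply_unit_bcf\<close>)
      then show ?thesis by (simp add: g_def apply_unit_bcf)
    qed
    then show ?thesis by (simp add: duality_pairing_def)
  qed
  ultimately show ?thesis by simp
qed

text \<open>The first \<open>N\<close> coordinates approximate the pairing, uniformly on norm-bounded sets.\<close>

lemma duality_pairing_truncation:
  fixes f :: "real \<Rightarrow> 'k::{real_normed_field, banach, second_countable_topology} ell1"
  assumes f: "f \<in> bochner_Linf (ell1_on J)" and M: "0 \<le> M" "AE s in unit_interval. norm (f s) \<le> M"
    and g: "g \<in> bochner_L1 (c0_on J)"
  shows "norm (duality_pairing J f g - (\<Sum>j<N. LINT s|unit_interval. coord (f s) j * apply_bcontfun (g s) j))
      \<le> M * (LINT s|unit_interval. norm (tail_bcf N (g s)))"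
proof -
  have smf: "f \<in> borel_measurable unit_interval" and smg: "strongly_measurable unit_interval g"
    using f g by (auto simp: bochner_Linf_def bochner_L1_def intro: strongly_measurable_imp_borel_measurable)
  have mf: "(\<lambda>s. coord (f s) j) \<in> borel_measurable unit_interval" for j
    using smf by (rule borel_measurable_coord)
  have mg: "(\<lambda>s. apply_bcontfun (g s) j) \<in> borel_measurable unit_interval" for j
    using strongly_measurable_compose[OF smg linear_continuous_on[OF bounded_linear_apply_bcontfun]]
    by (rule strongly_measurable_imp_borel_measurable)
  have ig: "integrable unit_interval (\<lambda>s. norm (g s))"
    using g strongly_measurable_norm[OF smg] by (intro integrableI_bounded) (auto simp: bochner_L1_def)
  have it: "integrable unit_interval (\<lambda>s. norm (tail_bcf N (g s)))"
  proof (rule Bochner_Integration.integrable_bound[OF ig])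
    show "(\<lambda>s. norm (tail_bcf N (g s))) \<in> borel_measurable unit_interval"
      by (rule strongly_measurable_norm[OF strongly_measurable_compose[OF smg linear_continuous_on[OF bounded_linear_tail_bcf]]])
  qed (simp add: norm_tail_bcf_le)
  let ?S = "\<lambda>n s. \<Sum>j<n. coord (f s) j * apply_bcontfun (g s) j"
  let ?\<Phi> = "\<lambda>s. \<Sum>\<^sub>\<infinity>j\<in>J. coord (f s) j * apply_bcontfun (g s) j"
  have pt: "(\<lambda>n. ?S n s) \<longlonglongrightarrow> ?\<Phi> s \<and> norm (?\<Phi> s - ?S N s) \<le> norm (f s) * norm (tail_bcf N (g s))"
    if fs: "f s \<in> ell1_on J" for s
  proof -
    let ?x = "\<lambda>j. coord (f s) j * apply_bcontfun (g s) j"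
    have le: "norm (?x j) \<le> norm (coord (f s) j) * norm (g s)" for j
      unfolding norm_mult by (intro mult_left_mono norm_bounded) auto
    have abs: "summable (\<lambda>j. norm (?x j))"
      by (rule summable_comparison_test'[OF summable_mult2[OF summable_coord[of "f s"], of "norm (g s)"]])
        (use le in auto)
    have "?\<Phi> s = infsum ?x UNIV"
      by (rule infsum_cong_neutral) (use fs in \<open>auto simp: ell1_on_def\<close>)
    also have "\<dots> = suminf ?x"
      using norm_summable_imp_has_sum[OF abs summable_sums[OF summable_norm_cancel[OF abs]]]
      by (simp add: infsumI)
    finally have \<Phi>: "?\<Phi> s = suminf ?x" .
    have 1: "(\<lambda>n. ?S n s) \<longlonglongrightarrow> ?\<Phi> s"
      unfolding \<Phi> using summable_LIMSEQ[OF summable_norm_cancel[OF abs]] .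
    have "?\<Phi> s - ?S N s = (\<Sum>j. ?x (j + N))"
      unfolding \<Phi> using suminf_minus_initial_segment[OF summable_norm_cancel[OF abs], of N] by simp
    also have "norm \<dots> \<le> (\<Sum>j. norm (coord (f s) (j + N)) * norm (tail_bcf N (g s)))"
    proof (rule norm_suminf_le)
      show "norm (?x (j + N)) \<le> norm (coord (f s) (j + N)) * norm (tail_bcf N (g s))" for j
        using norm_bounded[of "tail_bcf N (g s)" "j + N"]
        by (auto simp: norm_mult apply_tail_bcf intro!: mult_left_mono)
      show "summable (\<lambda>j. norm (coord (f s) (j + N)) * norm (tail_bcf N (g s)))"
        using summable_ignore_initial_segment[OF summable_coord[of "f s"], of N] by (intro summable_mult2)
    qed
    also have "\<dots> = (\<Sum>j. norm (coord (f s) (j + N))) * norm (tail_bcf N (g s))"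
      using summable_ignore_initial_segment[OF summable_coord[of "f s"], of N] by (simp add: suminf_mult2)
    also have "\<dots> \<le> norm (f s) * norm (tail_bcf N (g s))"
      unfolding norm_ell1.rep_eq
      using suminf_split_initial_segment[OF summable_coord[of "f s"], of N]
      by (intro mult_right_mono) (auto simp: sum_nonneg)
    finally show ?thesis using 1 by blast
  qed
  have S_int: "integrable unit_interval (\<lambda>s. coord (f s) j * apply_bcontfun (g s) j)" for j
  proof (rule Bochner_Integration.integrable_bound)
    show "integrable unit_interval (\<lambda>s. M * norm (g s))" using ig by simp
    show "(\<lambda>s. coord (f s) j * apply_bcontfun (g s) j) \<in> borel_measurable unit_interval"
      using mf mg by (rule borel_measurable_times)
    show "AE s in unit_interval. norm (coord (f s) j * apply_bcontfun (g s) j) \<le> norm (M * norm (g s))"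
      using M(2)
    proof eventually_elim
      case (elim s)
      have "norm (coord (f s) j * apply_bcontfun (g s) j) \<le> M * norm (g s)"
        unfolding norm_mult using elim norm_coord_le[of "f s" j] M(1)
        by (intro mult_mono norm_bounded) auto
      then show ?case by simp
    qed
  qed
  have mS: "(\<lambda>s. ?S n s) \<in> borel_measurable unit_interval" for n
    using mf mg by (intro borel_measurable_sum borel_measurable_times)
  have ae: "AE s in unit_interval. f s \<in> ell1_on J" using f by (simp add: bochner_Linf_def)
  have "(\<lambda>s. lim (\<lambda>n. ?S n s)) \<in> borel_measurable unit_interval"
    using mS by (rule borel_measurable_lim_metric)
  moreover have "AE s in unit_interval. lim (\<lambda>n. ?S n s) = ?\<Phi> s"
    using ae by eventually_elim (use pt in \<open>blast intro: limI\<close>)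
  ultimately have m\<Phi>: "?\<Phi> \<in> borel_measurable unit_interval"
    by (rule borel_measurable_unit_interval_AE)
  have diff: "AE s in unit_interval. norm (?\<Phi> s - ?S N s) \<le> M * norm (tail_bcf N (g s))"
    using ae M(2)
  proof eventually_elim
    case (elim s)
    with pt[of s] mult_right_mono[of "norm (f s)" M "norm (tail_bcf N (g s))"] show ?case by auto
  qed
  have iM: "integrable unit_interval (\<lambda>s. M * norm (tail_bcf N (g s)))" using it by simp
  have i\<Phi>S: "integrable unit_interval (\<lambda>s. ?\<Phi> s - ?S N s)"
  proof (rule Bochner_Integration.integrable_bound[OF iM])
    show "(\<lambda>s. ?\<Phi> s - ?S N s) \<in> borel_measurable unit_interval" using m\<Phi> mS by (rule borel_measurable_diff)
    show "AE s in unit_interval. norm (?\<Phi> s - ?S N s) \<le> norm (M * norm (tail_bcf N (g s)))"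
      using diff by eventually_elim (use M(1) in simp)
  qed
  have iS: "integrable unit_interval (\<lambda>s. ?S N s)" using S_int by simp
  then have "integrable unit_interval ?\<Phi>" using Bochner_Integration.integrable_add[OF i\<Phi>S iS] by simp
  then have "duality_pairing J f g - (\<Sum>j<N. LINT s|unit_interval. coord (f s) j * apply_bcontfun (g s) j)
      = (LINT s|unit_interval. ?\<Phi> s - ?S N s)"
    using iS S_int unfolding duality_pairing_def
    by (simp add: Bochner_Integration.integral_diff Bochner_Integration.integral_sum)
  also have "norm \<dots> \<le> (LINT s|unit_interval. norm (?\<Phi> s - ?S N s))" by (rule integral_norm_bound)
  also have "\<dots> \<le> (LINT s|unit_interval. M * norm (tail_bcf N (g s)))"
    using i\<Phi>S iM diff by (intro integral_mono_AE) auto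
  finally show ?thesis by simp
qed

lemma tail_integral_tendsto_0:
  fixes g :: "real \<Rightarrow> nat \<Rightarrow>\<^sub>C 'k::{real_normed_field, banach, second_countable_topology}"
  assumes g: "g \<in> bochner_L1 (c0_on J)"
  shows "(\<lambda>N. LINT s|unit_interval. norm (tail_bcf N (g s))) \<longlonglongrightarrow> 0"
proof -
  have smg: "strongly_measurable unit_interval g" using g by (auto simp: bochner_L1_def)
  have ig: "integrable unit_interval (\<lambda>s. norm (g s))"
    using g strongly_measurable_norm[OF smg] by (intro integrableI_bounded) (auto simp: bochner_L1_def)
  have "(\<lambda>N. LINT s|unit_interval. norm (tail_bcf N (g s))) \<longlonglongrightarrow> (LINT s|unit_interval. 0)"
  proof (rule integral_dominated_convergence[OF _ _ ig])
    show "(\<lambda>s. norm (tail_bcf N (g s))) \<in> borel_measurable unit_interval" for N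
      by (rule strongly_measurable_norm[OF strongly_measurable_compose[OF smg linear_continuous_on[OF bounded_linear_tail_bcf]]])
    have "AE s in unit_interval. g s \<in> c0_on J" using g by (simp add: bochner_L1_def)
    then show "AE s in unit_interval. (\<lambda>N. norm (tail_bcf N (g s))) \<longlonglongrightarrow> 0"
      by eventually_elim (auto simp: c0_on_def intro: norm_tail_bcf_tendsto_0)
    show "AE s in unit_interval. norm (norm (tail_bcf N (g s))) \<le> norm (g s)" for N
      by (intro AE_I2) (simp add: norm_tail_bcf_le)
  qed simp
  then show ?thesis by simp
qed


text \<open>
  On norm-bounded sets, weak* convergence is convergence of the primitives of the coordinates. The
  primitives may be taken after multiplying the coordinates by fixed invertible weights \<open>w\<close>.
\<close>

lemma bounded_weak_star_limit:
  fixes h :: "'a \<Rightarrow> real \<Rightarrow> 'k::{real_normed_field, banach, second_countable_topology} ell1"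
  assumes ev: "\<forall>\<^sub>F a in F. h a \<in> bochner_Linf (ell1_on J) \<and> ess_norm (h a) \<le> ennreal M"
    and l: "l \<in> bochner_Linf (ell1_on J)"
    and w: "\<And>j. j \<in> J \<Longrightarrow> w j \<in> borel_measurable borel" "\<And>j s. j \<in> J \<Longrightarrow> w j s \<noteq> 0"
      "\<And>j s. j \<in> J \<Longrightarrow> s \<in> {0..1} \<Longrightarrow> norm (w j s) \<le> B" "\<And>j s. j \<in> J \<Longrightarrow> s \<in> {0..1} \<Longrightarrow> norm (inverse (w j s)) \<le> B"
    and prim: "\<And>j x. j \<in> J \<Longrightarrow> x \<in> {0..1} \<Longrightarrow>
      ((\<lambda>a. LINT s|unit_interval. indicator {0..x} s *\<^sub>R (w j s * coord (h a s) j)) \<longlongrightarrow>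
        (LINT s|unit_interval. indicator {0..x} s *\<^sub>R (w j s * coord (l s) j))) F"
  shows "limitin (weak_star J) h l F"
  unfolding limitin_weak_star
proof (intro conjI ballI l)
  show "\<forall>\<^sub>F a in F. h a \<in> bochner_Linf (ell1_on J)" using ev by eventually_elim blast
  obtain L where L: "0 \<le> L" "AE s in unit_interval. norm (l s) \<le> L" using bochner_Linf_bound[OF l] by blast
  define K where "K = max L (max M 0)"
  have K: "0 \<le> K" "L \<le> K" "M \<le> K" by (auto simp: K_def)
  have lK: "AE s in unit_interval. norm (l s) \<le> K" using L(2) K by (auto elim: eventually_mono)
  have evK: "\<forall>\<^sub>F a in F. h a \<in> bochner_Linf (ell1_on J) \<and> (AE s in unit_interval. norm (h a s) \<le> K)"
    using ev
  proof eventually_elim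
    case (elim a)
    then have "ess_norm (h a) \<le> ennreal K" using K by (meson ennreal_leI order_trans)
    then show ?case using elim K ess_norm_le_iff[of "h a" K] by (auto simp: bochner_Linf_def)
  qed
  fix g :: "real \<Rightarrow> nat \<Rightarrow>\<^sub>C 'k" assume g: "g \<in> bochner_L1 (c0_on J)"
  have smg: "strongly_measurable unit_interval g" using g by (auto simp: bochner_L1_def)
  have mg: "(\<lambda>s. apply_bcontfun (g s) j) \<in> borel_measurable unit_interval" for j
    using strongly_measurable_compose[OF smg linear_continuous_on[OF bounded_linear_apply_bcontfun]]
    by (rule strongly_measurable_imp_borel_measurable)
  have ng: "integrable unit_interval (\<lambda>s. norm (g s))"
    using g strongly_measurable_norm[OF smg] by (intro integrableI_bounded) (auto simp: bochner_L1_def)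
  have ig: "integrable unit_interval (\<lambda>s. apply_bcontfun (g s) j)" for j
    by (rule Bochner_Integration.integrable_bound[OF ng mg]) (simp add: norm_bounded)
  have mc: "(\<lambda>s. coord (f s) j) \<in> borel_measurable unit_interval" if "f \<in> bochner_Linf (ell1_on J)" for f :: "real \<Rightarrow> 'k ell1" and j
    using that by (intro borel_measurable_coord strongly_measurable_imp_borel_measurable) (auto simp: bochner_Linf_def)
  have ic: "integrable unit_interval (\<lambda>s. coord (f s) j * apply_bcontfun (g s) j)"
    if "f \<in> bochner_Linf (ell1_on J)" "AE s in unit_interval. norm (f s) \<le> K" for f :: "real \<Rightarrow> 'k ell1" and j
  proof -
    have "AE s in unit_interval. norm (coord (f s) j) \<le> K"
      using that(2) by eventually_elim (rule order_trans[OF norm_coord_le])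
    from integrable_mult_bounded(1)[OF ig mc[OF that(1)] this] show ?thesis by (simp add: mult.commute)
  qed
  define I where "I j f = (LINT s|unit_interval. coord (f s) j * apply_bcontfun (g s) j)" for j and f :: "real \<Rightarrow> 'k ell1"
  have I_lim: "((\<lambda>a. I j (h a)) \<longlongrightarrow> I j l) F" for j
  proof (cases "j \<in> J")
    case False
    have "I j f = 0" if "f \<in> bochner_Linf (ell1_on J)" for f
    proof -
      have "AE s in unit_interval. coord (f s) j * apply_bcontfun (g s) j = 0"
        using that False by (auto simp: bochner_Linf_def ell1_on_def)
      then show ?thesis unfolding I_def by (rule integral_eq_zero_AE)
    qed
    with l evK show ?thesis by (auto intro!: tendsto_eventually elim: eventually_mono)
  next
    case True
    \<comment> \<open>the inverse weight is moved to the test function\<close>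
    let ?p = "\<lambda>s. apply_bcontfun (g s) j * inverse (w j s)"
    let ?h = "\<lambda>a s. w j s * coord (h a s) j - w j s * coord (l s) j"
    have mw: "w j \<in> borel_measurable unit_interval" by (intro borel_measurable_unit_interval w True)
    have "0 \<le> B" using order_trans[OF norm_ge_zero w(3)[OF True, of 0]] by auto
    have mwc: "(\<lambda>s. w j s * coord (f s) j) \<in> borel_measurable unit_interval"
      and bwc: "AE s in unit_interval. norm (w j s * coord (f s) j) \<le> B * K"
      if "f \<in> bochner_Linf (ell1_on J)" "AE s in unit_interval. norm (f s) \<le> K" for f :: "real \<Rightarrow> 'k ell1"
    proof -
      show "(\<lambda>s. w j s * coord (f s) j) \<in> borel_measurable unit_interval"
        using mw mc[OF that(1)] by (rule borel_measurable_times)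
      have "AE s in unit_interval. norm (w j s) \<le> B" using w(3)[OF True] by (intro AE_I2) auto
      then show "AE s in unit_interval. norm (w j s * coord (f s) j) \<le> B * K"
        using that(2)
      proof eventually_elim
        case (elim s)
        then show ?case
          unfolding norm_mult using \<open>0 \<le> B\<close> norm_coord_le[of "f s" j] by (intro mult_mono) auto
      qed
    qed
    have "((\<lambda>a. LINT s|unit_interval. ?p s * ?h a s) \<longlongrightarrow> 0) F"
    proof (rule weak_limit_zero_of_primitives[where M = "B * K + B * K"])
      show "\<forall>\<^sub>F a in F. ?h a \<in> borel_measurable unit_interval \<and> (AE s in unit_interval. norm (?h a s) \<le> B * K + B * K)"
        using evK
      proof eventually_elim
        case (elim a)
        from elim have "AE s in unit_interval. norm (w j s * coord (h a s) j) \<le> B * K" by (intro bwc) auto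
        then have "AE s in unit_interval. norm (?h a s) \<le> B * K + B * K"
          using bwc[OF l lK] by eventually_elim (rule order_trans[OF norm_triangle_ineq4 add_mono])
        moreover have "?h a \<in> borel_measurable unit_interval"
          using elim by (intro borel_measurable_diff mwc l lK) auto
        ultimately show ?case by blast
      qed
      have "integrable unit_interval (\<lambda>s. apply_bcontfun (g s) j * inverse (w j s))"
      proof (rule integrable_mult_bounded(1)[OF ig])
        show "(\<lambda>s. inverse (w j s)) \<in> borel_measurable unit_interval" using mw by measurable
        show "AE s in unit_interval. norm (inverse (w j s)) \<le> B" using w(4)[OF True] by (intro AE_I2) auto
      qed
      then show "integrable unit_interval ?p" .
      fix x :: real assume x: "x \<in> {0..1}"
      have "((\<lambda>a. (LINT s|unit_interval. indicator {0..x} s *\<^sub>R (w j s * coord (h a s) j))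
          - (LINT s|unit_interval. indicator {0..x} s *\<^sub>R (w j s * coord (l s) j))) \<longlongrightarrow> 0) F"
        using prim[OF True x] by (simp add: LIM_zero)
      moreover have "\<forall>\<^sub>F a in F. (LINT s|unit_interval. indicator {0..x} s *\<^sub>R (w j s * coord (h a s) j))
          - (LINT s|unit_interval. indicator {0..x} s *\<^sub>R (w j s * coord (l s) j))
          = (LINT s|unit_interval. indicator {0..x} s *\<^sub>R ?h a s)"
        using evK
      proof eventually_elim
        case (elim a)
        have int: "integrable unit_interval (\<lambda>s. indicat_real {0..x} s *\<^sub>R (w j s * coord (f s) j))"
          if f: "f \<in> bochner_Linf (ell1_on J)" "AE s in unit_interval. norm (f s) \<le> K" for f :: "real \<Rightarrow> 'k ell1"
          by (rule integrable_mult_indicator[OF _ integrable_bounded_unit_interval[OF mwc[OF f] bwc[OF f]]])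
            (use x in \<open>auto simp: sets_restrict_space_iff\<close>)
        show ?case using int[of "h a"] int[OF l lK] elim by (simp add: scaleR_diff_right)
      qed
      ultimately show "((\<lambda>a. LINT s|unit_interval. indicat_real {0..x} s *\<^sub>R ?h a s) \<longlongrightarrow> 0) F"
        by (rule Lim_transform_eventually)
    qed
    moreover have "\<forall>\<^sub>F a in F. (LINT s|unit_interval. ?p s * ?h a s) = I j (h a) - I j l"
      using evK
    proof eventually_elim
      case (elim a)
      have "?p s * ?h a s = coord (h a s) j * apply_bcontfun (g s) j - coord (l s) j * apply_bcontfun (g s) j" for s
        using w(2)[OF True, of s] by (simp add: field_simps)
      then show ?case using ic[of "h a"] ic[OF l lK] elim by (simp add: I_def)
    qed
    ultimately have "((\<lambda>a. I j (h a) - I j l) \<longlongrightarrow> 0) F" by (rule Lim_transform_eventually)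
    then show ?thesis by (rule LIM_zero_cancel)
  qed
  show "((\<lambda>a. duality_pairing J (h a) g) \<longlongrightarrow> duality_pairing J l g) F"
  proof (rule tendstoI)
    fix e :: real assume "0 < e"
    define R where "R N = (LINT s|unit_interval. norm (tail_bcf N (g s)))" for N
    have "(\<lambda>N. K * R N) \<longlonglongrightarrow> K * 0"
      unfolding R_def by (intro tendsto_intros tail_integral_tendsto_0[OF g])
    then have "\<forall>\<^sub>F N in sequentially. K * R N < e / 3"
      using \<open>0 < e\<close> by (intro order_tendstoD(2)) auto
    then obtain N where N: "K * R N < e / 3" by (auto simp: eventually_sequentially)
    have "((\<lambda>a. \<Sum>j<N. I j (h a)) \<longlongrightarrow> (\<Sum>j<N. I j l)) F"
      by (intro tendsto_sum I_lim)
    then have "\<forall>\<^sub>F a in F. dist (\<Sum>j<N. I j (h a)) (\<Sum>j<N. I j l) < e / 3"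
      by (rule tendstoD) (use \<open>0 < e\<close> in simp)
    then show "\<forall>\<^sub>F a in F. dist (duality_pairing J (h a) g) (duality_pairing J l g) < e"
      using evK
    proof eventually_elim
      case (elim a)
      have 1: "dist (duality_pairing J (h a) g) (\<Sum>j<N. I j (h a)) < e / 3"
        using duality_pairing_truncation[OF _ K(1) _ g, of "h a" N] elim N
        by (simp add: I_def R_def dist_norm)
      have 2: "dist (duality_pairing J l g) (\<Sum>j<N. I j l) < e / 3"
        using duality_pairing_truncation[OF l K(1) lK g, of N] N
        by (simp add: I_def R_def dist_norm)
      from elim(1) 1 2 show ?case
        using dist_triangle[of "duality_pairing J (h a) g" "duality_pairing J l g" "\<Sum>j<N. I j (h a)"]
          dist_triangle[of "\<Sum>j<N. I j (h a)" "duality_pairing J l g" "\<Sum>j<N. I j l"]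
          dist_commute[of "\<Sum>j<N. I j l" "duality_pairing J l g"]
        by linarith
    qed
  qed
qed

subsection \<open>Limits on the half-line\<close>

lemma continuous_map_top_of_set_iff:
  "continuous_map (top_of_set S) Y f \<longleftrightarrow> (\<forall>t\<in>S. limitin Y f (f t) (at t within S))"
proof -
  have "atin_within euclidean t S = at t within S" for t :: 'a
    by (auto simp: filter_eq_iff eventually_atin_within eventually_at_topological)
  then show ?thesis unfolding continuous_map_atin by (auto simp: atin_subtopology_within)
qed

lemma eventually_at_halfline:
  assumes "\<And>r::real. 0 \<le> r \<Longrightarrow> r \<le> t + 1 \<Longrightarrow> P r"
  shows "\<forall>\<^sub>F r in at t within {0..}. P r"
  unfolding eventually_at using assms by (intro exI[of _ 1]) (auto simp: dist_real_def)

lemma continuous_on_halfline: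
  fixes f :: "real \<Rightarrow> 'b::topological_space"
  assumes "\<And>T. continuous_on {0..T} f"
  shows "continuous_on {0..} f"
  unfolding continuous_on_def
proof
  fix t :: real assume t: "t \<in> {0..}"
  have "at t within {0..} = at t within {0..t + 1}"
    by (rule at_within_nhd[of _ "{..<t + 1}"]) auto
  then show "(f \<longlongrightarrow> f t) (at t within {0..})"
    using assms[of "t + 1"] t by (auto simp: continuous_on_def)
qed

lemma tendsto_halfline:
  fixes P :: "real \<Rightarrow> 'b::topological_space"
  assumes P: "continuous_on {0..} P" and t: "0 \<le> t" and y: "0 \<le> y"
  shows "((\<lambda>r. P (r + y)) \<longlongrightarrow> P (t + y)) (at t within {0..})"
proof -
  have "continuous_on {0..} (\<lambda>r. P (r + y))"
    by (rule continuous_on_compose2[OF P]) (use y in \<open>auto intro!: continuous_intros\<close>)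
  then show ?thesis using t by (auto simp: continuous_on_def)
qed

section \<open>The delay system for the boundary values\<close>

lemma sum_norm_set_integral_le:
  fixes f :: "'i \<Rightarrow> real \<Rightarrow> 'b::{banach, second_countable_topology}"
  assumes F: "finite F" and i: "\<And>j. j \<in> F \<Longrightarrow> set_integrable lborel {a..b} (f j)" and ab: "a \<le> b"
    and le: "\<And>s. s \<in> {a..b} \<Longrightarrow> (\<Sum>j\<in>F. norm (f j s)) \<le> L"
  shows "(\<Sum>j\<in>F. norm (LBINT s:{a..b}. f j s)) \<le> L * (b - a)"
proof -
  have i': "integrable lborel (\<lambda>s. norm (indicator {a..b} s *\<^sub>R f j s))" if "j \<in> F" for j
    using i[OF that] unfolding set_integrable_def by (rule integrable_norm)
  have "(\<Sum>j\<in>F. norm (LBINT s:{a..b}. f j s)) \<le> (\<Sum>j\<in>F. LINT s|lborel. norm (indicator {a..b} s *\<^sub>R f j s))"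
    unfolding set_lebesgue_integral_def by (intro sum_mono integral_norm_bound)
  also have "\<dots> = (LINT s|lborel. (\<Sum>j\<in>F. norm (indicator {a..b} s *\<^sub>R f j s)))"
    using i' by (intro Bochner_Integration.integral_sum[symmetric])
  also have "\<dots> \<le> (LINT s|lborel. indicator {a..b} s *\<^sub>R L)"
  proof (rule integral_mono)
    show "integrable lborel (\<lambda>s. \<Sum>j\<in>F. norm (indicator {a..b} s *\<^sub>R f j s))"
      using i' by (intro Bochner_Integration.integrable_sum)
    show "integrable lborel (\<lambda>s. indicator {a..b} s *\<^sub>R L)"
      by (intro integrable_scaleR_left integrable_real_indicator) (auto simp: emeasure_lborel_Icc_eq)
  qed (use le in \<open>auto simp: indicator_def\<close>)
  also have "\<dots> = L * (b - a)" using ab by simp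
  finally show ?thesis .
qed

text \<open>
  A flow without absorption is described by its values \<open>H\<^sub>j(t)\<close> at the endpoint \<open>0\<close> of the edges:
  \<open>u\<^sub>j(x,t) = H\<^sub>j(t + x/c\<^sub>j)\<close>. The initial value prescribes \<open>H\<^sub>j\<close> on \<open>[0,1/c\<^sub>j)\<close>, and the boundary
  condition with matrix \<open>M\<close> is a linear system with delays \<open>1/c\<^sub>j\<close>. The bound \<open>m\<close> of the column sums
  makes \<open>M\<close> bounded on \<open>\<ell>\<^sup>1\<close>. With infinitely many speeds, \<open>H(t)\<close> need not be summable.
\<close>

locale delay_system =
  fixes J :: "nat set" and c :: "nat \<Rightarrow> real" and cmin cmax m :: real
    and M :: "nat \<Rightarrow> nat \<Rightarrow> 'k::{real_normed_field, banach, second_countable_topology}"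
  assumes cmin_pos: "0 < cmin" and c_bounds: "\<And>j. j \<in> J \<Longrightarrow> cmin \<le> c j \<and> c j \<le> cmax"
    and finite_speeds: "finite (c ` J)"
    and finite_rows: "\<And>j. j \<in> J \<Longrightarrow> finite {k \<in> J. M j k \<noteq> 0}"
    and m_nonneg: "0 \<le> m"
    and column_sums: "\<And>k F. k \<in> J \<Longrightarrow> finite F \<Longrightarrow> F \<subseteq> J \<Longrightarrow> (\<Sum>j\<in>F. norm (M j k)) \<le> m"
begin

lemma c_pos: "j \<in> J \<Longrightarrow> 0 < c j"
  using cmin_pos c_bounds[of j] by linarith

lemma cmax_pos: "j \<in> J \<Longrightarrow> 0 < cmax"
  using c_pos[of j] c_bounds[of j] by linarith

lemma time_nonneg: "j \<in> J \<Longrightarrow> 0 \<le> t \<Longrightarrow> 0 \<le> t * cmax"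
  using cmax_pos[of j] by simp

lemma delay_ge: "j \<in> J \<Longrightarrow> 1 \<le> (1 / c j) * cmax"
  using c_pos[of j] c_bounds[of j] by simp

lemma delay_le: "j \<in> J \<Longrightarrow> 1 / c j \<le> 1 / cmin"
  using cmin_pos c_bounds[of j] by (intro divide_left_mono) auto

text \<open>The edges that feed the edge \<open>j\<close>.\<close>

definition sources :: "nat \<Rightarrow> nat set"
  where "sources j = {k \<in> J. M j k \<noteq> 0}"

lemma sources: "j \<in> J \<Longrightarrow> finite (sources j)" "k \<in> sources j \<Longrightarrow> k \<in> J"
  using finite_rows by (auto simp: sources_def)

text \<open>
  The data \<open>\<phi>\<^sub>j\<close> are functions of the position \<open>x \<in> [0,1)\<close> on the edge, which is reached from the
  endpoint \<open>0\<close> in time \<open>x/c\<^sub>j\<close>. Since each delay is at least \<open>1 / cmax\<close>, \<open>iter n\<close> is the solution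
  before time \<open>n / cmax\<close>.
\<close>

primrec iter :: "nat \<Rightarrow> (nat \<Rightarrow> real \<Rightarrow> 'k) \<Rightarrow> nat \<Rightarrow> real \<Rightarrow> 'k"
  where
    "iter 0 \<phi> = (\<lambda>j t. 0)"
  | "iter (Suc n) \<phi> = (\<lambda>j t. if t < 1 / c j then \<phi> j (c j * t) else \<Sum>k\<in>sources j. M j k * iter n \<phi> k (t - 1 / c j))"

text \<open>A number of delays that suffices up to time \<open>t\<close>.\<close>

definition steps :: "real \<Rightarrow> nat"
  where "steps t = nat \<lfloor>t * cmax\<rfloor> + 1"

text \<open>The solution with data \<open>\<phi>\<close>; its values at negative times are irrelevant.\<close>

definition sol :: "(nat \<Rightarrow> real \<Rightarrow> 'k) \<Rightarrow> nat \<Rightarrow> real \<Rightarrow> 'k"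
  where "sol \<phi> j t = iter (steps t) \<phi> j t"

lemma steps_gt: "0 \<le> t \<Longrightarrow> t * cmax < real (steps t)"
  unfolding steps_def by linarith

lemma steps_gt': "0 \<le> t \<Longrightarrow> t \<le> T \<Longrightarrow> j \<in> J \<Longrightarrow> t * cmax < real (steps T)"
  using steps_gt[of T] mult_right_mono[of t T cmax] cmax_pos[of j] by linarith

lemma iter_stable:
  assumes "j \<in> J" "0 \<le> t" "t * cmax < real n" "t * cmax < real n'"
  shows "iter n \<phi> j t = iter n' \<phi> j t"
  using assms
proof (induction n arbitrary: n' j t)
  case 0
  then show ?case using time_nonneg[of j t] by simp
next
  case (Suc n)
  have "n' \<noteq> 0" using Suc.prems time_nonneg[of j t] by (intro notI) simp
  then obtain p where p: "n' = Suc p" by (cases n') auto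
  have "iter n \<phi> k (t - 1 / c j) = iter p \<phi> k (t - 1 / c j)" if "k \<in> sources j" "\<not> t < 1 / c j" for k
  proof (rule Suc.IH)
    have "(t - 1 / c j) * cmax \<le> t * cmax - 1"
      using delay_ge[OF Suc.prems(1)] by (simp add: left_diff_distrib)
    then show "(t - 1 / c j) * cmax < real n" "(t - 1 / c j) * cmax < real p"
      using Suc.prems p by auto
  qed (use that sources in auto)
  then show ?case unfolding p by (auto intro!: sum.cong)
qed

lemma sol_eq_iter:
  assumes "j \<in> J" "0 \<le> t" "t * cmax < real n"
  shows "sol \<phi> j t = iter n \<phi> j t"
  unfolding sol_def using assms by (intro iter_stable steps_gt)

lemma sol_initial:
  assumes "j \<in> J" "0 \<le> t" "t < 1 / c j"
  shows "sol \<phi> j t = \<phi> j (c j * t)"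
  using assms by (simp add: sol_def steps_def)

lemma sol_delay:
  assumes j: "j \<in> J" and t: "0 \<le> t"
  shows "sol \<phi> j (t + 1 / c j) = (\<Sum>k\<in>sources j. M j k * sol \<phi> k t)"
proof -
  let ?n = "steps (t + 1 / c j)"
  have t': "0 \<le> t + 1 / c j" using t c_pos[OF j] by simp
  have n: "(t + 1 / c j) * cmax < real ?n" using t' by (rule steps_gt)
  then have "t * cmax + 1 < real ?n"
    using delay_ge[OF j] by (simp add: distrib_right)
  then obtain p where p: "?n = Suc p" "t * cmax < real p"
    by (cases ?n) (use t cmax_pos[OF j] in \<open>auto simp: steps_def\<close>)
  have "sol \<phi> j (t + 1 / c j) = iter (Suc p) \<phi> j (t + 1 / c j)" by (simp only: sol_def p)
  also have "\<dots> = (\<Sum>k\<in>sources j. M j k * iter p \<phi> k t)" using t by simp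
  also have "\<dots> = (\<Sum>k\<in>sources j. M j k * sol \<phi> k t)"
    using p(2) t sources sol_eq_iter[of _ t p \<phi>] by (intro sum.cong) auto
  finally show ?thesis .
qed

lemma sol_unique:
  assumes init: "\<And>j t. j \<in> J \<Longrightarrow> 0 \<le> t \<Longrightarrow> t < 1 / c j \<Longrightarrow> H j t = \<phi> j (c j * t)"
    and delay: "\<And>j t. j \<in> J \<Longrightarrow> 0 \<le> t \<Longrightarrow> H j (t + 1 / c j) = (\<Sum>k\<in>sources j. M j k * H k t)"
    and j: "j \<in> J" and t: "0 \<le> t"
  shows "H j t = sol \<phi> j t"
proof -
  have "H j t = sol \<phi> j t" if "j \<in> J" "0 \<le> t" "t * cmax < real n" for n j t
    using that
  proof (induction n arbitrary: j t)
    case 0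
    then show ?case using time_nonneg[of j t] by simp
  next
    case (Suc n)
    show ?case
    proof (cases "t < 1 / c j")
      case True
      then show ?thesis using Suc.prems by (simp add: init sol_initial)
    next
      case False
      define s where "s = t - 1 / c j"
      have s: "0 \<le> s" "t = s + 1 / c j" using False by (auto simp: s_def)
      have "s * cmax \<le> t * cmax - 1"
        using delay_ge[OF Suc.prems(1)] by (simp add: s_def left_diff_distrib)
      then have "H k s = sol \<phi> k s" if "k \<in> sources j" for k
        using Suc.IH[of k s] Suc.prems s that sources by auto
      then show ?thesis
        unfolding s(2) using Suc.prems(1) s(1) by (simp add: delay sol_delay)
    qed
  qed
  from this[OF j t steps_gt[OF t]] show ?thesis .
qed

text \<open>Edges of equal speed are treated together; this costs a factor, the number of speeds.\<close>

lemma speed_split: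
  assumes F: "finite F" "F \<subseteq> J"
    and le: "\<And>\<sigma>. \<sigma> \<in> c ` J \<Longrightarrow> (\<Sum>j\<in>{j \<in> F. c j = \<sigma>}. norm (Y j)) \<le> L"
  shows "(\<Sum>j\<in>F. norm (Y j)) \<le> real (card (c ` J)) * L"
proof -
  have "(\<Sum>j\<in>F. norm (Y j)) = (\<Sum>\<sigma>\<in>c ` J. \<Sum>j\<in>{j \<in> F. c j = \<sigma>}. norm (Y j))"
    using F finite_speeds by (intro sum.group[symmetric]) auto
  also have "\<dots> \<le> of_nat (card (c ` J)) * L" by (intro sum_bounded_above le)
  finally show ?thesis .
qed

lemma matrix_bound:
  assumes F: "finite F" "F \<subseteq> J" and X: "\<And>G. finite G \<Longrightarrow> G \<subseteq> J \<Longrightarrow> (\<Sum>k\<in>G. norm (X k)) \<le> L"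
  shows "(\<Sum>j\<in>F. norm (\<Sum>k\<in>sources j. M j k * X k)) \<le> m * L"
proof -
  define G where "G = (\<Union>j\<in>F. sources j)"
  have G: "finite G" "G \<subseteq> J" using F sources by (auto simp: G_def)
  have "(\<Sum>j\<in>F. norm (\<Sum>k\<in>sources j. M j k * X k)) \<le> (\<Sum>j\<in>F. \<Sum>k\<in>G. norm (M j k) * norm (X k))"
  proof (rule sum_mono)
    fix j assume "j \<in> F"
    then have "(\<Sum>k\<in>sources j. M j k * X k) = (\<Sum>k\<in>G. M j k * X k)"
      using G by (intro sum.mono_neutral_left) (auto simp: G_def sources_def)
    then show "norm (\<Sum>k\<in>sources j. M j k * X k) \<le> (\<Sum>k\<in>G. norm (M j k) * norm (X k))"
      using norm_sum[of "\<lambda>k. M j k * X k" G] by (simp add: norm_mult)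
  qed
  also have "\<dots> = (\<Sum>k\<in>G. (\<Sum>j\<in>F. norm (M j k)) * norm (X k))"
    by (subst sum.swap) (simp add: sum_distrib_right)
  also have "\<dots> \<le> (\<Sum>k\<in>G. m * norm (X k))"
    using G F by (intro sum_mono mult_right_mono column_sums) auto
  also have "\<dots> = m * (\<Sum>k\<in>G. norm (X k))" by (simp add: sum_distrib_left)
  also have "\<dots> \<le> m * L" using G m_nonneg by (intro mult_left_mono X)
  finally show ?thesis .
qed

text \<open>The factor by which \<open>\<ell>\<^sup>1\<close>-norms may grow in \<open>n\<close> iterations.\<close>

primrec growth :: "nat \<Rightarrow> real"
  where
    "growth 0 = 0"
  | "growth (Suc n) = real (card (c ` J)) * (1 + m * growth n)"

lemma growth_nonneg: "0 \<le> growth n"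
  by (induction n) (auto simp: m_nonneg)

text \<open>\<open>B\<close> bounds the \<open>\<ell>\<^sup>1\<close>-norm of the data \<open>(\<phi>\<^sub>j(x))\<^sub>j\<close> for every \<open>x \<in> [0,1]\<close>.\<close>

definition data_bound :: "(nat \<Rightarrow> real \<Rightarrow> 'k) \<Rightarrow> real \<Rightarrow> bool"
  where "data_bound \<phi> B \<longleftrightarrow> 0 \<le> B \<and>
    (\<forall>x F. 0 \<le> x \<and> x \<le> 1 \<and> finite F \<and> F \<subseteq> J \<longrightarrow> (\<Sum>j\<in>F. norm (\<phi> j x)) \<le> B)"

lemma iter_bound:
  assumes B: "data_bound \<phi> B" and F: "finite F" "F \<subseteq> J" and t: "0 \<le> t"
  shows "(\<Sum>j\<in>F. norm (iter n \<phi> j t)) \<le> B * growth n"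
  using F t
proof (induction n arbitrary: F t)
  case (Suc n)
  have B0: "0 \<le> B" using B by (simp add: data_bound_def)
  have "(\<Sum>j\<in>F. norm (iter (Suc n) \<phi> j t)) \<le> real (card (c ` J)) * (B * (1 + m * growth n))"
  proof (rule speed_split[OF Suc.prems(1,2)])
    fix \<sigma> assume "\<sigma> \<in> c ` J"
    let ?F = "{j \<in> F. c j = \<sigma>}"
    have F: "finite ?F" "?F \<subseteq> J" using Suc.prems by auto
    have \<sigma>: "0 < \<sigma>" using \<open>\<sigma> \<in> c ` J\<close> c_pos by auto
    show "(\<Sum>j\<in>?F. norm (iter (Suc n) \<phi> j t)) \<le> B * (1 + m * growth n)"
    proof (cases "t < 1 / \<sigma>")
      case True
      then have "(\<Sum>j\<in>?F. norm (iter (Suc n) \<phi> j t)) = (\<Sum>j\<in>?F. norm (\<phi> j (\<sigma> * t)))"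
        by (intro sum.cong) auto
      also have "\<dots> \<le> B"
        using B F True \<sigma> Suc.prems(3) unfolding data_bound_def
        by (auto simp: field_simps)
      also have "\<dots> \<le> B * (1 + m * growth n)"
        using B0 m_nonneg growth_nonneg[of n] by (simp add: distrib_left)
      finally show ?thesis .
    next
      case False
      then have "(\<Sum>j\<in>?F. norm (iter (Suc n) \<phi> j t))
          = (\<Sum>j\<in>?F. norm (\<Sum>k\<in>sources j. M j k * iter n \<phi> k (t - 1 / \<sigma>)))"
        by (intro sum.cong) auto
      also have "\<dots> \<le> m * (B * growth n)"
        using False by (intro matrix_bound F Suc.IH) auto
      also have "\<dots> \<le> B * (1 + m * growth n)"
        using B0 by (simp add: distrib_left mult_ac)
      finally show ?thesis .
    qed
  qed
  then show ?case by (simp add: mult_ac)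
qed simp

text \<open>The bound of the solution operator on \<open>[0,T]\<close>.\<close>

definition sol_const :: "real \<Rightarrow> real"
  where "sol_const T = real (card (c ` J)) * growth (steps T)"

text \<open>The times may depend on the edge through its speed, as they do along the characteristics.\<close>

lemma sol_bound:
  assumes B: "data_bound \<phi> B" and F: "finite F" "F \<subseteq> J"
    and \<tau>: "\<And>\<sigma>. \<sigma> \<in> c ` J \<Longrightarrow> 0 \<le> \<tau> \<sigma> \<and> \<tau> \<sigma> \<le> T"
  shows "(\<Sum>j\<in>F. norm (sol \<phi> j (\<tau> (c j)))) \<le> B * sol_const T"
proof -
  have "(\<Sum>j\<in>F. norm (sol \<phi> j (\<tau> (c j)))) \<le> real (card (c ` J)) * (B * growth (steps T))"
  proof (rule speed_split[OF F])
    fix \<sigma> assume \<sigma>: "\<sigma> \<in> c ` J"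
    let ?F = "{j \<in> F. c j = \<sigma>}"
    have "(\<Sum>j\<in>?F. norm (sol \<phi> j (\<tau> (c j)))) = (\<Sum>j\<in>?F. norm (iter (steps T) \<phi> j (\<tau> \<sigma>)))"
      using \<tau>[OF \<sigma>] F steps_gt'[of "\<tau> \<sigma>" T] by (intro sum.cong) (auto intro!: arg_cong[where f = norm] sol_eq_iter)
    also have "\<dots> \<le> B * growth (steps T)"
      using F \<tau>[OF \<sigma>] by (intro iter_bound[OF B]) auto
    finally show "(\<Sum>j\<in>?F. norm (sol \<phi> j (\<tau> (c j)))) \<le> B * growth (steps T)" .
  qed
  then show ?thesis by (simp add: sol_const_def mult_ac)
qed

lemma sol_const_nonneg: "0 \<le> sol_const T"
  by (simp add: sol_const_def growth_nonneg)

lemma norm_sol_le: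
  assumes "data_bound \<phi> B" "j \<in> J" "0 \<le> t" "t \<le> T"
  shows "norm (sol \<phi> j t) \<le> B * sol_const T"
  using sol_bound[OF assms(1), of "{j}" "\<lambda>_. t" T] assms by simp

lemma sol_measurable:
  assumes "\<And>j. j \<in> J \<Longrightarrow> \<phi> j \<in> borel_measurable borel" "j \<in> J"
  shows "sol \<phi> j \<in> borel_measurable borel"
proof -
  have it: "iter n \<phi> j \<in> borel_measurable borel" if "j \<in> J" for n j
    using that
  proof (induction n arbitrary: j)
    case (Suc n)
    have [measurable]: "\<phi> j \<in> borel_measurable borel" using assms Suc.prems by auto
    have IH: "iter n \<phi> k \<in> borel_measurable borel" if "k \<in> sources j" for k
      using Suc.IH sources that by auto
    have "(\<lambda>t. \<Sum>k\<in>sources j. M j k * iter n \<phi> k (t - 1 / c j)) \<in> borel_measurable borel"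
    proof (intro borel_measurable_sum borel_measurable_times borel_measurable_const)
      fix k assume "k \<in> sources j"
      show "(\<lambda>t. iter n \<phi> k (t - 1 / c j)) \<in> borel_measurable borel"
        by (rule measurable_compose[OF _ IH[OF \<open>k \<in> sources j\<close>]]) measurable
    qed
    then show ?case by simp
  qed simp
  have "(\<lambda>t. iter (steps t) \<phi> j t) \<in> borel_measurable borel"
  proof (rule measurable_compose_countable[where f = "\<lambda>n t. iter n \<phi> j t"])
    show "iter n \<phi> j \<in> borel_measurable borel" for n by (rule it[OF assms(2)])
    show "steps \<in> borel \<rightarrow>\<^sub>M count_space UNIV" unfolding steps_def[abs_def] by measurable
  qed
  then show ?thesis by (simp add: sol_def[abs_def])
qed

lemma sol_integrable:
  assumes "\<And>j. j \<in> J \<Longrightarrow> \<phi> j \<in> borel_measurable borel" "data_bound \<phi> B" "j \<in> J" "0 \<le> a"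
  shows "set_integrable lborel {a..b} (sol \<phi> j)"
proof (rule set_integrable_bounded)
  show "set_borel_measurable borel {a..b} (sol \<phi> j)"
    using sol_measurable[of \<phi> j] assms(1,3) by (simp add: set_borel_measurable_def)
  show "norm (sol \<phi> j s) \<le> B * sol_const b" if "s \<in> {a..b}" for s
    using that assms by (intro norm_sol_le) auto
qed

lemma sol_integral_initial:
  assumes m: "\<phi> j \<in> borel_measurable borel" "\<And>j. j \<in> J \<Longrightarrow> \<phi> j \<in> borel_measurable borel"
    and j: "j \<in> J" and t: "0 \<le> t" "t \<le> 1 / c j"
  shows "(LBINT s:{0..t}. sol \<phi> j s) = (1 / c j) *\<^sub>R (LBINT x:{0..c j * t}. \<phi> j x)"
proof -
  have ms: "sol \<phi> j \<in> borel_measurable borel" using m(2) j by (rule sol_measurable)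
  have "(LBINT s:{0..t}. sol \<phi> j s) = (LBINT s:{0..t}. \<phi> j (0 + c j * s))"
    unfolding set_lebesgue_integral_def
  proof (rule integral_cong_AE)
    show "AE s in lborel. indicat_real {0..t} s *\<^sub>R sol \<phi> j s = indicat_real {0..t} s *\<^sub>R \<phi> j (0 + c j * s)"
      using AE_lborel_singleton[of "1 / c j"]
      by eventually_elim (use t in \<open>auto simp: indicator_def intro!: sol_initial[OF j]\<close>)
    show "(\<lambda>s. indicat_real {0..t} s *\<^sub>R sol \<phi> j s) \<in> borel_measurable lborel"
      using ms by measurable
    show "(\<lambda>s. indicat_real {0..t} s *\<^sub>R \<phi> j (0 + c j * s)) \<in> borel_measurable lborel"
      using m(1) by measurable
  qed
  then show ?thesis using set_integral_shift_scale[OF c_pos[OF j], of 0 t "\<phi> j" 0] by simp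
qed

lemma sol_integral_delay:
  assumes m: "\<And>j. j \<in> J \<Longrightarrow> \<phi> j \<in> borel_measurable borel" and B: "data_bound \<phi> B"
    and j: "j \<in> J" and t: "0 \<le> t"
  shows "(LBINT s:{1 / c j..t + 1 / c j}. sol \<phi> j s) = (\<Sum>k\<in>sources j. M j k * (LBINT s:{0..t}. sol \<phi> k s))"
proof -
  have "(LBINT s:{1 / c j..t + 1 / c j}. sol \<phi> j s) = (LBINT s:{0..t}. sol \<phi> j (1 / c j + 1 * s))"
    using set_integral_shift_scale[of 1 0 t "sol \<phi> j" "1 / c j"] by (simp add: add.commute)
  also have "\<dots> = (LINT s|lborel. (\<Sum>k\<in>sources j. M j k * (indicator {0..t} s *\<^sub>R sol \<phi> k s)))"
    unfolding set_lebesgue_integral_def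
  proof (rule Bochner_Integration.integral_cong[OF refl])
    fix s
    show "indicat_real {0..t} s *\<^sub>R sol \<phi> j (1 / c j + 1 * s) = (\<Sum>k\<in>sources j. M j k * indicat_real {0..t} s *\<^sub>R sol \<phi> k s)"
      using sol_delay[OF j, of s \<phi>] by (cases "s \<in> {0..t}") (auto simp: add.commute)
  qed
  also have "\<dots> = (\<Sum>k\<in>sources j. M j k * (LBINT s:{0..t}. sol \<phi> k s))"
  proof -
    have i: "integrable lborel (\<lambda>s. indicator {0..t} s *\<^sub>R sol \<phi> k s)" if "k \<in> sources j" for k
      using sol_integrable[OF m B, of k 0 t] sources that by (simp add: set_integrable_def)
    show ?thesis
      unfolding set_lebesgue_integral_def
      by (subst Bochner_Integration.integral_sum)
        (intro integrable_mult_right i sum.cong refl integral_mult_right_zero; assumption)+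
  qed
  finally show ?thesis .
qed

text \<open>
  If the initial values are primitives and satisfy the boundary condition, so that no jump enters
  the system, then the solution is a primitive, and its derivative solves the system as well.
\<close>

lemma sol_primitive:
  assumes prim: "\<And>j. j \<in> J \<Longrightarrow> primitive_on 1 (\<phi> j) (\<psi> j)"
    and compat: "\<And>j. j \<in> J \<Longrightarrow> \<phi> j 1 = (\<Sum>k\<in>sources j. M j k * \<phi> k 0)"
    and m: "\<And>j. j \<in> J \<Longrightarrow> \<psi> j \<in> borel_measurable borel"
    and B: "data_bound (\<lambda>j x. c j *\<^sub>R \<psi> j x) B" and j: "j \<in> J"
  shows "primitive_on T (sol \<phi> j) (sol (\<lambda>j x. c j *\<^sub>R \<psi> j x) j)"
proof -
  let ?\<psi> = "\<lambda>j x. c j *\<^sub>R \<psi> j x"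
  have m': "?\<psi> j \<in> borel_measurable borel" if "j \<in> J" for j
    using m[OF that] by measurable
  have init0: "sol \<phi> j 0 = \<phi> j 0" if "j \<in> J" for j
    using that c_pos[OF that] by (simp add: sol_initial)
  have first: "(LBINT s:{0..t}. sol ?\<psi> j s) = \<phi> j (c j * t) - \<phi> j 0"
    if j: "j \<in> J" and t: "0 \<le> t" "t \<le> 1 / c j" for j t
  proof -
    have "c j * t \<in> {0..1}" using c_pos[OF j] t by (auto simp: field_simps)
    from primitive_onD(2)[OF prim[OF j] this]
    have "(LBINT x:{0..c j * t}. \<psi> j x) = \<phi> j (c j * t) - \<phi> j 0" by simp
    moreover have "(LBINT x:{0..c j * t}. ?\<psi> j x) = c j *\<^sub>R (LBINT x:{0..c j * t}. \<psi> j x)"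
      by (rule set_integral_scaleR_right)
    ultimately show ?thesis
      using sol_integral_initial[of ?\<psi>, OF m'[OF j] m' j t] c_pos[OF j] by simp
  qed
  have main: "sol \<phi> j t = sol \<phi> j 0 + (LBINT s:{0..t}. sol ?\<psi> j s)" if "j \<in> J" "0 \<le> t" "t * cmax < real n" for n j t
    using that
  proof (induction n arbitrary: j t)
    case 0
    then show ?case using time_nonneg[of j t] by simp
  next
    case (Suc n)
    note j = Suc.prems(1)
    show ?case
    proof (cases "t < 1 / c j")
      case True
      then show ?thesis using Suc.prems first[OF j, of t] by (simp add: sol_initial init0)
    next
      case False
      define s where "s = t - 1 / c j"
      have s: "0 \<le> s" "t = s + 1 / c j" using False by (auto simp: s_def)
      have "s * cmax \<le> t * cmax - 1"
        using delay_ge[OF j] by (simp add: s_def left_diff_distrib)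
      then have IH: "sol \<phi> k s = \<phi> k 0 + (LBINT r:{0..s}. sol ?\<psi> k r)" if "k \<in> sources j" for k
        using Suc.IH[of k s] Suc.prems s that sources init0 by auto
      have "sol \<phi> j t = (\<Sum>k\<in>sources j. M j k * (\<phi> k 0 + (LBINT r:{0..s}. sol ?\<psi> k r)))"
        unfolding s(2) using sol_delay[OF j s(1)] IH by simp
      also have "\<dots> = \<phi> j 1 + (LBINT r:{1 / c j..t}. sol ?\<psi> j r)"
      proof -
        have "(LBINT r:{1 / c j..t}. sol ?\<psi> j r) = (\<Sum>k\<in>sources j. M j k * (LBINT r:{0..s}. sol ?\<psi> k r))"
          unfolding s(2) by (rule sol_integral_delay[OF m' B j s(1)])
        then show ?thesis unfolding compat[OF j] by (simp add: distrib_left sum.distrib)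
      qed
      also have "\<phi> j 1 = \<phi> j 0 + (LBINT r:{0..1 / c j}. sol ?\<psi> j r)"
        using first[OF j, of "1 / c j"] c_pos[OF j] by simp
      finally have "sol \<phi> j t = \<phi> j 0 + ((LBINT r:{0..1 / c j}. sol ?\<psi> j r) + (LBINT r:{1 / c j..t}. sol ?\<psi> j r))"
        by (simp add: add.assoc)
      also have "(LBINT r:{0..1 / c j}. sol ?\<psi> j r) + (LBINT r:{1 / c j..t}. sol ?\<psi> j r) = (LBINT r:{0..t}. sol ?\<psi> j r)"
        using False c_pos[OF j] by (intro set_integral_split[symmetric] sol_integrable[OF m' B j]) auto
      finally show ?thesis by (simp add: init0 j)
    qed
  qed
  show ?thesis
    unfolding primitive_on_def
  proof (intro conjI)
    show "set_borel_measurable borel {0..T} (sol ?\<psi> j)"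
      using sol_measurable[of ?\<psi> j] m' j by (simp add: set_borel_measurable_def)
    show "\<exists>N. \<forall>s\<in>{0..T}. norm (sol ?\<psi> j s) \<le> N"
      using norm_sol_le[OF B j] by (intro exI[of _ "B * sol_const T"]) auto
    show "\<forall>x\<in>{0..T}. sol \<phi> j x = sol \<phi> j 0 + (LBINT s:{0..x}. sol ?\<psi> j s)"
    proof
      fix x assume "x \<in> {0..T}"
      then have "0 \<le> x" by simp
      show "sol \<phi> j x = sol \<phi> j 0 + (LBINT s:{0..x}. sol ?\<psi> j s)"
        by (rule main[OF j \<open>0 \<le> x\<close> steps_gt[OF \<open>0 \<le> x\<close>]])
    qed
  qed
qed

text \<open>
  Weak convergence of the data propagates through the system, because each edge is fed by finitely
  many edges. Equi-Lipschitz continuity of the primitives makes it uniform in time, which is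
  expressed here by times \<open>t n\<close> that vary with \<open>n\<close>.
\<close>

lemma sol_integral_tendsto_0:
  assumes m: "\<And>n j. j \<in> J \<Longrightarrow> \<phi> n j \<in> borel_measurable borel" and B: "\<And>n. data_bound (\<phi> n) B"
    and lim: "\<And>j x. j \<in> J \<Longrightarrow> x \<in> {0..1} \<Longrightarrow> (\<lambda>n. LBINT s:{0..x}. \<phi> n j s) \<longlonglongrightarrow> 0"
    and j: "j \<in> J" and t: "\<And>n. 0 \<le> t n \<and> t n \<le> T"
  shows "(\<lambda>n. LBINT s:{0..t n}. sol (\<phi> n) j s) \<longlonglongrightarrow> 0"
proof -
  have first: "(\<lambda>n. LBINT s:{0..t}. sol (\<phi> n) j s) \<longlonglongrightarrow> 0" if j: "j \<in> J" and t: "0 \<le> t" "t \<le> 1 / c j" for j t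
  proof -
    have "(LBINT s:{0..t}. sol (\<phi> n) j s) = (1 / c j) *\<^sub>R (LBINT x:{0..c j * t}. \<phi> n j x)" for n
      using m j t by (intro sol_integral_initial) auto
    moreover have "(\<lambda>n. (1 / c j) *\<^sub>R (LBINT x:{0..c j * t}. \<phi> n j x)) \<longlonglongrightarrow> (1 / c j) *\<^sub>R 0"
      using c_pos[OF j] t by (intro tendsto_intros lim[OF j]) (auto simp: field_simps)
    ultimately show ?thesis by simp
  qed
  have pointwise: "(\<lambda>n. LBINT s:{0..t}. sol (\<phi> n) j s) \<longlonglongrightarrow> 0" if "j \<in> J" "0 \<le> t" "t * cmax < real N" for N j t
    using that
  proof (induction N arbitrary: j t)
    case 0
    then show ?case using time_nonneg[of j t] by simp
  next
    case (Suc N)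
    note j = Suc.prems(1)
    show ?case
    proof (cases "t < 1 / c j")
      case True
      then show ?thesis using Suc.prems by (intro first) auto
    next
      case False
      define s where "s = t - 1 / c j"
      have s: "0 \<le> s" "t = s + 1 / c j" using False by (auto simp: s_def)
      have "s * cmax \<le> t * cmax - 1"
        using delay_ge[OF j] by (simp add: s_def left_diff_distrib)
      then have "(\<lambda>n. LBINT r:{0..s}. sol (\<phi> n) k r) \<longlonglongrightarrow> 0" if "k \<in> sources j" for k
        using Suc.prems s that sources by (intro Suc.IH) auto
      then have "(\<lambda>n. (LBINT r:{0..1 / c j}. sol (\<phi> n) j r) + (\<Sum>k\<in>sources j. M j k * (LBINT r:{0..s}. sol (\<phi> n) k r)))
          \<longlonglongrightarrow> 0 + (\<Sum>k\<in>sources j. M j k * 0)"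
        using c_pos[OF j] by (intro tendsto_intros first[OF j]) auto
      moreover have "(LBINT r:{0..t}. sol (\<phi> n) j r)
          = (LBINT r:{0..1 / c j}. sol (\<phi> n) j r) + (\<Sum>k\<in>sources j. M j k * (LBINT r:{0..s}. sol (\<phi> n) k r))" for n
      proof -
        have "(LBINT r:{0..t}. sol (\<phi> n) j r) = (LBINT r:{0..1 / c j}. sol (\<phi> n) j r) + (LBINT r:{1 / c j..t}. sol (\<phi> n) j r)"
          using False c_pos[OF j] by (intro set_integral_split sol_integrable[OF m B j]) auto
        moreover have "(LBINT r:{1 / c j..t}. sol (\<phi> n) j r) = (\<Sum>k\<in>sources j. M j k * (LBINT r:{0..s}. sol (\<phi> n) k r))"
          unfolding s(2) by (rule sol_integral_delay[OF m B j s(1)])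
        ultimately show ?thesis by simp
      qed
      ultimately show ?thesis by simp
    qed
  qed
  define P where "P n t = (LBINT s:{0..t}. sol (\<phi> n) j s)" for n t
  define L where "L = B * sol_const T + 1"
  have L: "0 < L" using B[of 0] sol_const_nonneg[of T] by (auto simp: L_def data_bound_def intro: add_nonneg_pos)
  have lip: "norm (P n y - P n x) \<le> L * (y - x)" if "0 \<le> x" "x \<le> y" "y \<le> T" for n x y
  proof -
    have "P n y - P n x = (LBINT s:{x..y}. sol (\<phi> n) j s)"
      unfolding P_def using set_integral_split[OF sol_integrable[OF m B j, of 0 y n], of x] that by simp
    also have "norm \<dots> \<le> L * (y - x)"
    proof (rule norm_set_integral_le)
      show "set_integrable lborel {x..y} (sol (\<phi> n) j)" using that by (intro sol_integrable[OF m B j])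
      show "norm (sol (\<phi> n) j s) \<le> L" if "s \<in> {x..y}" for s
        using norm_sol_le[OF B j, of s T n] that \<open>0 \<le> x\<close> \<open>y \<le> T\<close> by (auto simp: L_def)
    qed (use that in auto)
    finally show ?thesis .
  qed
  show ?thesis
    unfolding P_def[symmetric]
  proof (rule tendstoI)
    fix e :: real assume e: "0 < e"
    \<comment> \<open>a grid so fine that the primitives change by at most \<open>e / 2\<close> between its points\<close>
    define h where "h = e / (2 * L)"
    have h: "0 < h" using e L by (simp add: h_def)
    define K where "K = nat \<lfloor>T / h\<rfloor>"
    have "\<forall>\<^sub>F n in sequentially. \<forall>i\<in>{..K}. norm (P n (real i * h)) < e / 2"
    proof (rule eventually_ball_finite)
      show "\<forall>i\<in>{..K}. \<forall>\<^sub>F n in sequentially. norm (P n (real i * h)) < e / 2"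
      proof
        fix i
        have "0 \<le> real i * h" using h by simp
        from pointwise[OF j this steps_gt[OF this]] have "(\<lambda>n. P n (real i * h)) \<longlonglongrightarrow> 0"
          by (simp add: P_def)
        from tendstoD[OF this, of "e / 2"] show "\<forall>\<^sub>F n in sequentially. norm (P n (real i * h)) < e / 2"
          using e by simp
      qed
    qed simp
    then show "\<forall>\<^sub>F n in sequentially. dist (P n (t n)) 0 < e"
    proof eventually_elim
      case (elim n)
      define i where "i = nat \<lfloor>t n / h\<rfloor>"
      have tn: "0 \<le> t n" "t n \<le> T" using t by auto
      have "t n / h \<le> T / h" using tn h by (simp add: divide_right_mono)
      then have "i \<le> K" unfolding i_def K_def by (intro nat_mono floor_mono)
      have "real i \<le> t n / h" "t n / h < real i + 1"
        using tn h unfolding i_def by (auto simp: of_nat_floor)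
      then have i: "real i * h \<le> t n" "t n - real i * h \<le> h"
        using h by (auto simp: field_simps)
      have "norm (P n (t n) - P n (real i * h)) \<le> L * (t n - real i * h)"
        using i h tn by (intro lip) auto
      also have "\<dots> \<le> L * h" using i L by (intro mult_left_mono) auto
      also have "\<dots> = e / 2" using L by (simp add: h_def)
      finally have "norm (P n (t n) - P n (real i * h)) \<le> e / 2" .
      moreover have "norm (P n (real i * h)) < e / 2" using elim \<open>i \<le> K\<close> by auto
      ultimately show ?case
        using norm_triangle_ineq[of "P n (t n) - P n (real i * h)" "P n (real i * h)"] by simp
    qed
  qed
qed

end

section \<open>The flow on the network\<close>

text \<open>The retraction of the line onto \<open>[0,1]\<close>; it extends functions on the edges to the line.\<close>

definition clip :: "real \<Rightarrow> real"
  where "clip x = max 0 (min 1 x)"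

lemma clip [simp]: "x \<in> {0..1} \<Longrightarrow> clip x = x" "clip x \<in> {0..1}" "0 \<le> clip x" "clip x \<le> 1" "clip 0 = 0" "clip 1 = 1"
  by (auto simp: clip_def)

lemma continuous_on_clip: "continuous_on {0..1} f \<Longrightarrow> continuous_on UNIV (\<lambda>x. f (clip x))"
  by (rule continuous_on_compose2[of "{0..1}" f UNIV clip]) (auto simp: clip_def[abs_def] intro!: continuous_intros)

text \<open>
  The transport problem with coefficients \<open>q\<close> and boundary matrix \<open>Bm\<close>. The functions \<open>qh j\<close> are
  Borel versions of the coordinates of \<open>q\<close> that are bounded everywhere.
\<close>

locale network_flow =
  fixes J :: "nat set" and c :: "nat \<Rightarrow> real" and cmin cmax mB :: real
    and Bm :: "nat \<Rightarrow> nat \<Rightarrow> real"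
    and q :: "real \<Rightarrow> nat \<Rightarrow>\<^sub>C 'k::{real_normed_field, banach, second_countable_topology}"
    and qh :: "nat \<Rightarrow> real \<Rightarrow> 'k" and Mq :: real
  assumes speed_min: "0 < cmin" and speed_bounds: "\<And>j. j \<in> J \<Longrightarrow> cmin \<le> c j \<and> c j \<le> cmax"
    and speeds_finite: "finite (c ` J)"
    and rows_finite: "\<And>j. j \<in> J \<Longrightarrow> finite {k \<in> J. Bm j k \<noteq> 0}"
    and mB_nonneg: "0 \<le> mB"
    and column_sums_Bm: "\<And>k F. k \<in> J \<Longrightarrow> finite F \<Longrightarrow> F \<subseteq> J \<Longrightarrow> (\<Sum>j\<in>F. \<bar>Bm j k\<bar>) \<le> mB"
    and qh_measurable [measurable]: "\<And>j. qh j \<in> borel_measurable borel"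
    and Mq_nonneg: "0 \<le> Mq" and qh_bound: "\<And>j s. norm (qh j s) \<le> Mq"
    and qh_eq: "AE s in unit_interval. \<forall>j\<in>J. apply_bcontfun (q s) j = qh j s"
begin

text \<open>
  The integrating factor \<open>Q\<^sub>j\<close> solves \<open>c\<^sub>j Q\<^sub>j' = q\<^sub>j Q\<^sub>j\<close>. Multiplication by it removes the
  absorption term, at the price of a factor in the boundary matrix, which becomes \<open>M\<close>. Clipping the
  argument makes it continuous on the whole line. \<open>CQ\<close> bounds the factor and its inverse.
\<close>

definition rate :: "nat \<Rightarrow> real \<Rightarrow> 'k"
  where "rate j s = (1 / c j) *\<^sub>R qh j s"

definition Q :: "nat \<Rightarrow> real \<Rightarrow> 'k"
  where "Q j x = exp (LBINT s:{0..clip x}. rate j s)"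

definition CQ :: real
  where "CQ = exp (Mq / cmin)"

definition M :: "nat \<Rightarrow> nat \<Rightarrow> 'k"
  where "M j k = Q j 1 * of_real (Bm j k)"

lemma Q_nonzero [simp]: "Q j x \<noteq> 0"
  by (simp add: Q_def)

lemma Q_0 [simp]: "Q j 0 = 1"
  by (simp add: Q_def)

lemma CQ_pos: "0 < CQ"
  by (simp add: CQ_def)

lemma speed_pos: "j \<in> J \<Longrightarrow> 0 < c j"
  using speed_min speed_bounds[of j] by linarith

lemma rate_measurable [measurable]: "rate j \<in> borel_measurable borel"
  unfolding rate_def[abs_def] by measurable

lemma rate_bound: "j \<in> J \<Longrightarrow> norm (rate j s) \<le> Mq / cmin"
  using qh_bound[of j s] speed_bounds[of j] speed_min speed_pos[of j] Mq_nonneg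
  by (auto simp: rate_def intro!: frac_le)

lemma primitive_rate: "j \<in> J \<Longrightarrow> primitive_on 1 (\<lambda>x. LBINT s:{0..x}. rate j s) (rate j)"
  using primitive_on_integral[of "rate j" 1 "Mq / cmin" 0] rate_bound by simp

lemma primitive_Q: "j \<in> J \<Longrightarrow> primitive_on 1 (Q j) (\<lambda>x. rate j x * Q j x)"
  by (rule primitive_on_cong[OF primitive_on_exp[OF primitive_rate]]) (auto simp: Q_def)

lemma primitive_inverse_Q: "j \<in> J \<Longrightarrow> primitive_on 1 (\<lambda>x. inverse (Q j x)) (\<lambda>x. - rate j x * inverse (Q j x))"
proof -
  assume j: "j \<in> J"
  have "primitive_on 1 (\<lambda>x. 0 + (LBINT s:{0..x}. - rate j s)) (\<lambda>s. - rate j s)"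
    using rate_bound[OF j] by (intro primitive_on_integral) auto
  then have "primitive_on 1 (\<lambda>x. - (LBINT s:{0..x}. rate j s)) (\<lambda>s. - rate j s)"
    by (simp add: set_lebesgue_integral_def)
  from primitive_on_exp[OF this] show ?thesis
    by (rule primitive_on_cong) (auto simp: Q_def exp_minus)
qed

lemma Q_bound:
  assumes j: "j \<in> J"
  shows "norm (Q j x) \<le> CQ" "norm (inverse (Q j x)) \<le> CQ"
proof -
  have "norm (LBINT s:{0..clip x}. rate j s) \<le> Mq / cmin * (clip x - 0)"
    using j rate_bound by (intro norm_set_integral_le primitive_on_integrable[OF primitive_rate]) auto
  also have "\<dots> \<le> Mq / cmin"
    using mult_left_mono[of "clip x" 1 "Mq / cmin"] Mq_nonneg speed_min by simp
  finally have *: "norm (LBINT s:{0..clip x}. rate j s) \<le> Mq / cmin" .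
  then show "norm (Q j x) \<le> CQ"
    unfolding Q_def CQ_def by (intro order_trans[OF norm_exp]) simp
  have "norm (exp (- (LBINT s:{0..clip x}. rate j s))) \<le> CQ"
    using * unfolding CQ_def by (intro order_trans[OF norm_exp]) simp
  then show "norm (inverse (Q j x)) \<le> CQ" by (simp add: Q_def exp_minus)
qed

lemma Q_measurable: "j \<in> J \<Longrightarrow> Q j \<in> borel_measurable borel"
proof -
  assume "j \<in> J"
  then have "continuous_on {0..1} (\<lambda>x. exp (LBINT s:{0..x}. rate j s))"
    by (intro continuous_intros primitive_on_continuous[OF primitive_rate])
  from borel_measurable_continuous_onI[OF continuous_on_clip[OF this]] show ?thesis
    by (simp add: Q_def[abs_def])
qed

sublocale delay_system J c cmin cmax "CQ * mB" M
proof
  show "finite {k \<in> J. M j k \<noteq> 0}" if "j \<in> J" for j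
    using rows_finite[OF that] by (simp add: M_def)
  show "0 \<le> CQ * mB" using CQ_pos mB_nonneg by simp
  show "(\<Sum>j\<in>F. norm (M j k)) \<le> CQ * mB" if "k \<in> J" "finite F" "F \<subseteq> J" for k F
  proof -
    have "(\<Sum>j\<in>F. norm (M j k)) \<le> (\<Sum>j\<in>F. CQ * \<bar>Bm j k\<bar>)"
      using that Q_bound(1) by (intro sum_mono) (auto simp: M_def norm_mult intro!: mult_right_mono)
    also have "\<dots> \<le> CQ * mB"
      using column_sums_Bm[OF that] CQ_pos by (simp add: sum_distrib_left[symmetric])
    finally show ?thesis .
  qed
qed (use speed_min speed_bounds speeds_finite in auto)

lemma sum_sources:
  assumes "j \<in> J"
  shows "(\<Sum>k\<in>sources j. M j k * z k) = Q j 1 * (\<Sum>\<^sub>\<infinity>k\<in>J. Bm j k *\<^sub>R z k)"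
proof -
  have "(\<Sum>\<^sub>\<infinity>k\<in>J. Bm j k *\<^sub>R z k) = (\<Sum>\<^sub>\<infinity>k\<in>sources j. Bm j k *\<^sub>R z k)"
    by (rule infsum_cong_neutral) (auto simp: sources_def M_def)
  also have "\<dots> = (\<Sum>k\<in>sources j. Bm j k *\<^sub>R z k)"
    using sources(1)[OF assms] by (rule infsum_finite)
  finally show ?thesis
    by (simp add: sum_distrib_left M_def scaleR_conv_of_real mult.assoc)
qed

abbreviation X :: "(real \<Rightarrow> 'k ell1) set"
  where "X \<equiv> bochner_Linf (ell1_on J)"

abbreviation D :: "(real \<Rightarrow> 'k ell1) set"
  where "D \<equiv> flow_domain J Bm"

abbreviation A :: "(real \<Rightarrow> 'k ell1) \<Rightarrow> real \<Rightarrow> 'k ell1"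
  where "A \<equiv> flow_operator J c q"

lemma domainE:
  assumes "f \<in> D"
  obtains g where "f \<in> X" "weak_derivative (ell1_on J) f \<in> X"
    "is_weak_derivative f (weak_derivative (ell1_on J) f)" "is_continuous_rep f g"
    "\<And>j. j \<in> J \<Longrightarrow> coord (g 1) j = (\<Sum>\<^sub>\<infinity>k\<in>J. Bm j k *\<^sub>R coord (g 0) k)"
proof -
  obtain g d where f: "f \<in> X" and g: "is_continuous_rep f g"
    "\<forall>j\<in>J. coord (g 1) j = (\<Sum>\<^sub>\<infinity>k\<in>J. Bm j k *\<^sub>R coord (g 0) k)"
    and d: "d \<in> X" "is_weak_derivative f d"
    using assms unfolding flow_domain_def W1inf_def by blast
  have "weak_derivative (ell1_on J) f \<in> X \<and> is_weak_derivative f (weak_derivative (ell1_on J) f)"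
    using someI[of "\<lambda>d. d \<in> X \<and> is_weak_derivative f d" d] d by (simp add: weak_derivative_def)
  with f g that show ?thesis by blast
qed

lemma coord_flow_operator:
  assumes f: "f \<in> X" and d: "weak_derivative (ell1_on J) f \<in> X"
  shows "AE s in unit_interval. \<forall>j\<in>J. coord (A f s) j
      = c j *\<^sub>R coord (weak_derivative (ell1_on J) f s) j + qh j s * coord (f s) j"
  using qh_eq
proof eventually_elim
  case (elim s)
  let ?x = "\<lambda>j. if j \<in> J then c j *\<^sub>R coord (weak_derivative (ell1_on J) f s) j + apply_bcontfun (q s) j * coord (f s) j else 0"
  have "(\<Sum>j\<in>F. norm (?x j)) \<le> \<bar>cmax\<bar> * norm (weak_derivative (ell1_on J) f s) + Mq * norm (f s)" if F: "finite F" for F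
  proof -
    have "(\<Sum>j\<in>F. norm (?x j)) \<le> (\<Sum>j\<in>F. \<bar>cmax\<bar> * norm (coord (weak_derivative (ell1_on J) f s) j) + Mq * norm (coord (f s) j))"
    proof (rule sum_mono)
      fix j
      show "norm (?x j) \<le> \<bar>cmax\<bar> * norm (coord (weak_derivative (ell1_on J) f s) j) + Mq * norm (coord (f s) j)"
      proof (cases "j \<in> J")
        case True
        then have "norm (?x j) \<le> norm (c j *\<^sub>R coord (weak_derivative (ell1_on J) f s) j) + norm (qh j s * coord (f s) j)"
          using elim norm_triangle_ineq[of "c j *\<^sub>R coord (weak_derivative (ell1_on J) f s) j" "qh j s * coord (f s) j"]
          by simp
        also have "\<dots> \<le> \<bar>cmax\<bar> * norm (coord (weak_derivative (ell1_on J) f s) j) + Mq * norm (coord (f s) j)"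
          using True speed_pos[OF True] speed_bounds[OF True] qh_bound[of j s]
          by (intro add_mono) (auto simp: norm_mult intro!: mult_right_mono)
        finally show ?thesis .
      qed (simp add: Mq_nonneg)
    qed
    also have "\<dots> \<le> \<bar>cmax\<bar> * norm (weak_derivative (ell1_on J) f s) + Mq * norm (f s)"
      unfolding sum.distrib sum_distrib_left[symmetric]
      by (intro add_mono mult_left_mono sum_coord_le_norm F) (auto simp: Mq_nonneg)
    finally show ?thesis .
  qed
  from coord_Abs_ell1(1)[of ?x, OF this] have "coord (A f s) = ?x"
    by (simp only: flow_operator_def)
  with elim show ?case by auto
qed

text \<open>
  Along a solution, the weighted coordinates \<open>Q\<^sub>j u\<^sub>j\<close> have the weighted coordinates of the time
  derivative as their space derivative, up to the factor \<open>c\<^sub>j\<close>.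
\<close>

lemma primitive_weighted_coord:
  assumes f: "f \<in> D" and rep: "is_continuous_rep f g" and h: "h \<in> X" "AE s in unit_interval. h s = A f s"
    and h': "h' \<in> borel_measurable borel" "\<And>s. norm (h' s) \<le> N" "AE s in unit_interval. coord (h s) j = h' s"
    and j: "j \<in> J"
  shows "primitive_on 1 (\<lambda>x. Q j x * coord (g x) j) (\<lambda>x. (1 / c j) *\<^sub>R (Q j x * h' x))"
proof -
  let ?d = "weak_derivative (ell1_on J) f"
  have fX: "f \<in> X" and d: "?d \<in> X" "is_weak_derivative f ?d"
    using domainE[OF f] by metis+
  obtain K where K: "0 \<le> K" "AE s in unit_interval. norm (?d s) \<le> K" using bochner_Linf_bound[OF d(1)] by blast
  obtain d' where d': "d' \<in> borel_measurable borel" "AE s in unit_interval. coord (?d s) j = d' s" "\<And>s. norm (d' s) \<le> K"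
    using bounded_coord_rep[OF d(1) K] by blast
  have "primitive_on 1 (\<lambda>x. coord (g x) j) d'"
    using coord_primitive_of_weak_derivative[OF fX d rep d'(1) d'(3) d'(2)] .
  from primitive_on_bilinear[OF bounded_bilinear_mult primitive_Q[OF j] this]
  have p: "primitive_on 1 (\<lambda>x. Q j x * coord (g x) j) (\<lambda>x. rate j x * Q j x * coord (g x) j + Q j x * d' x)" .
  show ?thesis
  proof (rule primitive_on_cong_AE[OF p])
    show "(\<lambda>x. (1 / c j) *\<^sub>R (Q j x * h' x)) \<in> borel_measurable borel"
      using Q_measurable[OF j] h'(1) by measurable
    show "norm ((1 / c j) *\<^sub>R (Q j s * h' s)) \<le> (1 / c j) * (CQ * N)" for s
      using speed_pos[OF j] Q_bound(1)[OF j, of s] h'(2)[of s] CQ_pos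
      by (auto simp: norm_mult intro!: divide_right_mono mult_mono)
    have "AE s in unit_interval. f s = g s" using rep by (simp add: is_continuous_rep_def)
    then show "AE s in unit_interval. rate j s * Q j s * coord (g s) j + Q j s * d' s = (1 / c j) *\<^sub>R (Q j s * h' s)"
      using coord_flow_operator[OF fX d(1)] h(2) h'(3) d'(2)
    proof eventually_elim
      case (elim s)
      then have "h' s = c j *\<^sub>R d' s + qh j s * coord (g s) j" using j by metis
      then show ?case
        using speed_pos[OF j] by (simp add: rate_def scaleR_conv_of_real field_simps)
    qed
  qed
qed

lemma initial_data_measurable:
  assumes "continuous_on {0..1} g" "j \<in> J"
  shows "(\<lambda>x. Q j x * coord (g (clip x)) j) \<in> borel_measurable borel"
  using Q_measurable[OF assms(2)]
    borel_measurable_continuous_onI[OF continuous_on_clip[OF continuous_on_coord[OF assms(1)]]]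
  by (rule borel_measurable_times)

lemma LINT_weighted_coord:
  assumes f: "f \<in> X" and h: "h \<in> borel_measurable borel" "AE s in unit_interval. Q j s * coord (f s) j = h s"
    and j: "j \<in> J" and x: "x \<in> {0..1}"
  shows "(LINT s|unit_interval. indicator {0..x} s *\<^sub>R (Q j s * coord (f s) j)) = (LBINT s:{0..x}. h s)"
proof -
  have mc: "(\<lambda>s. coord (f s) j) \<in> borel_measurable unit_interval"
    using f by (intro borel_measurable_coord strongly_measurable_imp_borel_measurable) (auto simp: bochner_Linf_def)
  have mi: "(\<lambda>s. indicator {0..x} s :: real) \<in> borel_measurable unit_interval"
    by (intro borel_measurable_unit_interval borel_measurable_indicator) simp
  have "(LINT s|unit_interval. indicator {0..x} s *\<^sub>R (Q j s * coord (f s) j)) = (LINT s|unit_interval. indicator {0..x} s *\<^sub>R h s)"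
  proof (rule integral_cong_AE)
    show "(\<lambda>s. indicat_real {0..x} s *\<^sub>R (Q j s * coord (f s) j)) \<in> borel_measurable unit_interval"
      by (intro borel_measurable_scaleR mi borel_measurable_times mc borel_measurable_unit_interval Q_measurable j)
    show "(\<lambda>s. indicat_real {0..x} s *\<^sub>R h s) \<in> borel_measurable unit_interval"
      by (intro borel_measurable_scaleR mi borel_measurable_unit_interval h(1))
    show "AE s in unit_interval. indicat_real {0..x} s *\<^sub>R (Q j s * coord (f s) j) = indicat_real {0..x} s *\<^sub>R h s"
      using h(2) by eventually_elim simp
  qed
  also have "\<dots> = (LBINT s:{0..x}. h s)"
    using h(1) x by (intro set_LINT_unit_interval_prefix) (auto simp: set_borel_measurable_def)
  finally show ?thesis .
qed

text \<open>
  Every solution is given by the delay system. The weak* time derivative is tested with the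
  indicators of \<open>[0,b]\<close>, weighted by \<open>Q\<^sub>j\<close>, on one edge; this yields the transport equation for
  \<open>v = Q\<^sub>j u\<^sub>j\<close> in integrated form, hence \<open>v(x,t) = v(0, t + x/c\<^sub>j)\<close>. The values \<open>v(0,\<cdot>)\<close> then
  solve the delay system.
\<close>

theorem solution_along_characteristics:
  assumes sol_u: "is_solution (weak_star J) D A f u" and f: "is_continuous_rep f g0"
    and t: "0 \<le> t"
  shows "AE x in unit_interval. \<forall>j\<in>J.
    Q j x * coord (u t x) j = sol (\<lambda>j x. Q j x * coord (g0 (clip x)) j) j (t + x / c j)"
proof -
  obtain u' where u: "u \<in> B_loc X" "\<And>t. 0 \<le> t \<Longrightarrow> u t \<in> D" "AE s in unit_interval. u 0 s = f s"
    and u': "u' \<in> B_loc X" "has_C1_derivative (weak_star J) u u'"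
      "\<And>t. 0 \<le> t \<Longrightarrow> AE s in unit_interval. u' t s = A (u t) s"
    using sol_u unfolding is_solution_def by auto
  have uX: "u t \<in> X" "u' t \<in> X" if "0 \<le> t" for t using u(1) u'(1) that by (auto simp: B_loc_def)
  have "\<exists>g. is_continuous_rep (u t) g \<and> (\<forall>j\<in>J. coord (g 1) j = (\<Sum>\<^sub>\<infinity>k\<in>J. Bm j k *\<^sub>R coord (g 0) k))" if "0 \<le> t" for t
    using domainE[OF u(2)[OF that]] by metis
  then obtain G where G: "\<And>t. 0 \<le> t \<Longrightarrow> is_continuous_rep (u t) (G t)"
    "\<And>t j. 0 \<le> t \<Longrightarrow> j \<in> J \<Longrightarrow> coord (G t 1) j = (\<Sum>\<^sub>\<infinity>k\<in>J. Bm j k *\<^sub>R coord (G t 0) k)"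
    by metis
  have contG: "continuous_on {0..1} (G t)" and aeG: "AE s in unit_interval. u t s = G t s" if "0 \<le> t" for t
    using G(1)[OF that] by (auto simp: is_continuous_rep_def)
  have u'_bound: "\<exists>N\<ge>0. \<forall>t\<in>{0..T}. AE s in unit_interval. norm (u' t s) \<le> N" for T
  proof -
    have "\<exists>N::real. \<forall>t\<in>{0..T}. ess_norm (u' t) \<le> ennreal N"
      using u'(1) unfolding B_loc_def by (auto simp del: atLeastAtMost_iff)
    then obtain N :: real where N: "\<And>t. t \<in> {0..T} \<Longrightarrow> ess_norm (u' t) \<le> ennreal N" by blast
    have "AE s in unit_interval. norm (u' t s) \<le> max N 0" if t: "t \<in> {0..T}" for t
    proof -
      have "ess_norm (u' t) \<le> ennreal (max N 0)" using N[OF t] by (meson ennreal_leI max.cobounded1 order_trans)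
      then show ?thesis
        using ess_norm_le_iff[of "u' t" "max N 0"] uX(2)[of t] t by (auto simp: bochner_Linf_def)
    qed
    then show ?thesis by (intro exI[of _ "max N 0"]) auto
  qed
  have lim_quot: "limitin (weak_star J) (\<lambda>r s. (1 / (r - t)) *\<^sub>R (u r s - u t s)) (u' t) (at t within {0..})" if "0 \<le> t" for t
    using u'(2) that by (simp add: has_C1_derivative_def)
  have lim_u': "limitin (weak_star J) u' (u' t) (at t within {0..})" if "0 \<le> t" for t
    using u'(2) that unfolding has_C1_derivative_def continuous_map_top_of_set_iff by auto
  define v where "v j x t = Q j x * coord (G t x) j" for j x t
  have main: "v j x t = v j 0 (t + x / c j)" if j: "j \<in> J" and x: "x \<in> {0..<1}" and t: "0 \<le> t" for j x t
  proof -
    have cj: "0 < c j" by (rule speed_pos[OF j])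
    obtain N where N: "0 \<le> N" "\<And>r. r \<in> {0..t + x / c j} \<Longrightarrow> AE s in unit_interval. norm (u' r s) \<le> N"
      using u'_bound[of "t + x / c j"] by blast
    define L where "L = (1 / c j) * (CQ * N)"
    have L0: "0 \<le> L" using N(1) CQ_pos cj by (simp add: L_def)
    have lip: "norm (v j a r - v j b r) \<le> L * \<bar>a - b\<bar>" if "a \<in> {0..1}" "b \<in> {0..1}" "r \<in> {t..t + x / c j}" for a b r
    proof -
      have r: "0 \<le> r" "r \<in> {0..t + x / c j}" using that(3) t by auto
      obtain h' where h': "h' \<in> borel_measurable borel" "AE s in unit_interval. coord (u' r s) j = h' s" "\<And>s. norm (h' s) \<le> N"
        using bounded_coord_rep[OF uX(2)[OF r(1)] N(1) N(2)[OF r(2)]] by blast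
      have p: "primitive_on 1 (\<lambda>x. Q j x * coord (G r x) j) (\<lambda>x. (1 / c j) *\<^sub>R (Q j x * h' x))"
        by (rule primitive_weighted_coord[OF u(2)[OF r(1)] G(1)[OF r(1)] uX(2)[OF r(1)] u'(3)[OF r(1)] h'(1) h'(3) h'(2) j])
      show ?thesis
        unfolding v_def
      proof (rule primitive_on_lipschitz_bound[OF p _ that(1,2)])
        show "norm ((1 / c j) *\<^sub>R (Q j s * h' s)) \<le> L" for s
          using cj Q_bound(1)[OF j, of s] h'(3)[of s] CQ_pos
          by (auto simp: norm_mult L_def intro!: divide_right_mono mult_mono)
      qed
    qed
    define V where "V b r = (LBINT s:{0..b}. Q j s * coord (G r (clip s)) j)" for b r
    have V_eq: "V b r = (LBINT s:{0..b}. v j s r)" if "b \<in> {0..1}" for b r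
      unfolding V_def v_def using that by (intro set_lebesgue_integral_cong) auto
    define p where "p b s = indicator {0..b} s *\<^sub>R Q j s" for b s
    have p: "p b \<in> borel_measurable borel" "norm (p b s) \<le> CQ" for b s
      using Q_measurable[OF j] Q_bound(1)[OF j, of s] CQ_pos unfolding p_def[abs_def]
      by (measurable, auto simp: indicator_def)
    have pc: "coord z j * p b s = indicator {0..b} s *\<^sub>R (Q j s * coord z j)" for z b s
      by (simp add: p_def mult.commute)
    have V_int: "V b r = (LINT s|unit_interval. coord (u r s) j * p b s)" if "b \<in> {0..1}" "0 \<le> r" for b r
      unfolding pc V_def
    proof (rule LINT_weighted_coord[OF uX(1)[OF that(2)] _ _ j that(1), symmetric])
      show "(\<lambda>s. Q j s * coord (G r (clip s)) j) \<in> borel_measurable borel"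
        by (rule initial_data_measurable[OF contG[OF that(2)] j])
      show "AE s in unit_interval. Q j s * coord (u r s) j = Q j s * coord (G r (clip s)) j"
        using aeG[OF that(2)] unfolding AE_unit_interval_iff by eventually_elim auto
    qed
    have v_int: "c j *\<^sub>R (v j b r - v j 0 r) = (LINT s|unit_interval. coord (u' r s) j * p b s)" if b: "b \<in> {0..1}" and r: "0 \<le> r" for b r
    proof -
      obtain N where N: "0 \<le> N" "AE s in unit_interval. norm (u' r s) \<le> N"
        using bochner_Linf_bound[OF uX(2)[OF r]] by blast
      obtain h' where h': "h' \<in> borel_measurable borel" "AE s in unit_interval. coord (u' r s) j = h' s" "\<And>s. norm (h' s) \<le> N"
        using bounded_coord_rep[OF uX(2)[OF r] N] by blast
      have "primitive_on 1 (\<lambda>x. Q j x * coord (G r x) j) (\<lambda>x. (1 / c j) *\<^sub>R (Q j x * h' x))"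
        by (rule primitive_weighted_coord[OF u(2)[OF r] G(1)[OF r] uX(2)[OF r] u'(3)[OF r] h'(1) h'(3) h'(2) j])
      from primitive_onD(2)[OF this b]
      have "v j b r - v j 0 r = (LBINT s:{0..b}. (1 / c j) *\<^sub>R (Q j s * h' s))" by (simp add: v_def)
      also have "\<dots> = (1 / c j) *\<^sub>R (LBINT s:{0..b}. Q j s * h' s)" by (rule set_integral_scaleR_right)
      also have "(LBINT s:{0..b}. Q j s * h' s) = (LINT s|unit_interval. indicator {0..b} s *\<^sub>R (Q j s * coord (u' r s) j))"
      proof (rule LINT_weighted_coord[OF uX(2)[OF r] _ _ j b, symmetric])
        show "(\<lambda>s. Q j s * h' s) \<in> borel_measurable borel" using Q_measurable[OF j] h'(1) by (rule borel_measurable_times)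
        show "AE s in unit_interval. Q j s * coord (u' r s) j = Q j s * h' s" using h'(2) by eventually_elim simp
      qed
      finally show ?thesis using cj by (simp add: pc)
    qed
    show ?thesis
    proof (rule constant_along_characteristics[OF cj t x, where V = V and L = L])
      show "norm (V b r - V a r - (b - a) *\<^sub>R v j a r) \<le> L * (b - a)\<^sup>2"
        if "a \<in> {0..1}" "b \<in> {0..1}" "r \<in> {t..t + x / c j}" for a b r
        using lipschitz_integral_increment[of 1 "\<lambda>s. v j s r" L a b] lip that L0 by (simp add: V_eq)
      show "(V b has_vector_derivative c j *\<^sub>R (v j b r - v j 0 r)) (at r within {0..})" if b: "b \<in> {0..1}" and r: "0 \<le> r" for b r
        unfolding has_vector_derivative_iff_quotient v_int[OF b r]
      proof (rule Lim_transform_eventually[OF weak_star_limit_imp_coord[OF lim_quot[OF r] j p]])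
        have int: "integrable unit_interval (\<lambda>s. coord (u r s) j * p b s)" if r: "0 \<le> r" for r
        proof -
          obtain N where N: "0 \<le> N" "AE s in unit_interval. norm (u r s) \<le> N"
            using bochner_Linf_bound[OF uX(1)[OF r]] by blast
          have "AE s in unit_interval. norm (coord (u r s) j) \<le> N"
            using N(2) by eventually_elim (rule order_trans[OF norm_coord_le])
          moreover have "(\<lambda>s. coord (u r s) j) \<in> borel_measurable unit_interval"
            using uX(1)[OF r] by (intro borel_measurable_coord strongly_measurable_imp_borel_measurable) (auto simp: bochner_Linf_def)
          moreover have "integrable unit_interval (p b)"
            by (rule integrable_bounded_unit_interval[of _ CQ]) (use p in \<open>auto intro: borel_measurable_unit_interval\<close>)
          ultimately show ?thesis using integrable_mult_bounded(1) by (simp add: mult.commute)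
        qed
        have quot: "(LINT s|unit_interval. coord ((1 / (r' - r)) *\<^sub>R (u r' s - u r s)) j * p b s) = (1 / (r' - r)) *\<^sub>R (V b r' - V b r)"
          if "0 \<le> r'" for r'
        proof -
          have "V b r' - V b r = (LINT s|unit_interval. coord (u r' s) j * p b s - coord (u r s) j * p b s)"
            using int[OF r] int[OF that] V_int[OF b r] V_int[OF b that] by simp
          then have "(1 / (r' - r)) *\<^sub>R (V b r' - V b r)
              = (LINT s|unit_interval. (1 / (r' - r)) *\<^sub>R (coord (u r' s) j * p b s - coord (u r s) j * p b s))"
            by (simp only: integral_scaleR_right)
          then show ?thesis by (auto simp: left_diff_distrib)
        qed
        show "\<forall>\<^sub>F r' in at r within {0..}. (LINT s|unit_interval. coord ((1 / (r' - r)) *\<^sub>R (u r' s - u r s)) j * p b s)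
            = (1 / (r' - r)) *\<^sub>R (V b r' - V b r)"
          unfolding eventually_at_filter
        proof (intro always_eventually allI impI)
          fix r' :: real assume "r' \<in> {0..}"
          then have "0 \<le> r'" by simp
          then show "(LINT s|unit_interval. coord ((1 / (r' - r)) *\<^sub>R (u r' s - u r s)) j * p b s)
            = (1 / (r' - r)) *\<^sub>R (V b r' - V b r)" by (rule quot)
        qed
      qed
      show "((\<lambda>r'. v j b r' - v j 0 r') \<longlongrightarrow> v j b r - v j 0 r) (at r within {0..})" if b: "b \<in> {0..1}" and r: "0 \<le> r" for b r
      proof -
        have lim: "((\<lambda>r'. (1 / c j) *\<^sub>R (LINT s|unit_interval. coord (u' r' s) j * p b s)) \<longlongrightarrow>
            (1 / c j) *\<^sub>R (LINT s|unit_interval. coord (u' r s) j * p b s)) (at r within {0..})"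
          by (intro tendsto_intros weak_star_limit_imp_coord[OF lim_u'[OF r] j p])
        have "(1 / c j) *\<^sub>R (LINT s|unit_interval. coord (u' r' s) j * p b s) = v j b r' - v j 0 r'" if "0 \<le> r'" for r'
          using cj by (simp flip: v_int[OF b that])
        note eq = this
        have ev: "\<forall>\<^sub>F r' in at r within {0..}.
            (1 / c j) *\<^sub>R (LINT s|unit_interval. coord (u' r' s) j * p b s) = v j b r' - v j 0 r'"
          unfolding eventually_at_filter
        proof (intro always_eventually allI impI)
          fix r' :: real assume "r' \<in> {0..}"
          then have "0 \<le> r'" by simp
          then show "(1 / c j) *\<^sub>R (LINT s|unit_interval. coord (u' r' s) j * p b s) = v j b r' - v j 0 r'" by (rule eq)
        qed
        show ?thesis using Lim_transform_eventually[OF lim ev] unfolding eq[OF r] .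
      qed
    qed
  qed
  have cont_v: "continuous_on {0..1} (\<lambda>x. v j x t)" if "j \<in> J" "0 \<le> t" for j t
    unfolding v_def using primitive_on_continuous[OF primitive_Q[OF that(1)]] contG[OF that(2)]
    by (intro continuous_intros)
  have end_v: "v j 1 t = v j 0 (t + 1 / c j)" if j: "j \<in> J" and t: "0 \<le> t" for j t
  proof -
    have cj: "0 < c j" by (rule speed_pos[OF j])
    let ?r = "t + (1 / 2) / c j"
    have r: "0 \<le> ?r" using t cj by simp
    \<comment> \<open>the value at the end point is reached by a characteristic that starts in the middle of the edge\<close>
    have shift: "v j x t = v j (x - 1 / 2) ?r" if "x \<in> {1 / 2..<1}" for x
    proof -
      have "v j x t = v j 0 (t + x / c j)" using that by (intro main[OF j _ t]) auto
      also have "t + x / c j = ?r + (x - 1 / 2) / c j" by (simp add: diff_divide_distrib)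
      also have "v j 0 \<dots> = v j (x - 1 / 2) ?r"
        using that main[OF j _ r, of "x - 1 / 2"] by auto
      finally show ?thesis .
    qed
    have lim1: "((\<lambda>x. v j x t) \<longlongrightarrow> v j 1 t) (at 1 within {1 / 2..<1})"
      by (rule tendsto_within_subset[of _ _ 1 "{0..1}"]) (use cont_v[OF j t] in \<open>auto simp: continuous_on_def\<close>)
    have "continuous_on {1 / 2..1} (\<lambda>x. v j (x - 1 / 2) ?r)"
      by (rule continuous_on_compose2[OF cont_v[OF j r]]) (auto intro!: continuous_intros)
    then have "((\<lambda>x. v j (x - 1 / 2) ?r) \<longlongrightarrow> v j (1 - 1 / 2) ?r) (at 1 within {1 / 2..1})"
      unfolding continuous_on_def by (rule bspec) simp
    then have lim2: "((\<lambda>x. v j (x - 1 / 2) ?r) \<longlongrightarrow> v j (1 - 1 / 2) ?r) (at 1 within {1 / 2..<1})"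
      by (rule tendsto_within_subset) auto
    have "\<forall>\<^sub>F x in at 1 within {1 / 2..<1}. v j x t = v j (x - 1 / 2) ?r"
      unfolding eventually_at_filter by (intro always_eventually allI impI shift)
    note lim3 = Lim_transform_eventually[OF lim1 this]
    have "at (1::real) within {1 / 2..<1} \<noteq> bot"
      by (subst trivial_limit_within) (auto intro!: islimpt_greaterThanLessThan2[of "1/2" 1, THEN islimpt_subset])
    then have "v j 1 t = v j (1 - 1 / 2) ?r"
      using lim3 lim2 by (rule tendsto_unique)
    also have "\<dots> = v j 0 (?r + (1 - 1 / 2) / c j)" using r by (intro main[OF j]) auto
    also have "?r + (1 - 1 / 2) / c j = t + 1 / c j" by (simp add: diff_divide_distrib)
    finally show ?thesis .
  qed
  have H: "v j 0 t = sol (\<lambda>j x. Q j x * coord (g0 (clip x)) j) j t" if "j \<in> J" "0 \<le> t" for j t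
  proof (rule sol_unique[OF _ _ that])
    fix j and t :: real assume j: "j \<in> J" and t: "0 \<le> t"
    {
      assume t1: "t < 1 / c j"
      have x: "c j * t \<in> {0..<1}" using t t1 speed_pos[OF j] by (auto simp: field_simps)
      have "AE s in unit_interval. G 0 s = g0 s"
        using aeG[of 0] u(3) f unfolding is_continuous_rep_def by (auto elim!: eventually_elim2)
      then have "G 0 (c j * t) = g0 (c j * t)"
        using continuous_eq_of_AE[OF contG[of 0], of g0 "c j * t"] f x by (auto simp: is_continuous_rep_def)
      then show "v j 0 t = Q j (c j * t) * coord (g0 (clip (c j * t))) j"
        using main[OF j x, of 0] x speed_pos[OF j] by (simp add: v_def)
    }
    have "v j 0 (t + 1 / c j) = v j 1 t" by (rule end_v[OF j t, symmetric])
    also have "\<dots> = Q j 1 * coord (G t 1) j" by (simp only: v_def)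
    also have "\<dots> = (\<Sum>k\<in>sources j. M j k * coord (G t 0) k)"
      by (simp only: G(2)[OF t j] sum_sources[OF j])
    finally show "v j 0 (t + 1 / c j) = (\<Sum>k\<in>sources j. M j k * v k 0 t)" by (simp add: v_def)
  qed
  have "AE s in lborel. s \<noteq> (1::real)" by (rule AE_lborel_singleton)
  with aeG[OF t] show ?thesis
    unfolding AE_unit_interval_iff
  proof eventually_elim
    case (elim x)
    show ?case
    proof (intro impI ballI)
      fix j assume x: "x \<in> {0..1}" and j: "j \<in> J"
      then have "Q j x * coord (u t x) j = v j x t" using elim by (simp add: v_def)
      also have "\<dots> = v j 0 (t + x / c j)" using elim x by (intro main[OF j _ t]) auto
      also have "\<dots> = sol (\<lambda>j x. Q j x * coord (g0 (clip x)) j) j (t + x / c j)"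
        using t x speed_pos[OF j] by (intro H[OF j]) auto
      finally show "Q j x * coord (u t x) j = sol (\<lambda>j x. Q j x * coord (g0 (clip x)) j) j (t + x / c j)" .
    qed
  qed
qed


subsection \<open>The states of the flow\<close>

lemma data_bound_initial:
  assumes "\<And>x. x \<in> {0..1} \<Longrightarrow> norm (g x) \<le> N" "0 \<le> N"
  shows "data_bound (\<lambda>j x. Q j x * coord (g (clip x)) j) (CQ * N)"
  unfolding data_bound_def
proof (intro conjI allI impI)
  show "0 \<le> CQ * N" using CQ_pos assms(2) by simp
  fix x :: real and F assume *: "0 \<le> x \<and> x \<le> 1 \<and> finite F \<and> F \<subseteq> J"
  have "(\<Sum>j\<in>F. norm (Q j x * coord (g (clip x)) j)) \<le> (\<Sum>j\<in>F. CQ * norm (coord (g (clip x)) j))"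
    unfolding norm_mult using Q_bound(1) * by (intro sum_mono mult_right_mono) auto
  also have "\<dots> \<le> CQ * norm (g (clip x))"
    unfolding sum_distrib_left[symmetric] using * CQ_pos by (intro mult_left_mono sum_coord_le_norm) auto
  also have "\<dots> \<le> CQ * N" using assms CQ_pos by (intro mult_left_mono) auto
  finally show "(\<Sum>j\<in>F. norm (Q j x * coord (g (clip x)) j)) \<le> CQ * N" .
qed

text \<open>The state at time \<open>t\<close> that the solution of the delay system describes.\<close>

definition profile :: "(nat \<Rightarrow> real \<Rightarrow> 'k) \<Rightarrow> real \<Rightarrow> real \<Rightarrow> 'k ell1"
  where "profile \<phi> t x = Abs_ell1 (\<lambda>j. if j \<in> J then inverse (Q j x) * sol \<phi> j (t + clip x / c j) else 0)"

text \<open>The bound of the map from the data to the state, on \<open>[0,T]\<close>.\<close>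

definition profile_const :: "real \<Rightarrow> real"
  where "profile_const T = CQ * sol_const (T + 1 / cmin)"

lemma profile_const_nonneg: "0 \<le> profile_const T"
  using CQ_pos sol_const_nonneg by (simp add: profile_const_def)

lemma time_bounds:
  assumes "\<sigma> \<in> c ` J" "0 \<le> t" "t \<le> T" "0 \<le> x" "x \<le> 1"
  shows "0 \<le> t + x / \<sigma> \<and> t + x / \<sigma> \<le> T + 1 / cmin"
proof -
  obtain j where "j \<in> J" "\<sigma> = c j" using assms(1) by blast
  then have "0 < \<sigma>" "cmin \<le> \<sigma>" using speed_pos speed_bounds by auto
  then have "0 \<le> x / \<sigma>" "x / \<sigma> \<le> 1 / cmin"
    using assms speed_min by (auto intro!: frac_le)
  then show ?thesis using assms by linarith
qed

lemma profile:
  assumes B: "data_bound \<phi> B" and t: "0 \<le> t" "t \<le> T"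
  shows "coord (profile \<phi> t x) j = (if j \<in> J then inverse (Q j x) * sol \<phi> j (t + clip x / c j) else 0)"
    and "norm (profile \<phi> t x) \<le> B * profile_const T"
proof -
  let ?y = "\<lambda>j. if j \<in> J then inverse (Q j x) * sol \<phi> j (t + clip x / c j) else 0"
  have "(\<Sum>j\<in>F. norm (?y j)) \<le> B * profile_const T" if F: "finite F" for F
  proof -
    have "(\<Sum>j\<in>F. norm (?y j)) = (\<Sum>j\<in>F \<inter> J. norm (inverse (Q j x)) * norm (sol \<phi> j (t + clip x / c j)))"
      using F by (subst sum.inter_restrict) (auto simp: norm_mult intro!: sum.cong)
    also have "\<dots> \<le> (\<Sum>j\<in>F \<inter> J. CQ * norm (sol \<phi> j (t + clip x / c j)))"
      using Q_bound(2) by (intro sum_mono mult_right_mono) auto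
    also have "\<dots> = CQ * (\<Sum>j\<in>F \<inter> J. norm (sol \<phi> j (t + clip x / c j)))" by (simp add: sum_distrib_left)
    also have "\<dots> \<le> CQ * (B * sol_const (T + 1 / cmin))"
      using F CQ_pos t time_bounds
      by (intro mult_left_mono sol_bound[OF B, where \<tau> = "\<lambda>\<sigma>. t + clip x / \<sigma>"]) auto
    finally show ?thesis by (simp add: profile_const_def mult_ac)
  qed
  from coord_Abs_ell1[of ?y, OF this]
  show "coord (profile \<phi> t x) j = ?y j" "norm (profile \<phi> t x) \<le> B * profile_const T"
    by (simp_all add: profile_def)
qed

lemma sol_clip_measurable:
  assumes "\<And>j. j \<in> J \<Longrightarrow> \<phi> j \<in> borel_measurable borel" "j \<in> J"
  shows "(\<lambda>x. sol \<phi> j (t + clip x / c j)) \<in> borel_measurable borel"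
proof (rule measurable_compose[OF _ sol_measurable[OF assms]])
  show "(\<lambda>x. t + clip x / c j) \<in> borel_measurable borel" unfolding clip_def by measurable
qed

lemma profile_measurable:
  assumes m: "\<And>j. j \<in> J \<Longrightarrow> \<phi> j \<in> borel_measurable borel" and B: "data_bound \<phi> B" and t: "0 \<le> t"
  shows "profile \<phi> t \<in> borel_measurable borel"
proof (rule borel_measurable_coordI)
  fix j
  have "(\<lambda>x. inverse (Q j x) * sol \<phi> j (t + clip x / c j)) \<in> borel_measurable borel" if "j \<in> J"
    using Q_measurable[OF that] sol_clip_measurable[OF m that]
    by (intro borel_measurable_times borel_measurable_inverse)
  then show "(\<lambda>x. coord (profile \<phi> t x) j) \<in> borel_measurable borel"
    using profile(1)[OF B t order_refl] by (cases "j \<in> J") simp_all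
qed

lemma profile_in_X:
  assumes m: "\<And>j. j \<in> J \<Longrightarrow> \<phi> j \<in> borel_measurable borel" and B: "data_bound \<phi> B" and t: "0 \<le> t" "t \<le> T"
  shows "profile \<phi> t \<in> X" "ess_norm (profile \<phi> t) \<le> ennreal (B * profile_const T)"
proof -
  have 1: "profile \<phi> t \<in> borel_measurable borel" by (rule profile_measurable[OF m B t(1)])
  have 2: "profile \<phi> t s \<in> ell1_on J" for s using profile(1)[OF B t] by (simp add: ell1_on_def)
  have 3: "norm (profile \<phi> t s) \<le> B * profile_const T" for s by (rule profile(2)[OF B t])
  show "profile \<phi> t \<in> X" by (rule bochner_LinfI(1)[OF 1 2 3])
  show "ess_norm (profile \<phi> t) \<le> ennreal (B * profile_const T)" by (rule bochner_LinfI(2)[OF 1 2 3])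
qed

lemma sol_integral_along_edge:
  assumes m: "\<And>j. j \<in> J \<Longrightarrow> \<phi> j \<in> borel_measurable borel" and B: "data_bound \<phi> B"
    and t: "0 \<le> t" and j: "j \<in> J" and x: "x \<in> {0..1}"
  shows "(LBINT s:{0..x}. sol \<phi> j (t + clip s / c j))
      = c j *\<^sub>R ((LBINT s:{0..t + x / c j}. sol \<phi> j s) - (LBINT s:{0..t}. sol \<phi> j s))"
    and "set_integrable lborel {0..x} (\<lambda>s. sol \<phi> j (t + clip s / c j))"
proof -
  have cj: "0 < c j" by (rule speed_pos[OF j])
  have "(LBINT s:{0..x}. sol \<phi> j (t + clip s / c j)) = (LBINT s:{0..x}. sol \<phi> j (t + (1 / c j) * s))"
    using x by (intro set_lebesgue_integral_cong) auto
  also have "\<dots> = c j *\<^sub>R (LBINT s:{t..t + x / c j}. sol \<phi> j s)"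
    using set_integral_shift_scale[of "1 / c j" 0 x "sol \<phi> j" t] cj by simp
  also have "(LBINT s:{t..t + x / c j}. sol \<phi> j s) = (LBINT s:{0..t + x / c j}. sol \<phi> j s) - (LBINT s:{0..t}. sol \<phi> j s)"
    using set_integral_split[OF sol_integrable[OF m B j, of 0 "t + x / c j"], of t] t x cj by simp
  finally show "(LBINT s:{0..x}. sol \<phi> j (t + clip s / c j))
      = c j *\<^sub>R ((LBINT s:{0..t + x / c j}. sol \<phi> j s) - (LBINT s:{0..t}. sol \<phi> j s))" .
  show "set_integrable lborel {0..x} (\<lambda>s. sol \<phi> j (t + clip s / c j))"
  proof (rule set_integrable_bounded)
    show "set_borel_measurable borel {0..x} (\<lambda>s. sol \<phi> j (t + clip s / c j))"
      using sol_clip_measurable[OF m j] by (simp add: set_borel_measurable_def)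
    show "norm (sol \<phi> j (t + clip s / c j)) \<le> B * sol_const (t + 1 / cmin)" for s
      using time_bounds[of "c j" t t "clip s"] j t by (intro norm_sol_le[OF B j]) auto
  qed
qed

lemma LINT_profile:
  assumes m: "\<And>j. j \<in> J \<Longrightarrow> \<phi> j \<in> borel_measurable borel" and B: "data_bound \<phi> B"
    and t: "0 \<le> t" and j: "j \<in> J" and x: "x \<in> {0..1}"
  shows "(LINT s|unit_interval. indicator {0..x} s *\<^sub>R (Q j s * coord (profile \<phi> t s) j))
      = c j *\<^sub>R ((LBINT s:{0..t + x / c j}. sol \<phi> j s) - (LBINT s:{0..t}. sol \<phi> j s))"
proof -
  have "(LINT s|unit_interval. indicator {0..x} s *\<^sub>R (Q j s * coord (profile \<phi> t s) j))
      = (LBINT s:{0..x}. sol \<phi> j (t + clip s / c j))"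
  proof (rule LINT_weighted_coord[OF profile_in_X(1)[OF m B t order_refl] sol_clip_measurable[OF m j] _ j x])
    show "AE s in unit_interval. Q j s * coord (profile \<phi> t s) j = sol \<phi> j (t + clip s / c j)"
      using profile(1)[OF B t order_refl] j by (intro AE_I2) simp
  qed
  also have "\<dots> = c j *\<^sub>R ((LBINT s:{0..t + x / c j}. sol \<phi> j s) - (LBINT s:{0..t}. sol \<phi> j s))"
    by (rule sol_integral_along_edge(1)[OF m B t j x])
  finally show ?thesis .
qed

lemma primitive_sol_integral:
  assumes m: "\<And>j. j \<in> J \<Longrightarrow> \<phi> j \<in> borel_measurable borel" and B: "data_bound \<phi> B" and j: "j \<in> J"
  shows "primitive_on T (\<lambda>t. LBINT s:{0..t}. sol \<phi> j s) (sol \<phi> j)"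
  using primitive_on_integral[OF sol_measurable[OF m j], where T = T and M = "B * sol_const T" and z = 0] norm_sol_le[OF B j, of _ T]
  by auto

lemma Q_weights:
  "\<And>j. j \<in> J \<Longrightarrow> Q j \<in> borel_measurable borel" "\<And>j s. j \<in> J \<Longrightarrow> Q j s \<noteq> 0"
  "\<And>j s. j \<in> J \<Longrightarrow> s \<in> {0..1} \<Longrightarrow> norm (Q j s) \<le> CQ"
  "\<And>j s. j \<in> J \<Longrightarrow> s \<in> {0..1} \<Longrightarrow> norm (inverse (Q j s)) \<le> CQ"
  using Q_measurable Q_bound by auto

lemma profile_continuous:
  assumes m: "\<And>j. j \<in> J \<Longrightarrow> \<phi> j \<in> borel_measurable borel" and B: "data_bound \<phi> B" and t: "0 \<le> t"
  shows "limitin (weak_star J) (profile \<phi>) (profile \<phi> t) (at t within {0..})"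
proof (rule bounded_weak_star_limit[where w = Q and B = CQ and M = "B * profile_const (t + 1)"])
  show "\<forall>\<^sub>F r in at t within {0..}. profile \<phi> r \<in> X \<and> ess_norm (profile \<phi> r) \<le> ennreal (B * profile_const (t + 1))"
    using profile_in_X[OF m B] by (intro eventually_at_halfline) blast
  show "profile \<phi> t \<in> X" using t by (intro profile_in_X(1)[OF m B, of _ t]) auto
  fix j and x :: real assume j: "j \<in> J" and x: "x \<in> {0..1}"
  define P where "P = (\<lambda>t. LBINT s:{0..t}. sol \<phi> j s)"
  have P: "continuous_on {0..} P"
    unfolding P_def by (intro continuous_on_halfline primitive_on_continuous[OF primitive_sol_integral[OF m B j]])
  have "((\<lambda>r. c j *\<^sub>R (P (r + x / c j) - P (r + 0))) \<longlongrightarrow> c j *\<^sub>R (P (t + x / c j) - P (t + 0))) (at t within {0..})"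
    using x speed_pos[OF j] by (intro tendsto_intros tendsto_halfline[OF P t]) auto
  moreover have "\<forall>\<^sub>F r in at t within {0..}. c j *\<^sub>R (P (r + x / c j) - P (r + 0))
      = (LINT s|unit_interval. indicator {0..x} s *\<^sub>R (Q j s * coord (profile \<phi> r s) j))"
    using LINT_profile[OF m B _ j x] by (intro eventually_at_halfline) (simp add: P_def)
  ultimately have "((\<lambda>r. LINT s|unit_interval. indicator {0..x} s *\<^sub>R (Q j s * coord (profile \<phi> r s) j)) \<longlongrightarrow>
      c j *\<^sub>R (P (t + x / c j) - P (t + 0))) (at t within {0..})"
    by (rule Lim_transform_eventually)
  then show "((\<lambda>r. LINT s|unit_interval. indicator {0..x} s *\<^sub>R (Q j s * coord (profile \<phi> r s) j)) \<longlongrightarrow>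
      (LINT s|unit_interval. indicator {0..x} s *\<^sub>R (Q j s * coord (profile \<phi> t s) j))) (at t within {0..})"
    using LINT_profile[OF m B t j x] by (simp add: P_def)
qed (fact Q_weights)+

text \<open>
  The difference quotients are bounded because the solution is Lipschitz with values in \<open>\<ell>\<^sup>1\<close>; their
  primitives converge because \<open>sol \<phi> j\<close> is continuous.
\<close>

lemma profile_derivative:
  assumes m: "\<And>j. j \<in> J \<Longrightarrow> \<phi> j \<in> borel_measurable borel" and B: "data_bound \<phi> B"
    and m': "\<And>j. j \<in> J \<Longrightarrow> \<psi> j \<in> borel_measurable borel" and B': "data_bound \<psi> B'"
    and prim: "\<And>j T. j \<in> J \<Longrightarrow> primitive_on T (sol \<phi> j) (sol \<psi> j)" and t: "0 \<le> t"
  shows "limitin (weak_star J) (\<lambda>r s. (1 / (r - t)) *\<^sub>R (profile \<phi> r s - profile \<phi> t s)) (profile \<psi> t) (at t within {0..})"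
proof -
  define T where "T = t + 1"
  define L where "L = B' * sol_const (T + 1 / cmin)"
  have L0: "0 \<le> L" using B' sol_const_nonneg by (auto simp: L_def data_bound_def)
  define K where "K = CQ * (real (card (c ` J)) * L)"
  have K0: "0 \<le> K" using L0 CQ_pos by (simp add: K_def)
  have increment: "norm (profile \<phi> b x - profile \<phi> a x) \<le> K * (b - a)"
    if ab: "0 \<le> a" "a \<le> b" "b \<le> T" for a b x
  proof (rule norm_ell1_le)
    fix F :: "nat set" assume F: "finite F"
    have b0: "0 \<le> b" "a \<le> T" using ab by auto
    let ?d = "\<lambda>j. sol \<phi> j (b + clip x / c j) - sol \<phi> j (a + clip x / c j)"
    have "(\<Sum>j\<in>F. norm (coord (profile \<phi> b x - profile \<phi> a x) j)) = (\<Sum>j\<in>F \<inter> J. norm (inverse (Q j x)) * norm (?d j))"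
    proof -
      have "coord (profile \<phi> b x - profile \<phi> a x) j = (if j \<in> J then inverse (Q j x) * ?d j else 0)" for j
        using profile(1)[OF B ab(1) b0(2)] profile(1)[OF B b0(1) ab(3)] by (simp add: right_diff_distrib)
      then show ?thesis
        unfolding sum.inter_restrict[OF F] by (intro sum.cong refl) (simp add: norm_mult)
    qed
    also have "\<dots> \<le> (\<Sum>j\<in>F \<inter> J. CQ * norm (?d j))"
      using Q_bound(2) by (intro sum_mono mult_right_mono) auto
    also have "\<dots> = CQ * (\<Sum>j\<in>F \<inter> J. norm (?d j))" by (simp add: sum_distrib_left)
    also have "\<dots> \<le> CQ * (real (card (c ` J)) * (L * (b - a)))"
    proof (intro mult_left_mono speed_split)
      fix \<sigma> assume \<sigma>: "\<sigma> \<in> c ` J"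
      let ?F = "{j \<in> F \<inter> J. c j = \<sigma>}" and ?y = "clip x / \<sigma>"
      have a': "0 \<le> a + ?y" and b': "b + ?y \<le> T + 1 / cmin"
        using time_bounds[OF \<sigma>, of a T "clip x"] time_bounds[OF \<sigma>, of b T "clip x"] ab by auto
      have "(\<Sum>j\<in>?F. norm (?d j)) = (\<Sum>j\<in>?F. norm (LBINT s:{a + ?y..b + ?y}. sol \<psi> j s))"
        using ab a' b' by (intro sum.cong refl arg_cong[where f = norm])
          (auto intro!: primitive_on_diff[OF prim[of _ "T + 1 / cmin"]])
      also have "\<dots> \<le> L * ((b + ?y) - (a + ?y))"
      proof (rule sum_norm_set_integral_le)
        show "set_integrable lborel {a + ?y..b + ?y} (sol \<psi> j)" if "j \<in> ?F" for j
          using that a' by (intro sol_integrable[OF m' B']) auto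
        show "(\<Sum>j\<in>?F. norm (sol \<psi> j s)) \<le> L" if "s \<in> {a + ?y..b + ?y}" for s
          using sol_bound[OF B', of ?F "\<lambda>_. s" "T + 1 / cmin"] F that a' b' by (auto simp: L_def)
      qed (use F ab in auto)
      finally show "(\<Sum>j\<in>?F. norm (?d j)) \<le> L * (b - a)" by simp
    qed (use F CQ_pos in auto)
    finally show "(\<Sum>j\<in>F. norm (coord (profile \<phi> b x - profile \<phi> a x) j)) \<le> K * (b - a)"
      by (simp add: K_def mult_ac)
  qed
  let ?q = "\<lambda>r s. (1 / (r - t)) *\<^sub>R (profile \<phi> r s - profile \<phi> t s)"
  have q_bound: "norm (?q r s) \<le> K" if r: "0 \<le> r" "r \<le> t + 1" for r s
  proof (cases "r = t")
    case False
    have "norm (profile \<phi> r s - profile \<phi> t s) \<le> K * \<bar>r - t\<bar>"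
      using increment[of r t s] increment[of t r s] r t
      by (cases "r \<le> t") (auto simp: T_def norm_minus_commute)
    then show ?thesis using False by (simp add: divide_le_eq)
  qed (simp add: K0)
  have q_X: "?q r \<in> X \<and> ess_norm (?q r) \<le> ennreal K" if r: "0 \<le> r" "r \<le> t + 1" for r
  proof -
    have 1: "?q r \<in> borel_measurable borel"
      using profile_measurable[OF m B r(1)] profile_measurable[OF m B t]
      by (intro borel_measurable_scaleR borel_measurable_diff borel_measurable_const)
    have 2: "?q r s \<in> ell1_on J" for s
      using profile(1)[OF B r(1) order_refl] profile(1)[OF B t order_refl] by (simp add: ell1_on_def)
    show ?thesis using bochner_LinfI[OF 1 2 q_bound[OF r]] by blast
  qed
  show ?thesis
  proof (rule bounded_weak_star_limit[where w = Q and B = CQ and M = K])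
    show "\<forall>\<^sub>F r in at t within {0..}. ?q r \<in> X \<and> ess_norm (?q r) \<le> ennreal K"
      using q_X by (rule eventually_at_halfline)
    show "profile \<psi> t \<in> X" using t by (intro profile_in_X(1)[OF m' B', of _ t]) auto
    fix j and x :: real assume j: "j \<in> J" and x: "x \<in> {0..1}"
    have cj: "0 < c j" by (rule speed_pos[OF j])
    define P where "P = (\<lambda>t. LBINT s:{0..t}. sol \<phi> j s)"
    have quot: "((\<lambda>r. (1 / (r - t)) *\<^sub>R (P (r + y) - P (t + y))) \<longlongrightarrow> sol \<phi> j (t + y)) (at t within {0..})" if y: "0 \<le> y" for y
    proof -
      obtain N where N: "0 \<le> N" "\<And>s. s \<in> {0..T + y} \<Longrightarrow> norm (sol \<psi> j s) \<le> N"
        "\<And>a b. a \<in> {0..T + y} \<Longrightarrow> b \<in> {0..T + y} \<Longrightarrow> norm (sol \<phi> j a - sol \<phi> j b) \<le> N * \<bar>a - b\<bar>"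
        using primitive_on_lipschitz[OF prim[OF j, of "T + y"]] by blast
      have "((\<lambda>r. (1 / (r - t)) *\<^sub>R (P (r + y) - P (t + y)) - sol \<phi> j (t + y)) \<longlongrightarrow> 0) (at t within {0..})"
      proof (rule Lim_null_comparison)
        have "norm ((1 / (r - t)) *\<^sub>R (P (r + y) - P (t + y)) - sol \<phi> j (t + y)) \<le> N * \<bar>r - t\<bar>"
          if r: "0 \<le> r" "r \<le> t + 1" "r \<noteq> t" for r
        proof -
          have "norm (P (r + y) - P (t + y) - ((r + y) - (t + y)) *\<^sub>R sol \<phi> j (t + y)) \<le> N * ((r + y) - (t + y))\<^sup>2"
            unfolding P_def by (rule lipschitz_integral_increment[OF N(3) N(1)]) (use r t y in \<open>auto simp: T_def\<close>)
          then have "norm (P (r + y) - P (t + y) - (r - t) *\<^sub>R sol \<phi> j (t + y)) \<le> (N * \<bar>r - t\<bar>) * \<bar>r - t\<bar>"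
            by (simp add: power2_eq_square mult.assoc flip: abs_mult)
          moreover have "(1 / (r - t)) *\<^sub>R (P (r + y) - P (t + y)) - sol \<phi> j (t + y)
              = (1 / (r - t)) *\<^sub>R (P (r + y) - P (t + y) - (r - t) *\<^sub>R sol \<phi> j (t + y))"
            using r(3) by (simp add: scaleR_diff_right)
          ultimately show ?thesis using r(3) by (simp only: norm_scaleR) (simp add: divide_le_eq)
        qed
        then show "\<forall>\<^sub>F r in at t within {0..}. norm ((1 / (r - t)) *\<^sub>R (P (r + y) - P (t + y)) - sol \<phi> j (t + y)) \<le> N * \<bar>r - t\<bar>"
          unfolding eventually_at by (intro exI[of _ 1]) (auto simp: dist_real_def)
        have "((\<lambda>r. N * \<bar>r - t\<bar>) \<longlongrightarrow> N * \<bar>t - t\<bar>) (at t within {0..})" by (intro tendsto_intros)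
        then show "((\<lambda>r. N * \<bar>r - t\<bar>) \<longlongrightarrow> 0) (at t within {0..})" by simp
      qed
      then show ?thesis by (rule LIM_zero_cancel)
    qed
    have "((\<lambda>r. c j *\<^sub>R ((1 / (r - t)) *\<^sub>R (P (r + x / c j) - P (t + x / c j)) - (1 / (r - t)) *\<^sub>R (P (r + 0) - P (t + 0))))
        \<longlongrightarrow> c j *\<^sub>R (sol \<phi> j (t + x / c j) - sol \<phi> j (t + 0))) (at t within {0..})"
      using x cj by (intro tendsto_intros quot) auto
    moreover have "\<forall>\<^sub>F r in at t within {0..}.
        c j *\<^sub>R ((1 / (r - t)) *\<^sub>R (P (r + x / c j) - P (t + x / c j)) - (1 / (r - t)) *\<^sub>R (P (r + 0) - P (t + 0)))
        = (LINT s|unit_interval. indicator {0..x} s *\<^sub>R (Q j s * coord (?q r s) j))"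
    proof (rule eventually_at_halfline)
      fix r :: real assume r: "0 \<le> r" "r \<le> t + 1"
      let ?h = "\<lambda>s. (1 / (r - t)) *\<^sub>R (sol \<phi> j (r + clip s / c j) - sol \<phi> j (t + clip s / c j))"
      have "(LINT s|unit_interval. indicator {0..x} s *\<^sub>R (Q j s * coord (?q r s) j)) = (LBINT s:{0..x}. ?h s)"
      proof (rule LINT_weighted_coord[OF _ _ _ j x])
        show "?q r \<in> X" using q_X[OF r] by blast
        show "?h \<in> borel_measurable borel"
          using sol_clip_measurable[OF m j]
          by (intro borel_measurable_scaleR borel_measurable_diff borel_measurable_const)
        show "AE s in unit_interval. Q j s * coord (?q r s) j = ?h s"
          using profile(1)[OF B r(1) order_refl] profile(1)[OF B t order_refl] j
          by (intro AE_I2) (simp add: right_diff_distrib flip: mult.assoc)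
      qed
      also have "\<dots> = (1 / (r - t)) *\<^sub>R (LBINT s:{0..x}. sol \<phi> j (r + clip s / c j) - sol \<phi> j (t + clip s / c j))"
        by (rule set_integral_scaleR_right)
      also have "(LBINT s:{0..x}. sol \<phi> j (r + clip s / c j) - sol \<phi> j (t + clip s / c j))
          = c j *\<^sub>R (P (r + x / c j) - P r) - c j *\<^sub>R (P (t + x / c j) - P t)"
        unfolding P_def using sol_integral_along_edge[OF m B r(1) j x] sol_integral_along_edge[OF m B t j x]
        by (simp only: set_integral_diff(2))
      finally show "c j *\<^sub>R ((1 / (r - t)) *\<^sub>R (P (r + x / c j) - P (t + x / c j)) - (1 / (r - t)) *\<^sub>R (P (r + 0) - P (t + 0)))
        = (LINT s|unit_interval. indicator {0..x} s *\<^sub>R (Q j s * coord (?q r s) j))"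
        by (simp add: algebra_simps)
    qed
    ultimately have lim: "((\<lambda>r. LINT s|unit_interval. indicator {0..x} s *\<^sub>R (Q j s * coord (?q r s) j))
        \<longlongrightarrow> c j *\<^sub>R (sol \<phi> j (t + x / c j) - sol \<phi> j (t + 0))) (at t within {0..})"
      by (rule Lim_transform_eventually)
    have tx: "0 \<le> t + x / c j" using t x cj by simp
    have "(LINT s|unit_interval. indicator {0..x} s *\<^sub>R (Q j s * coord (profile \<psi> t s) j))
        = c j *\<^sub>R (sol \<phi> j (t + x / c j) - sol \<phi> j (t + 0))"
    proof -
      have "(LBINT s:{0..r}. sol \<psi> j s) = sol \<phi> j r - sol \<phi> j 0" if "0 \<le> r" for r
        using primitive_on_diff[OF prim[OF j, of r], of 0 r] that by simp
      from this[OF t] this[OF tx] LINT_profile[OF m' B' t j x] show ?thesis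
        by simp
    qed
    with lim show "((\<lambda>r. LINT s|unit_interval. indicator {0..x} s *\<^sub>R (Q j s * coord (?q r s) j))
        \<longlongrightarrow> (LINT s|unit_interval. indicator {0..x} s *\<^sub>R (Q j s * coord (profile \<psi> t s) j))) (at t within {0..})"
      by simp
  qed (fact Q_weights)+
qed


lemma primitive_sol_along_edge:
  assumes prim: "primitive_on (t + 1 / c j) (sol \<phi> j) (sol \<psi> j)" and t: "0 \<le> t" and j: "j \<in> J"
    and m: "\<And>j. j \<in> J \<Longrightarrow> \<psi> j \<in> borel_measurable borel" and B: "data_bound \<psi> B"
  shows "primitive_on 1 (\<lambda>x. sol \<phi> j (t + clip x / c j)) (\<lambda>x. (1 / c j) *\<^sub>R sol \<psi> j (t + clip x / c j))"
  unfolding primitive_on_def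
proof (intro conjI ballI)
  have cj: "0 < c j" by (rule speed_pos[OF j])
  show "set_borel_measurable borel {0..1} (\<lambda>x. (1 / c j) *\<^sub>R sol \<psi> j (t + clip x / c j))"
    using sol_clip_measurable[OF m j] by (simp add: set_borel_measurable_def)
  have "norm (sol \<psi> j (t + clip x / c j)) \<le> B * sol_const (t + 1 / cmin)" for x
    using time_bounds[of "c j" t t "clip x"] j t by (intro norm_sol_le[OF B j]) auto
  then have "norm ((1 / c j) *\<^sub>R sol \<psi> j (t + clip x / c j)) \<le> (1 / c j) * (B * sol_const (t + 1 / cmin))" for x
    unfolding norm_scaleR using cj by (intro mult_mono) auto
  then show "\<exists>N. \<forall>s\<in>{0..1}. norm ((1 / c j) *\<^sub>R sol \<psi> j (t + clip s / c j)) \<le> N" by blast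
  fix x :: real assume x: "x \<in> {0..1}"
  have tx: "0 \<le> t + x / c j" "t \<le> t + x / c j" "t + x / c j \<le> t + 1 / c j"
    using x cj t by (auto intro: divide_right_mono)
  have "sol \<phi> j (t + x / c j) - sol \<phi> j t = (LBINT s:{t..t + x / c j}. sol \<psi> j s)"
    by (rule primitive_on_diff[OF prim t tx(2,3)])
  also have "\<dots> = (LBINT s:{0..t + x / c j}. sol \<psi> j s) - (LBINT s:{0..t}. sol \<psi> j s)"
    using set_integral_split[OF sol_integrable[OF m B j, of 0 "t + x / c j"], of t] t tx by simp
  also have "\<dots> = (1 / c j) *\<^sub>R (LBINT s:{0..x}. sol \<psi> j (t + clip s / c j))"
    using sol_integral_along_edge(1)[OF m B t j x] cj by simp
  also have "\<dots> = (LBINT s:{0..x}. (1 / c j) *\<^sub>R sol \<psi> j (t + clip s / c j))"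
    by (rule set_integral_scaleR_right[symmetric])
  finally show "sol \<phi> j (t + clip x / c j) = sol \<phi> j (t + clip 0 / c j)
      + (LBINT s:{0..x}. (1 / c j) *\<^sub>R sol \<psi> j (t + clip s / c j))"
    using x by (simp add: algebra_simps)
qed

text \<open>
  The space derivative of the state \<open>profile \<phi> t\<close>, read off from the equation
  \<open>u\<^sub>t = c u\<^sub>x + q u\<close>, where \<open>profile \<psi> t\<close> is the time derivative.
\<close>

definition profile_deriv ::
  "(nat \<Rightarrow> real \<Rightarrow> 'k) \<Rightarrow> (nat \<Rightarrow> real \<Rightarrow> 'k) \<Rightarrow> real \<Rightarrow> real \<Rightarrow> 'k ell1"
  where "profile_deriv \<phi> \<psi> t x = Abs_ell1 (\<lambda>j. if j \<in> J
    then (1 / c j) *\<^sub>R (coord (profile \<psi> t x) j - qh j x * coord (profile \<phi> t x) j) else 0)"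

lemma profile_deriv:
  shows "coord (profile_deriv \<phi> \<psi> t x) j = (if j \<in> J
    then (1 / c j) *\<^sub>R (coord (profile \<psi> t x) j - qh j x * coord (profile \<phi> t x) j) else 0)"
    and "norm (profile_deriv \<phi> \<psi> t x) \<le> (1 / cmin) * (norm (profile \<psi> t x) + Mq * norm (profile \<phi> t x))"
proof -
  let ?y = "\<lambda>j. if j \<in> J then (1 / c j) *\<^sub>R (coord (profile \<psi> t x) j - qh j x * coord (profile \<phi> t x) j) else 0"
  have "(\<Sum>j\<in>F. norm (?y j)) \<le> (1 / cmin) * (norm (profile \<psi> t x) + Mq * norm (profile \<phi> t x))" if F: "finite F" for F
  proof -
    have "norm (?y j) \<le> (1 / cmin) * (norm (coord (profile \<psi> t x) j) + Mq * norm (coord (profile \<phi> t x) j))" for j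
    proof (cases "j \<in> J")
      case True
      have "norm (coord (profile \<psi> t x) j - qh j x * coord (profile \<phi> t x) j)
          \<le> norm (coord (profile \<psi> t x) j) + Mq * norm (coord (profile \<phi> t x) j)"
        using qh_bound[of j x]
        by (intro order_trans[OF norm_triangle_ineq4] add_mono) (auto simp: norm_mult intro!: mult_right_mono)
      moreover have "1 / c j \<le> 1 / cmin" by (rule delay_le[OF True])
      ultimately have "(1 / c j) * norm (coord (profile \<psi> t x) j - qh j x * coord (profile \<phi> t x) j)
          \<le> (1 / cmin) * (norm (coord (profile \<psi> t x) j) + Mq * norm (coord (profile \<phi> t x) j))"
        using speed_min by (intro mult_mono) auto
      then show ?thesis using True speed_pos[OF True] by simp
    qed (use speed_min Mq_nonneg in simp)
    then have "(\<Sum>j\<in>F. norm (?y j)) \<le> (\<Sum>j\<in>F. (1 / cmin) * (norm (coord (profile \<psi> t x) j) + Mq * norm (coord (profile \<phi> t x) j)))"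
      by (rule sum_mono)
    also have "\<dots> \<le> (1 / cmin) * (norm (profile \<psi> t x) + Mq * norm (profile \<phi> t x))"
      unfolding sum_distrib_left[symmetric] sum.distrib
      using F speed_min Mq_nonneg by (intro mult_left_mono add_mono sum_coord_le_norm) auto
    finally show ?thesis .
  qed
  from coord_Abs_ell1[of ?y, OF this]
  show "coord (profile_deriv \<phi> \<psi> t x) j = ?y j"
    and "norm (profile_deriv \<phi> \<psi> t x) \<le> (1 / cmin) * (norm (profile \<psi> t x) + Mq * norm (profile \<phi> t x))"
    by (simp_all only: profile_deriv_def)
qed

lemma profile_in_domain:
  assumes m: "\<And>j. j \<in> J \<Longrightarrow> \<phi> j \<in> borel_measurable borel" and B: "data_bound \<phi> B"
    and m': "\<And>j. j \<in> J \<Longrightarrow> \<psi> j \<in> borel_measurable borel" and B': "data_bound \<psi> B'"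
    and prim: "\<And>j T. j \<in> J \<Longrightarrow> primitive_on T (sol \<phi> j) (sol \<psi> j)" and t: "0 \<le> t"
  shows "profile \<phi> t \<in> D" "AE s in unit_interval. profile \<psi> t s = A (profile \<phi> t) s"
proof -
  let ?U = "profile \<phi> t" and ?W = "profile_deriv \<phi> \<psi> t"
  define K where "K = (1 / cmin) * (B' * profile_const t + Mq * (B * profile_const t))"
  have U: "?U \<in> X" by (rule profile_in_X(1)[OF m B t order_refl])
  have cU: "coord (?U x) j = (if j \<in> J then inverse (Q j x) * sol \<phi> j (t + clip x / c j) else 0)" for x j
    by (rule profile(1)[OF B t order_refl])
  have cU': "coord (profile \<psi> t x) j = (if j \<in> J then inverse (Q j x) * sol \<psi> j (t + clip x / c j) else 0)" for x j
    by (rule profile(1)[OF B' t order_refl])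
  have W_meas: "?W \<in> borel_measurable borel"
  proof (rule borel_measurable_coordI)
    fix j
    have "(\<lambda>x. (1 / c j) *\<^sub>R (coord (profile \<psi> t x) j - qh j x * coord (?U x) j)) \<in> borel_measurable borel"
      by (intro borel_measurable_scaleR borel_measurable_diff borel_measurable_times borel_measurable_const
          qh_measurable borel_measurable_coord profile_measurable[OF m B t] profile_measurable[OF m' B' t])
    then show "(\<lambda>x. coord (?W x) j) \<in> borel_measurable borel"
      unfolding profile_deriv(1) by (cases "j \<in> J") simp_all
  qed
  have W_norm: "norm (?W x) \<le> K" for x
  proof -
    have "norm (profile \<psi> t x) + Mq * norm (?U x) \<le> B' * profile_const t + Mq * (B * profile_const t)"
      using profile(2)[OF B t order_refl, of x] profile(2)[OF B' t order_refl, of x] Mq_nonneg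
      by (intro add_mono mult_left_mono)
    then show ?thesis
      unfolding K_def using speed_min by (intro order_trans[OF profile_deriv(2)] mult_left_mono) auto
  qed
  have W_J: "?W x \<in> ell1_on J" for x by (simp add: ell1_on_def profile_deriv(1))
  have W: "?W \<in> X" by (rule bochner_LinfI(1)[OF W_meas W_J W_norm])
  have cprim: "primitive_on 1 (\<lambda>x. coord (?U x) j) (\<lambda>x. coord (?W x) j)" for j
  proof (cases "j \<in> J")
    case False
    then show ?thesis
      using primitive_on_integral[of "\<lambda>_. 0 :: 'k" 1 0 0]
      by (simp add: cU profile_deriv(1) set_lebesgue_integral_def)
  next
    case True
    have p: "primitive_on 1 (\<lambda>x. inverse (Q j x) * sol \<phi> j (t + clip x / c j))
        (\<lambda>x. (- rate j x * inverse (Q j x)) * sol \<phi> j (t + clip x / c j)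
          + inverse (Q j x) * ((1 / c j) *\<^sub>R sol \<psi> j (t + clip x / c j)))"
      by (rule primitive_on_bilinear[OF bounded_bilinear_mult primitive_inverse_Q[OF True]
            primitive_sol_along_edge[OF prim[OF True] t True m' B']])
    show ?thesis
      by (rule primitive_on_cong[OF p])
        (auto simp: cU cU' profile_deriv(1) True rate_def scaleR_diff_right scaleR_conv_of_real algebra_simps)
  qed
  have primU: "primitive_on 1 ?U ?W" by (rule primitive_on_of_coord[OF W_meas W_norm cprim])
  have wd: "is_weak_derivative ?U ?W" by (rule primitive_on_imp_weak_derivative[OF primU])
  have cont: "is_continuous_rep ?U ?U"
    using primitive_on_continuous[OF primU] by (simp add: is_continuous_rep_def)
  have boundary: "coord (?U 1) j = (\<Sum>\<^sub>\<infinity>k\<in>J. Bm j k *\<^sub>R coord (?U 0) k)" if j: "j \<in> J" for j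
  proof -
    have "Q j 1 * coord (?U 1) j = sol \<phi> j (t + 1 / c j)" using j by (simp add: cU flip: mult.assoc)
    also have "\<dots> = (\<Sum>k\<in>sources j. M j k * sol \<phi> k t)" by (rule sol_delay[OF j t])
    also have "\<dots> = (\<Sum>k\<in>sources j. M j k * coord (?U 0) k)"
      using sources by (intro sum.cong) (auto simp: cU)
    also have "\<dots> = Q j 1 * (\<Sum>\<^sub>\<infinity>k\<in>J. Bm j k *\<^sub>R coord (?U 0) k)" by (rule sum_sources[OF j])
    finally show ?thesis by simp
  qed
  show dom: "?U \<in> D"
    unfolding flow_domain_def W1inf_def using U W wd cont boundary by blast
  obtain g where d: "weak_derivative (ell1_on J) ?U \<in> X" "is_weak_derivative ?U (weak_derivative (ell1_on J) ?U)"
    using domainE[OF dom] by metis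
  have "AE s in unit_interval. coord (weak_derivative (ell1_on J) ?U s) j = coord (?W s) j" for j
  proof -
    obtain N where N: "0 \<le> N" "AE s in unit_interval. norm (weak_derivative (ell1_on J) ?U s) \<le> N"
      using bochner_Linf_bound[OF d(1)] by blast
    obtain d' where d': "d' \<in> borel_measurable borel"
      "AE s in unit_interval. coord (weak_derivative (ell1_on J) ?U s) j = d' s" "\<And>s. norm (d' s) \<le> N"
      using bounded_coord_rep[OF d(1) N] by blast
    have "primitive_on 1 (\<lambda>x. coord (?U x) j) d'"
      by (rule coord_primitive_of_weak_derivative[OF U d(1) d(2) cont d'(1) d'(3) d'(2)])
    from primitive_on_AE_unique[OF this cprim] d'(2) show ?thesis
      by eventually_elim simp
  qed
  then have "AE s in unit_interval. \<forall>j. coord (weak_derivative (ell1_on J) ?U s) j = coord (?W s) j"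
    by (simp add: AE_all_countable)
  with qh_eq show "AE s in unit_interval. profile \<psi> t s = A ?U s"
  proof eventually_elim
    case (elim s)
    have "(if j \<in> J then c j *\<^sub>R coord (weak_derivative (ell1_on J) ?U s) j + apply_bcontfun (q s) j * coord (?U s) j else 0)
        = (if j \<in> J then inverse (Q j s) * sol \<psi> j (t + clip s / c j) else 0)" for j
    proof (cases "j \<in> J")
      case True
      have "c j *\<^sub>R coord (?W s) j = coord (profile \<psi> t s) j - qh j s * coord (?U s) j"
        using True speed_pos[OF True] by (simp add: profile_deriv(1))
      then show ?thesis using elim True by (simp add: cU')
    qed simp
    then show ?case by (simp add: flow_operator_def profile_def[of \<psi>])
  qed
qed

text \<open>
  For initial values in the domain the data \<open>\<phi>\<close> are primitives and satisfy the boundary condition;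
  \<open>c\<^sub>j \<psi>\<^sub>j\<close> are the data of the time derivative.
\<close>

theorem solution_exists:
  assumes f: "f \<in> D"
  shows "\<exists>u. is_solution (weak_star J) D A f u"
proof -
  let ?d = "weak_derivative (ell1_on J) f"
  obtain g where fX: "f \<in> X" and d: "?d \<in> X" "is_weak_derivative f ?d"
    and rep: "is_continuous_rep f g"
    and bc: "\<And>j. j \<in> J \<Longrightarrow> coord (g 1) j = (\<Sum>\<^sub>\<infinity>k\<in>J. Bm j k *\<^sub>R coord (g 0) k)"
    using domainE[OF f] by metis
  have contg: "continuous_on {0..1} g" and aeg: "AE s in unit_interval. f s = g s"
    using rep by (auto simp: is_continuous_rep_def)
  obtain N where N: "0 \<le> N" "AE s in unit_interval. norm (f s) \<le> N" using bochner_Linf_bound[OF fX] by blast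
  have gN: "norm (g x) \<le> N" if "x \<in> {0..1}" for x by (rule continuous_rep_bound[OF rep N(2) that])
  obtain N' where N': "0 \<le> N'" "AE s in unit_interval. norm (?d s) \<le> N'" using bochner_Linf_bound[OF d(1)] by blast
  obtain d' where d': "d' \<in> borel_measurable borel" "AE s in unit_interval. ?d s = d' s" "\<And>s. norm (d' s) \<le> N'"
    using bounded_borel_rep[of ?d N'] N' d(1) unfolding bochner_Linf_def by blast
  define \<phi> where "\<phi> j x = Q j x * coord (g (clip x)) j" for j x
  define \<psi> where "\<psi> j x = rate j x * \<phi> j x + Q j x * coord (d' x) j" for j x
  let ?\<psi> = "\<lambda>j x. c j *\<^sub>R \<psi> j x"
  have m: "\<phi> j \<in> borel_measurable borel" if "j \<in> J" for j
    using initial_data_measurable[OF contg that] by (simp add: \<phi>_def[abs_def])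
  have m1: "\<psi> j \<in> borel_measurable borel" if "j \<in> J" for j
    unfolding \<psi>_def[abs_def]
    using m[OF that] Q_measurable[OF that] borel_measurable_coord[OF d'(1)] rate_measurable
    by (intro borel_measurable_add borel_measurable_times)
  then have m': "?\<psi> j \<in> borel_measurable borel" if "j \<in> J" for j
    using that by (intro borel_measurable_scaleR borel_measurable_const)
  have B: "data_bound \<phi> (CQ * N)"
    using data_bound_initial[OF gN N(1)] by (simp add: \<phi>_def[abs_def])
  define B' where "B' = Mq * (CQ * N) + \<bar>cmax\<bar> * (CQ * N')"
  have B': "data_bound ?\<psi> B'"
    unfolding data_bound_def
  proof (intro conjI allI impI)
    show "0 \<le> B'" using CQ_pos N(1) N'(1) Mq_nonneg by (simp add: B'_def)
    fix x :: real and F assume *: "0 \<le> x \<and> x \<le> 1 \<and> finite F \<and> F \<subseteq> J"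
    have "norm (?\<psi> j x) \<le> Mq * norm (\<phi> j x) + \<bar>cmax\<bar> * (CQ * norm (coord (d' x) j))" if "j \<in> F" for j
    proof -
      have j: "j \<in> J" using that * by auto
      have "?\<psi> j x = qh j x * \<phi> j x + c j *\<^sub>R (Q j x * coord (d' x) j)"
        using speed_pos[OF j] by (simp add: \<psi>_def rate_def scaleR_add_right)
      also have "norm \<dots> \<le> norm (qh j x * \<phi> j x) + norm (c j *\<^sub>R (Q j x * coord (d' x) j))"
        by (rule norm_triangle_ineq)
      also have "\<dots> \<le> Mq * norm (\<phi> j x) + \<bar>cmax\<bar> * (CQ * norm (coord (d' x) j))"
        unfolding norm_scaleR norm_mult using qh_bound Q_bound(1)[OF j] speed_pos[OF j] speed_bounds[OF j]
        by (intro add_mono mult_mono mult_right_mono) auto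
      finally show ?thesis .
    qed
    then have "(\<Sum>j\<in>F. norm (?\<psi> j x)) \<le> (\<Sum>j\<in>F. Mq * norm (\<phi> j x) + \<bar>cmax\<bar> * (CQ * norm (coord (d' x) j)))"
      by (rule sum_mono)
    also have "\<dots> = Mq * (\<Sum>j\<in>F. norm (\<phi> j x)) + \<bar>cmax\<bar> * (CQ * (\<Sum>j\<in>F. norm (coord (d' x) j)))"
      by (simp add: sum.distrib sum_distrib_left)
    also have "\<dots> \<le> B'"
      unfolding B'_def
    proof (intro add_mono mult_left_mono)
      show "(\<Sum>j\<in>F. norm (\<phi> j x)) \<le> CQ * N" using B * unfolding data_bound_def by blast
      show "(\<Sum>j\<in>F. norm (coord (d' x) j)) \<le> N'" using * d'(3)[of x] sum_coord_le_norm order_trans by blast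
    qed (use Mq_nonneg CQ_pos in auto)
    finally show "(\<Sum>j\<in>F. norm (?\<psi> j x)) \<le> B'" .
  qed
  have "primitive_on 1 (\<phi> j) (\<psi> j)" if j: "j \<in> J" for j
  proof -
    have "AE s in unit_interval. coord (?d s) j = coord (d' s) j"
      using d'(2) by eventually_elim simp
    from coord_primitive_of_weak_derivative[OF fX d rep borel_measurable_coord[OF d'(1)] order_trans[OF norm_coord_le d'(3)] this]
    have "primitive_on 1 (\<lambda>x. coord (g x) j) (\<lambda>x. coord (d' x) j)" .
    from primitive_on_bilinear[OF bounded_bilinear_mult primitive_Q[OF j] this]
    show ?thesis by (rule primitive_on_cong) (auto simp: \<phi>_def \<psi>_def mult.assoc)
  qed
  moreover have "\<phi> j 1 = (\<Sum>k\<in>sources j. M j k * \<phi> k 0)" if j: "j \<in> J" for j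
    using sum_sources[OF j, of "coord (g 0)"] bc[OF j] by (simp add: \<phi>_def)
  ultimately have prim: "primitive_on T (sol \<phi> j) (sol ?\<psi> j)" if "j \<in> J" for j T
    using that by (intro sol_primitive[OF _ _ m1 B']) auto
  let ?u = "profile \<phi>" and ?u' = "profile ?\<psi>"
  have B_loc_profile: "profile \<eta> \<in> B_loc X"
    if mm: "\<And>j. j \<in> J \<Longrightarrow> \<eta> j \<in> borel_measurable borel" and K: "data_bound \<eta> K" for \<eta> K
    unfolding B_loc_def
  proof (intro CollectI conjI allI impI)
    show "profile \<eta> t \<in> X" if "0 \<le> t" for t by (rule profile_in_X(1)[OF mm K that order_refl])
    fix S :: "real set" assume S: "compact S \<and> S \<subseteq> {0..}"
    then obtain T where T: "\<And>t. t \<in> S \<Longrightarrow> norm t \<le> T" using compact_imp_bounded bounded_iff by metis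
    have "ess_norm (profile \<eta> t) \<le> ennreal (K * profile_const T)" if "t \<in> S" for t
      using T[OF that] S that by (intro profile_in_X(2)[OF mm K]) auto
    then show "\<exists>M::real. \<forall>t\<in>S. ess_norm (profile \<eta> t) \<le> ennreal M" by blast
  qed
  have "is_solution (weak_star J) D A f ?u"
    unfolding is_solution_def topspace_weak_star
  proof (intro conjI)
    show "?u \<in> B_loc X" by (rule B_loc_profile[OF m B])
    show "\<forall>t\<ge>0. ?u t \<in> D" using profile_in_domain(1)[OF m B m' B' prim] by blast
    show "AE s in unit_interval. ?u 0 s = f s"
    proof -
      have "AE s in unit_interval. f s \<in> ell1_on J" using fX by (simp add: bochner_Linf_def)
      \<comment> \<open>at \<open>s = 1\<close> the value comes from the boundary condition, no longer from the data\<close>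
      moreover have "AE s in unit_interval. s \<in> {0..<1}"
        unfolding AE_unit_interval_iff using AE_lborel_singleton[of "1::real"] by eventually_elim auto
      ultimately show ?thesis
        using aeg
      proof eventually_elim
        case (elim s)
        show ?case
        proof (rule ell1_eqI)
          fix j
          show "coord (?u 0 s) j = coord (f s) j"
          proof (cases "j \<in> J")
            case True
            have "sol \<phi> j (s / c j) = \<phi> j (c j * (s / c j))"
              using True elim speed_pos[OF True] by (intro sol_initial) (auto intro: divide_strict_right_mono)
            then show ?thesis
              using True elim speed_pos[OF True] profile(1)[OF B order_refl order_refl, of s j]
              by (simp add: \<phi>_def flip: mult.assoc)
          next
            case False
            then show ?thesis using elim profile(1)[OF B order_refl order_refl, of s j] by (simp add: ell1_on_def)
          qed
        qed
      qed
    qed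
    show "\<exists>u'\<in>B_loc X. has_C1_derivative (weak_star J) ?u u' \<and> (\<forall>t\<ge>0. AE s in unit_interval. u' t s = A (?u t) s)"
    proof (intro bexI[of _ ?u'] conjI)
      show "?u' \<in> B_loc X" by (rule B_loc_profile[OF m' B'])
      show "\<forall>t\<ge>0. AE s in unit_interval. ?u' t s = A (?u t) s"
        using profile_in_domain(2)[OF m B m' B' prim] by blast
      show "has_C1_derivative (weak_star J) ?u ?u'"
        unfolding has_C1_derivative_def continuous_map_top_of_set_iff
        using profile_derivative[OF m B m' B' prim] profile_continuous[OF m B] profile_continuous[OF m' B']
        by simp
    qed
  qed
  then show ?thesis by blast
qed

theorem solution_unique:
  assumes f: "f \<in> D" and u: "is_solution (weak_star J) D A f u" and v: "is_solution (weak_star J) D A f v"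
    and t: "0 \<le> t"
  shows "AE s in unit_interval. u t s = v t s"
proof -
  obtain g where rep: "is_continuous_rep f g" using domainE[OF f] by metis
  have X: "AE s in unit_interval. u t s \<in> ell1_on J" "AE s in unit_interval. v t s \<in> ell1_on J"
    using u v t by (auto simp: is_solution_def B_loc_def bochner_Linf_def)
  from X solution_along_characteristics[OF u rep t] solution_along_characteristics[OF v rep t]
  show ?thesis
  proof eventually_elim
    case (elim s)
    show ?case
    proof (rule ell1_eqI)
      fix j
      show "coord (u t s) j = coord (v t s) j"
      proof (cases "j \<in> J")
        case True
        with elim have "Q j s * coord (u t s) j = Q j s * coord (v t s) j" by simp
        then show ?thesis by simp
      qed (use elim in \<open>simp add: ell1_on_def\<close>)
    qed
  qed
qed

lemma solution_eq_profile:
  assumes u: "is_solution (weak_star J) D A f u" and rep: "is_continuous_rep f g" and t: "0 \<le> t"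
    and B: "data_bound (\<lambda>j x. Q j x * coord (g (clip x)) j) B"
  shows "AE s in unit_interval. u t s = profile (\<lambda>j x. Q j x * coord (g (clip x)) j) t s"
proof -
  let ?\<phi> = "\<lambda>j x. Q j x * coord (g (clip x)) j"
  have "AE s in unit_interval. u t s \<in> ell1_on J"
    using u t by (auto simp: is_solution_def B_loc_def bochner_Linf_def)
  moreover have "AE s in unit_interval. s \<in> {0..1::real}" by (intro AE_I2) simp
  ultimately show ?thesis
    using solution_along_characteristics[OF u rep t]
  proof eventually_elim
    case (elim s)
    show ?case
    proof (rule ell1_eqI)
      fix j
      show "coord (u t s) j = coord (profile ?\<phi> t s) j"
      proof (cases "j \<in> J")
        case True
        with elim have "sol ?\<phi> j (t + clip s / c j) = Q j s * coord (u t s) j" by simp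
        then show ?thesis
          using True profile(1)[OF B t order_refl, of s j] by (simp flip: mult.assoc)
      qed (use elim profile(1)[OF B t order_refl, of s j] in \<open>simp add: ell1_on_def\<close>)
    qed
  qed
qed

text \<open>Dependence on the initial value, uniformly for times in \<open>[0,T]\<close>.\<close>

theorem continuous_dependence:
  assumes fn: "\<And>n. f n \<in> D" and u: "\<And>n. is_solution (weak_star J) D A (f n) (u n)"
    and N: "\<And>n. ess_norm (f n) \<le> ennreal N" and lim: "limitin (weak_star J) f (\<lambda>_. 0) sequentially"
    and t: "\<And>n. 0 \<le> t n \<and> t n \<le> T"
  shows "limitin (weak_star J) (\<lambda>n. u n (t n)) (\<lambda>_. 0) sequentially"
proof -
  have fX: "f n \<in> X" for n using domainE[OF fn[of n]] by metis
  have "\<exists>g. is_continuous_rep (f n) g" for n using domainE[OF fn[of n]] by metis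
  then obtain g where rep: "\<And>n. is_continuous_rep (f n) (g n)" by metis
  have contg: "continuous_on {0..1} (g n)" and aeg: "AE s in unit_interval. f n s = g n s" for n
    using rep[of n] by (auto simp: is_continuous_rep_def)
  define K where "K = max N 0"
  have "ess_norm (f n) \<le> ennreal K" for n
    using N[of n] unfolding K_def by (meson ennreal_leI max.cobounded1 order_trans)
  then have "AE s in unit_interval. norm (f n s) \<le> K" for n
    using ess_norm_le_iff[of "f n" K] fX[of n] by (auto simp: K_def bochner_Linf_def)
  then have gK: "norm (g n x) \<le> K" if "x \<in> {0..1}" for n x
    using continuous_rep_bound[OF rep] that by blast
  define \<phi> where "\<phi> n = (\<lambda>j x. Q j x * coord (g n (clip x)) j)" for n
  have m: "\<phi> n j \<in> borel_measurable borel" if "j \<in> J" for n j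
    unfolding \<phi>_def by (rule initial_data_measurable[OF contg that])
  have B: "data_bound (\<phi> n) (CQ * K)" for n
    unfolding \<phi>_def by (rule data_bound_initial[OF gK]) (auto simp: K_def)
  have u_eq: "AE s in unit_interval. u n (t n) s = profile (\<phi> n) (t n) s" for n
    using solution_eq_profile[OF u rep _ B[unfolded \<phi>_def], of "t n" n] t by (simp add: \<phi>_def)
  have uX: "u n (t n) \<in> X" for n using u[of n] t by (auto simp: is_solution_def B_loc_def)
  have data_lim: "(\<lambda>n. LBINT s:{0..x}. \<phi> n j s) \<longlonglongrightarrow> 0" if j: "j \<in> J" and x: "x \<in> {0..1}" for j x
  proof -
    define p where "p s = indicator {0..x} s *\<^sub>R Q j s" for s
    have p: "p \<in> borel_measurable borel" "norm (p s) \<le> CQ" for s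
      using Q_measurable[OF j] Q_bound(1)[OF j, of s] CQ_pos unfolding p_def[abs_def]
      by (measurable, auto simp: indicator_def)
    have "(\<lambda>n. LINT s|unit_interval. coord (f n s) j * p s) \<longlonglongrightarrow> (LINT s|unit_interval. coord (0 :: 'k ell1) j * p s)"
      by (rule weak_star_limit_imp_coord[OF lim j p])
    moreover have "(LINT s|unit_interval. coord (f n s) j * p s) = (LBINT s:{0..x}. \<phi> n j s)" for n
    proof -
      have "AE s in unit_interval. Q j s * coord (f n s) j = \<phi> n j s"
        using aeg[of n] unfolding AE_unit_interval_iff \<phi>_def by eventually_elim auto
      from LINT_weighted_coord[OF fX m[OF j] this j x] show ?thesis
        by (simp add: p_def mult.commute)
    qed
    ultimately show ?thesis by simp
  qed
  show ?thesis
  proof (rule bounded_weak_star_limit[where w = Q and B = CQ and M = "CQ * K * profile_const T"])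
    have "ess_norm (u n (t n)) \<le> ennreal (CQ * K * profile_const T)" for n
    proof -
      have "AE s in unit_interval. norm (u n (t n) s) \<le> CQ * K * profile_const T"
        using u_eq[of n] by eventually_elim (use profile(2)[OF B, of "t n" T n] t in simp)
      moreover have "0 \<le> CQ * K * profile_const T"
        using CQ_pos profile_const_nonneg by (simp add: K_def)
      ultimately show ?thesis
        using ess_norm_le_iff uX[of n] by (auto simp: bochner_Linf_def)
    qed
    with uX show "\<forall>\<^sub>F n in sequentially. u n (t n) \<in> X \<and> ess_norm (u n (t n)) \<le> ennreal (CQ * K * profile_const T)"
      by simp
    show "(\<lambda>_. 0) \<in> X"
      by (rule bochner_LinfI(1)[of _ _ 0]) (auto simp: ell1_on_def)
    fix j and x :: real assume j: "j \<in> J" and x: "x \<in> {0..1}"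
    have tx: "0 \<le> t n + x / c j \<and> t n + x / c j \<le> T + 1 / cmin" for n
      using time_bounds[of "c j" "t n" T x] j x t by auto
    have "(\<lambda>n. c j *\<^sub>R ((LBINT s:{0..t n + x / c j}. sol (\<phi> n) j s) - (LBINT s:{0..t n}. sol (\<phi> n) j s))) \<longlonglongrightarrow> c j *\<^sub>R (0 - 0)"
      by (intro tendsto_intros sol_integral_tendsto_0[OF m B data_lim j tx] sol_integral_tendsto_0[OF m B data_lim j t])
    moreover have "(LINT s|unit_interval. indicator {0..x} s *\<^sub>R (Q j s * coord (u n (t n) s) j))
        = c j *\<^sub>R ((LBINT s:{0..t n + x / c j}. sol (\<phi> n) j s) - (LBINT s:{0..t n}. sol (\<phi> n) j s))" for n
    proof -
      have tn: "0 \<le> t n" using t by auto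
      have "AE s in unit_interval. Q j s * coord (u n (t n) s) j = sol (\<phi> n) j (t n + clip s / c j)"
        using u_eq[of n] by eventually_elim (use profile(1)[OF B tn order_refl] j in simp)
      from LINT_weighted_coord[OF uX sol_clip_measurable[OF m j] this j x]
        sol_integral_along_edge(1)[OF m B tn j x] show ?thesis by simp
    qed
    ultimately show "(\<lambda>n. LINT s|unit_interval. indicator {0..x} s *\<^sub>R (Q j s * coord (u n (t n) s) j))
        \<longlonglongrightarrow> (LINT s|unit_interval. indicator {0..x} s *\<^sub>R (Q j s * coord (0 :: 'k ell1) j))"
      by simp
  qed (fact Q_weights)+
qed

theorem flow_well_posed: "well_posed (weak_star J) D A"
  unfolding well_posed_def
proof (intro conjI ballI allI impI)
  show "\<exists>u. is_solution (weak_star J) D A f u" if "f \<in> D" for f using that by (rule solution_exists)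
  show "AE s in unit_interval. u t s = v t s"
    if "f \<in> D" "is_solution (weak_star J) D A f u \<and> is_solution (weak_star J) D A f v" "0 \<le> t" for f u v t
    using that solution_unique by blast
  fix f u and t0 :: real and U :: "(real \<Rightarrow> 'k ell1) set"
  assume H: "(\<forall>n. f n \<in> D \<and> is_solution (weak_star J) D A (f n) (u n)) \<and>
      (\<exists>M::real. \<forall>n. ess_norm (f n) \<le> ennreal M) \<and> limitin (weak_star J) f (\<lambda>_. 0) sequentially"
    and t0: "0 \<le> t0" and U: "openin (weak_star J) U \<and> (\<lambda>_. 0) \<in> U"
  \<comment> \<open>for each \<open>n\<close>, a time in \<open>[0,t0]\<close> at which the solution is outside \<open>U\<close>, if there is one\<close>
  define t where "t n = (if \<exists>r\<in>{0..t0}. u n r \<notin> U then SOME r. r \<in> {0..t0} \<and> u n r \<notin> U else 0)" for n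
  have t: "t n \<in> {0..t0} \<and> ((\<exists>r\<in>{0..t0}. u n r \<notin> U) \<longrightarrow> u n (t n) \<notin> U)" for n
  proof (cases "\<exists>r\<in>{0..t0}. u n r \<notin> U")
    case True
    then have "\<exists>r. r \<in> {0..t0} \<and> u n r \<notin> U" by blast
    from someI_ex[OF this] True show ?thesis by (simp add: t_def)
  qed (use t0 in \<open>simp add: t_def\<close>)
  obtain N :: real where N: "\<And>n. ess_norm (f n) \<le> ennreal N" using H by blast
  have "limitin (weak_star J) (\<lambda>n. u n (t n)) (\<lambda>_. 0) sequentially"
    using H N t by (intro continuous_dependence[of f u N t t0]) auto
  then have "\<forall>\<^sub>F n in sequentially. u n (t n) \<in> U"
    using U unfolding limitin_def by blast
  then show "\<forall>\<^sub>F n in sequentially. \<forall>t\<in>{0..t0}. u n t \<in> U"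
    by eventually_elim (use t in blast)
qed

end

section \<open>Networks with commensurable speeds\<close>

text \<open>The bounded positive integers \<open>c\<^sub>0/c\<^sub>j\<close> take finitely many values.\<close>

lemma finite_commensurable_speeds:
  fixes c :: "nat \<Rightarrow> real"
  assumes "0 < cmin" "0 < c0" "\<And>j. j \<in> J \<Longrightarrow> cmin \<le> c j" "\<And>j. j \<in> J \<Longrightarrow> c0 / c j \<in> \<nat>"
  shows "finite (c ` J)"
proof (rule finite_subset)
  show "c ` J \<subseteq> (\<lambda>n. c0 / real n) ` {..nat \<lfloor>c0 / cmin\<rfloor>}"
  proof
    fix \<sigma> assume "\<sigma> \<in> c ` J"
    then obtain j where j: "j \<in> J" "\<sigma> = c j" by blast
    then obtain n where n: "c0 / c j = real n" using assms(4) by (auto elim: Nats_cases)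
    have cj: "0 < c j" "cmin \<le> c j" using assms(1,3) j(1) by force+
    have "real n \<le> c0 / cmin"
      unfolding n[symmetric] using assms(1,2) cj by (intro divide_left_mono) auto
    then have "n \<le> nat \<lfloor>c0 / cmin\<rfloor>" by (simp add: le_nat_floor)
    moreover have "c j = c0 / real n" using n cj assms(2) by (metis divide_divide_eq_right nonzero_mult_div_cancel_left order_less_irrefl)
    ultimately show "\<sigma> \<in> (\<lambda>n. c0 / real n) ` {..nat \<lfloor>c0 / cmin\<rfloor>}" using j by blast
  qed
qed simp

lemma bounded_coefficient_rep:
  fixes q :: "real \<Rightarrow> nat \<Rightarrow>\<^sub>C 'k::{real_normed_field, banach, second_countable_topology}"
  assumes "q \<in> bochner_Linf S"
  obtains qh N where "\<And>j. qh j \<in> borel_measurable borel" "0 \<le> N" "\<And>j s. norm (qh j s) \<le> N"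
    "AE s in unit_interval. \<forall>j. apply_bcontfun (q s) j = qh j s"
proof -
  obtain N where N: "0 \<le> N" "AE s in unit_interval. norm (q s) \<le> N" using bochner_Linf_bound[OF assms] by blast
  have sm: "strongly_measurable unit_interval q" using assms by (simp add: bochner_Linf_def)
  have "\<exists>h. h \<in> borel_measurable borel \<and> (AE s in unit_interval. apply_bcontfun (q s) j = h s) \<and> (\<forall>s. norm (h s) \<le> N)" for j
  proof -
    have "AE s in unit_interval. norm (apply_bcontfun (q s) j) \<le> N"
      using N(2) by eventually_elim (rule order_trans[OF norm_bounded])
    then show ?thesis
      by (rule bounded_borel_rep[OF strongly_measurable_compose[OF sm linear_continuous_on[OF bounded_linear_apply_bcontfun]] _ N(1)])
        blast
  qed
  then obtain qh where "\<And>j. qh j \<in> borel_measurable borel"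
    "\<And>j. AE s in unit_interval. apply_bcontfun (q s) j = qh j s" "\<And>j s. norm (qh j s) \<le> N"
    by metis
  with N(1) that[of qh N] show ?thesis by (simp add: AE_all_countable)
qed

theorem corollary2:
  fixes G :: "('v, nat) pre_digraph"
    and w :: "nat \<Rightarrow> nat \<Rightarrow> real"
    and c :: "nat \<Rightarrow> real"
    and cmin cmax c0 :: real
    and q :: "real \<Rightarrow> nat \<Rightarrow>\<^sub>C 'k::{real_normed_field, banach, second_countable_topology}"
  assumes simple: "loopfree_digraph G" "nomulti_digraph G"
    and countable_verts: "countable (verts G)"
    and locally_finite: "\<And>v. v \<in> verts G \<Longrightarrow> finite (in_arcs G v \<union> out_arcs G v)"
    and w_bounds: "\<And>i j. i \<in> arcs G \<Longrightarrow> j \<in> arcs G \<Longrightarrow> 0 \<le> w i j \<and> w i j \<le> 1"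
    and w_adjacent: "\<And>i j. i \<in> arcs G \<Longrightarrow> j \<in> arcs G \<Longrightarrow> w i j \<noteq> 0 \<Longrightarrow> head G j = tail G i"
    and w_stochastic: "\<And>j. j \<in> arcs G \<Longrightarrow> ((\<lambda>i. w i j) has_sum 1) (arcs G)"
    and c_bounds: "0 < cmin" "\<And>j. j \<in> arcs G \<Longrightarrow> cmin \<le> c j \<and> c j \<le> cmax"
    and c_commensurable: "0 < c0" "\<And>j. j \<in> arcs G \<Longrightarrow> c0 / c j \<in> \<nat>"
    and q: "q \<in> bochner_Linf (ellinf_on (arcs G))"
  shows "well_posed (weak_star (arcs G))
    (flow_domain (arcs G) (diag_conjugate c (line_graph_matrix G w)))
    (flow_operator (arcs G) c q)"
proof -
  obtain qh N where qh: "\<And>j. qh j \<in> borel_measurable borel" "0 \<le> N" "\<And>j s. norm (qh j s) \<le> N"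
    "AE s in unit_interval. \<forall>j. apply_bcontfun (q s) j = qh j s"
    by (rule bounded_coefficient_rep[OF q]) (rule that)
  interpret G: wf_digraph G using simple(1) by (simp add: loopfree_digraph_def)
  let ?B = "diag_conjugate c (line_graph_matrix G w)"
  have cpos: "0 < c j" if "j \<in> arcs G" for j using c_bounds(1) c_bounds(2)[OF that] by linarith
  interpret network_flow "arcs G" c cmin cmax "\<bar>cmax\<bar> / cmin" ?B q qh N
  proof
    show "finite (c ` arcs G)"
      using c_bounds c_commensurable by (intro finite_commensurable_speeds[of cmin c0]) auto
    show "finite {k \<in> arcs G. ?B j k \<noteq> 0}" if "j \<in> arcs G" for j
    proof (rule finite_subset)
      show "{k \<in> arcs G. ?B j k \<noteq> 0} \<subseteq> in_arcs G (tail G j)"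
        by (auto simp: diag_conjugate_def line_graph_matrix_def in_arcs_def split: if_splits)
      show "finite (in_arcs G (tail G j))"
        using locally_finite[OF G.tail_in_verts[OF that]] by simp
    qed
    show "(\<Sum>j\<in>F. \<bar>?B j k\<bar>) \<le> \<bar>cmax\<bar> / cmin" if k: "k \<in> arcs G" and F: "finite F" "F \<subseteq> arcs G" for k F
    proof -
      have "\<bar>?B j k\<bar> \<le> (\<bar>cmax\<bar> / cmin) * w j k" if "j \<in> F" for j
      proof -
        have j: "j \<in> arcs G" using that F by auto
        have w: "0 \<le> w j k" using w_bounds[OF j k] by simp
        have "\<bar>?B j k\<bar> \<le> inverse (c j) * w j k * c k"
          using w cpos[OF j] cpos[OF k] by (auto simp: diag_conjugate_def line_graph_matrix_def)
        also have "\<dots> = (c k / c j) * w j k" by (simp add: divide_inverse mult_ac)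
        also have "\<dots> \<le> (\<bar>cmax\<bar> / cmin) * w j k"
          using w cpos[OF j] cpos[OF k] c_bounds(1) c_bounds(2)[OF j] c_bounds(2)[OF k]
          by (intro mult_right_mono frac_le) auto
        finally show ?thesis .
      qed
      then have "(\<Sum>j\<in>F. \<bar>?B j k\<bar>) \<le> (\<bar>cmax\<bar> / cmin) * (\<Sum>j\<in>F. w j k)"
        unfolding sum_distrib_left by (rule sum_mono)
      also have "\<dots> \<le> (\<bar>cmax\<bar> / cmin) * 1"
      proof (rule mult_left_mono)
        show "(\<Sum>j\<in>F. w j k) \<le> 1"
          by (rule finite_sum_le_has_sum[OF w_stochastic[OF k]]) (use F w_bounds k in auto)
      qed (use c_bounds(1) in auto)
      finally show ?thesis by simp
    qed
    show "AE s in unit_interval. \<forall>j\<in>arcs G. apply_bcontfun (q s) j = qh j s"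
      using qh(4) by eventually_elim simp
  qed (use c_bounds qh in auto)
  show ?thesis by (rule flow_well_posed)
qed

end
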